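(* Let $G$ be a finite simple graph that contains neither a triangle nor an ISK4. Then $G$ is a series-parallel graph, or $G$ is a complete bipartite graph, or $G$ has a clique cutset of size at most two, or $G$ has a star cutset.
   Context: Graphs are finite and simple. $G$ contains $H$ if $H$ is isomorphic to an induced subgraph of $G$; $G$ is $F$-free if it does not contain $F$. A subdivision of a graph is obtained by repeatedly replacing an edge $vw$ by a path $v u w$ through a new vertex $u$ (a graph is a subdivision of itself). An ISK4 of $G$ is an induced subgraph of $G$ that is a subdivision of $K_4$; $G$ is ISK4-free if it has no ISK4. A graph is series-parallel if no subgraph (not necessarily induced) of it is a subdivision of $K_4$. A cutset is a set $C$ of vertices such that $G\setminus C$ is disconnected; a clique cutset is a cutset that is a clique; a star cutset is a cutset $C$ containing a vertex $c$ adjacent to all other vertices of $C$. *)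

theory Defs
  imports "Graph_Theory.Graph_Theory"
begin

text \<open>
  A finite simple graph is a \<open>pair_graph\<close>: a finite, loop-free, symmetric digraph whose arcs are
  pairs of vertices, each edge being represented by its two orientations. Arcs as pairs matter here:
  over an arbitrary arc type, a subdivision of \<open>K\<^sub>4\<close> need not arise from a \<open>K\<^sub>4\<close> of the same type,
  because the type may contain no arc joining the ends of the edge that is subdivided.
\<close>

definition is_subdivision_of_K4 :: "'a pair_pre_digraph \<Rightarrow> bool" where
  "is_subdivision_of_K4 H \<longleftrightarrow> (\<exists>B :: 'a pair_pre_digraph. K\<^bsub>4\<^esub> (with_proj B) \<and> subdivision_pair B H)"

text \<open>
  \<open>K\<^bsub>n\<^esub>\<close> is an isomorphism-invariant predicate, so the following says that no induced subgraph
  is isomorphic to the triangle.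
\<close>

definition triangle_free :: "'a pair_pre_digraph \<Rightarrow> bool" where
  "triangle_free G \<longleftrightarrow>
    \<not> (\<exists>H :: 'a pair_pre_digraph. induced_subgraph (with_proj H) (with_proj G) \<and> K\<^bsub>3\<^esub> (with_proj H))"

definition ISK4_of :: "'a pair_pre_digraph \<Rightarrow> 'a pair_pre_digraph \<Rightarrow> bool" where
  "ISK4_of H G \<longleftrightarrow> induced_subgraph (with_proj H) (with_proj G) \<and> is_subdivision_of_K4 H"

definition ISK4_free :: "'a pair_pre_digraph \<Rightarrow> bool" where
  "ISK4_free G \<longleftrightarrow> \<not> (\<exists>H. ISK4_of H G)"

definition series_parallel :: "'a pair_pre_digraph \<Rightarrow> bool" where
  "series_parallel G \<longleftrightarrow>
    \<not> (\<exists>H :: 'a pair_pre_digraph. subgraph (with_proj H) (with_proj G) \<and> is_subdivision_of_K4 H)"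

text \<open>Both sides of a complete bipartite graph are required to be nonempty.\<close>

definition complete_bipartite :: "'a pair_pre_digraph \<Rightarrow> bool" where
  "complete_bipartite G \<longleftrightarrow> (\<exists>m n. m \<ge> 1 \<and> n \<ge> 1 \<and> K\<^bsub>m,n\<^esub> (with_proj G))"

text \<open>
  The library's \<open>connected\<close> is false for the graph without vertices, which must not count as
  disconnected: otherwise the whole vertex set would always be a cutset.
\<close>

definition disconnected :: "('a, 'b) pre_digraph \<Rightarrow> bool" where
  "disconnected G \<longleftrightarrow> verts G \<noteq> {} \<and> \<not> connected G"

definition cutset :: "'a pair_pre_digraph \<Rightarrow> 'a set \<Rightarrow> bool" where
  "cutset G C \<longleftrightarrow> C \<subseteq> pverts G \<and> disconnected (with_proj G \<restriction> (pverts G - C))"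

definition clique :: "'a pair_pre_digraph \<Rightarrow> 'a set \<Rightarrow> bool" where
  "clique G C \<longleftrightarrow> C \<subseteq> pverts G \<and> (\<forall>u\<in>C. \<forall>v\<in>C. u \<noteq> v \<longrightarrow> (u, v) \<in> parcs G)"

definition clique_cutset :: "'a pair_pre_digraph \<Rightarrow> 'a set \<Rightarrow> bool" where
  "clique_cutset G C \<longleftrightarrow> cutset G C \<and> clique G C"

definition star_cutset :: "'a pair_pre_digraph \<Rightarrow> 'a set \<Rightarrow> bool" where
  "star_cutset G C \<longleftrightarrow> cutset G C \<and> (\<exists>c\<in>C. \<forall>v\<in>C. v \<noteq> c \<longrightarrow> (c, v) \<in> parcs G)"

end

theory Submission
  imports Defs
begin

text \<open>
  If a vertex set \<open>X\<close> carries a subdivision of \<open>K\<^sub>4\<close> as a not necessarily induced subgraph and is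
  minimal with this property, then every chord of the subdivision can be used to save a vertex, unless
  \<open>X\<close> is a \<open>K\<^sub>3\<^sub>,\<^sub>3\<close> or a wheel with at least four spokes. Hence, in an ISK4-free and triangle-free
  graph, no set whose vertices have at most three neighbours inside it carries a subdivision of \<open>K\<^sub>4\<close>,
  apart from \<open>K\<^sub>3\<^sub>,\<^sub>3\<close>. So an ISK4 is found without checking paths for stray edges: it suffices
  to bound degrees.

  If the graph contains \<open>K\<^sub>3\<^sub>,\<^sub>3\<close>, take a maximal complete bipartite subgraph with sides \<open>P\<close> and \<open>Q\<close>. A
  connected set outside it has at most one neighbour in each of \<open>P\<close> and \<open>Q\<close>, so either nothing lies
  outside, or the neighbours of an outer component form a clique cutset.

  Otherwise a non-series-parallel graph has a smallest wheel, with centre \<open>x\<close> say. If the non-neighbours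
  of \<open>x\<close> do not induce a connected graph, then the closed neighbourhood of \<open>x\<close> is a star cutset. If
  they do, consider a shortest subpath of the rim that has at least three neighbours of \<open>x\<close>, two of
  which are its ends, and whose ends are joined through a connected set \<open>K\<close> of non-neighbours of \<open>x\<close>
  with no neighbour inside the subpath; let \<open>K\<close> be maximal. By connectivity some non-neighbour \<open>v\<close> of
  \<open>x\<close> sees both \<open>K\<close> and the inside of the subpath. However the neighbours of \<open>x\<close> and of \<open>v\<close> are
  interleaved on the subpath, there is an ISK4, a smaller wheel, or a shorter subpath of the same kind.
\<close>

section \<open>Subdivisions of \<open>K\<^sub>4\<close> as tuples of lists\<close>

text \<open>The pieces from which an ISK4 is assembled are segments of the rim, an induced path
  through \<open>K\<close> and the vertex \<open>v\<close>. Edges between these pieces cannot all be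
  excluded: an end of the segment may see many vertices of the path through \<open>K\<close>. A
  degree bound tolerates them, because a minimal vertex set that is not an ISK4 contains
  \<open>K\<^sub>3\<^sub>,\<^sub>3\<close> or is a wheel whose hub has degree at least four. In
  \<open>K\<^sub>3\<^sub>,\<^sub>3\<close> all degrees are three, so it escapes the bound and has to
  be settled separately.

  Counting vertices, instead of minimality under inclusion, serves for one fact: a non-neighbour of
  the centre has at most two neighbours in a sector between consecutive spokes. This fact concerns
  the fixed path along the rim, so it survives while the subpath shrinks and is closed through sets
  \<open>K\<close> that have nothing to do with the original wheel. Hence the induction runs over
  the length of the subpath.

  Along an induced path, neighbours of one vertex are never consecutive, as there are no triangles;
  this keeps common neighbours of \<open>x\<close> and \<open>v\<close> at degree three.\<close>

fun edges :: "'a list \<Rightarrow> ('a \<times> 'a) set" where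
  "edges (x # y # l) = insert (x, y) (insert (y, x) (edges (y # l)))"
| "edges _ = {}"

lemma edges_append: "edges (xs @ y # ys) = edges (xs @ [y]) \<union> edges (y # ys)"
proof (induction xs)
  case (Cons x xs)
  then show ?case by (cases xs) auto
qed simp

lemma edges_split [simp]: "edges (a # xs @ y # ys @ [b]) = edges (a # xs @ [y]) \<union> edges (y # ys @ [b])"
  using edges_append[of "a # xs" y "ys @ [b]"] by simp

lemma edges_split2 [simp]: "edges (a # xs @ y # z # ys) = edges (a # xs @ [y]) \<union> edges (y # z # ys)"
  using edges_append[of "a # xs" y "z # ys"] by simp

lemma edges_rev: "edges (rev l) = edges l"
proof (induction l rule: edges.induct)
  case (1 x y l)
  have "edges (rev (x # y # l)) = edges (rev (y # l)) \<union> edges [y, x]"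
    using edges_append[of "rev l" y "[x]"] by simp
  with 1 show ?case by auto
qed auto

lemma edges_rev_path [simp]: "edges (b # rev p @ [a]) = edges (a # p @ [b])"
  using edges_rev[of "a # p @ [b]"] by simp

lemma edges_sym: "(x, y) \<in> edges l \<longleftrightarrow> (y, x) \<in> edges l"
  by (induction l rule: edges.induct) auto

lemma edges_subset: "edges l \<subseteq> set l \<times> set l"
  by (induction l rule: edges.induct) auto

text \<open>The branch vertices are \<open>a\<close>, \<open>b\<close>, \<open>c\<close>, \<open>d\<close>; the lists \<open>p\<close>, \<open>q\<close>, \<open>r\<close>, \<open>s\<close>, \<open>t\<close>, \<open>z\<close> are the
  interiors of the paths joining \<open>ab\<close>, \<open>ac\<close>, \<open>ad\<close>, \<open>bc\<close>, \<open>bd\<close>, \<open>cd\<close>. The sets \<open>X\<close>, \<open>B\<close>, \<open>D\<close> of all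
  vertices, branch vertices and edges are recorded because permuting the branch vertices preserves them.\<close>

definition K4_model where
  "K4_model A X B D a b c d p q r s t z \<longleftrightarrow>
     distinct (a # b # c # d # p @ q @ r @ s @ t @ z)
   \<and> X = set (a # b # c # d # p @ q @ r @ s @ t @ z)
   \<and> B = {a, b, c, d}
   \<and> D = edges (a # p @ [b]) \<union> edges (a # q @ [c]) \<union> edges (a # r @ [d])
       \<union> edges (b # s @ [c]) \<union> edges (b # t @ [d]) \<union> edges (c # z @ [d])
   \<and> D \<subseteq> A"

text \<open>Compares two labellings of nearly the same vertices: the old list rearranges the new one
  together with a list \<open>w\<close> of discarded vertices.\<close>

lemma distinct_mset_plus:
  assumes "distinct l" "mset l = mset l' + mset w"
  shows "distinct l'" "set l' \<subseteq> set l" "w \<noteq> [] \<Longrightarrow> set l' \<subset> set l"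
proof -
  have "mset l = mset (l' @ w)" using assms(2) by simp
  then have d: "distinct (l' @ w)" "set l = set (l' @ w)"
    using assms(1) mset_eq_imp_distinct_iff mset_eq_setD by blast+
  then show "distinct l'" "set l' \<subseteq> set l" by auto
  show "set l' \<subset> set l" if "w \<noteq> []" using d that by (cases w) auto
qed

lemma distinct_mset_subset:
  assumes "distinct xs" "set xs \<subseteq> set ys"
  shows "mset xs \<subseteq># mset ys"
proof (rule mset_subset_eqI)
  fix a
  show "count (mset xs) a \<le> count (mset ys) a"
    using assms by (cases "a \<in> set xs") (auto simp: distinct_count_atmost_1 Suc_le_eq)
qed

text \<open>Stated with multisets, so that each relabelling below becomes an equation up to
  reordering that the simplifier decides.\<close>

lemma K4_model_permute:
  assumes "K4_model A X B D a b c d p q r s t z"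
    and "mset (a' # b' # c' # d' # p' @ q' @ r' @ s' @ t' @ z') = mset (a # b # c # d # p @ q @ r @ s @ t @ z)"
    and "B = {a', b', c', d'}"
    and "D = edges (a' # p' @ [b']) \<union> edges (a' # q' @ [c']) \<union> edges (a' # r' @ [d'])
       \<union> edges (b' # s' @ [c']) \<union> edges (b' # t' @ [d']) \<union> edges (c' # z' @ [d'])"
  shows "K4_model A X B D a' b' c' d' p' q' r' s' t' z'"
  using assms mset_eq_imp_distinct_iff[OF assms(2)] mset_eq_setD[OF assms(2)]
  unfolding K4_model_def by metis

text \<open>The three transpositions of neighbouring labels generate all symmetries of the model, so
  a fact about \<open>p\<close> transfers to each of the six paths. Paths traversed in the other
  direction are reversed.\<close>

lemma K4_model_swap12: "K4_model A X B D a b c d p q r s t z \<Longrightarrow> K4_model A X B D b a c d (rev p) s t q r z"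
  by (rule K4_model_permute, assumption)
     (simp_all add: K4_model_def ac_simps Un_ac insert_commute add_mset_commute)

lemma K4_model_swap23: "K4_model A X B D a b c d p q r s t z \<Longrightarrow> K4_model A X B D a c b d q p r (rev s) z t"
  by (rule K4_model_permute, assumption)
     (simp_all add: K4_model_def ac_simps Un_ac insert_commute add_mset_commute)

lemma K4_model_swap34: "K4_model A X B D a b c d p q r s t z \<Longrightarrow> K4_model A X B D a b d c p r q t s (rev z)"
  by (rule K4_model_permute, assumption)
     (simp_all add: K4_model_def ac_simps Un_ac insert_commute add_mset_commute)

lemma K4_model_swap_pairs: "K4_model A X B D a b c d p q r s t z \<Longrightarrow> K4_model A X B D c d a b z (rev q) (rev s) (rev r) (rev t) p"
  by (rule K4_model_permute, assumption)
     (simp_all add: K4_model_def ac_simps Un_ac insert_commute add_mset_commute)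

definition K4_on where
  "K4_on A X \<longleftrightarrow> (\<exists>B D a b c d p q r s t z. K4_model A X B D a b c d p q r s t z)"

lemma K4_onI:
  assumes "distinct (a # b # c # d # p @ q @ r @ s @ t @ z)"
    and "X = set (a # b # c # d # p @ q @ r @ s @ t @ z)"
    and "edges (a # p @ [b]) \<subseteq> A" "edges (a # q @ [c]) \<subseteq> A" "edges (a # r @ [d]) \<subseteq> A"
        "edges (b # s @ [c]) \<subseteq> A" "edges (b # t @ [d]) \<subseteq> A" "edges (c # z @ [d]) \<subseteq> A"
  shows "K4_on A X"
proof -
  have "K4_model A X {a, b, c, d} (edges (a # p @ [b]) \<union> edges (a # q @ [c]) \<union> edges (a # r @ [d])
       \<union> edges (b # s @ [c]) \<union> edges (b # t @ [d]) \<union> edges (c # z @ [d])) a b c d p q r s t z"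
    unfolding K4_model_def using assms by (intro conjI refl Un_least)
  then show ?thesis unfolding K4_on_def by blast
qed

lemma K4_modelD:
  assumes "K4_model A X B D a b c d p q r s t z"
  shows "edges (a # p @ [b]) \<subseteq> A" "edges (a # q @ [c]) \<subseteq> A" "edges (a # r @ [d]) \<subseteq> A"
    "edges (b # s @ [c]) \<subseteq> A" "edges (b # t @ [d]) \<subseteq> A" "edges (c # z @ [d]) \<subseteq> A"
    "distinct (a # b # c # d # p @ q @ r @ s @ t @ z)"
    "X = set (a # b # c # d # p @ q @ r @ s @ t @ z)"
  using assms unfolding K4_model_def by blast+

section \<open>Chords of subdivisions on minimal vertex sets\<close>

locale triangle_free_relation =
  fixes A :: "('a \<times> 'a) set"
  assumes symA: "(x, y) \<in> A \<Longrightarrow> (y, x) \<in> A"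
    and irreflA: "(x, x) \<notin> A"
    and tri_free: "(x, y) \<in> A \<Longrightarrow> (y, z) \<in> A \<Longrightarrow> (x, z) \<notin> A"
begin

text \<open>Two vertices with a common neighbour are non-adjacent here, so such a subgraph is
  automatically induced.\<close>

definition K33_in :: "'a set \<Rightarrow> bool" where
  "K33_in X \<longleftrightarrow> (\<exists>a b c d e f. distinct [a, b, c, d, e, f] \<and> {a, b, c, d, e, f} \<subseteq> X \<and>
      {a, b, c} \<times> {d, e, f} \<subseteq> A)"

lemma K33_in_mono: "K33_in X \<Longrightarrow> X \<subseteq> Y \<Longrightarrow> K33_in Y"
  unfolding K33_in_def by (meson order_trans)

text \<open>Minimality alone: that \<open>X\<close> carries a subdivision is stated separately
  wherever it matters.\<close>

definition min_K4 :: "'a set \<Rightarrow> bool" where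
  "min_K4 X \<longleftrightarrow> (\<forall>Y. K4_on A Y \<longrightarrow> \<not> Y \<subset> X)"

text \<open>The edge \<open>uv\<close> bypasses the part of the path between \<open>u\<close> and
  \<open>v\<close>. This part is nonempty, since otherwise \<open>uv\<close> would be an edge of the
  path.\<close>

lemma shortcut:
  assumes "distinct (a # p @ [b])" "edges (a # p @ [b]) \<subseteq> A"
    and "u \<in> set (a # p @ [b])" "v \<in> set (a # p @ [b])" "(u, v) \<in> A" "(u, v) \<notin> edges (a # p @ [b])"
  shows "\<exists>p'. distinct p' \<and> set p' \<subset> set p \<and> edges (a # p' @ [b]) \<subseteq> A"
proof -
  let ?l = "a # p @ [b]"
  have "\<exists>xs u v ys zs. ?l = xs @ u # ys @ v # zs \<and> (u, v) \<in> A \<and> (u, v) \<notin> edges ?l"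
  proof -
    obtain xs ys where l: "?l = xs @ u # ys" using assms(3) by (metis split_list)
    have "v \<noteq> u" using assms(5) irreflA by auto
    then consider "v \<in> set xs" | "v \<in> set ys" using assms(4) l by (metis Un_iff set_ConsD set_append)
    then show ?thesis
    proof cases
      case 1
      then obtain xs1 xs2 where "xs = xs1 @ v # xs2" by (metis split_list)
      then have "?l = xs1 @ v # xs2 @ u # ys" using l by simp
      then show ?thesis using symA[OF assms(5)] assms(6) edges_sym by metis
    next
      case 2
      then obtain ys1 ys2 where "ys = ys1 @ v # ys2" by (metis split_list)
      then have "?l = xs @ u # ys1 @ v # ys2" using l by simp
      then show ?thesis using assms(5,6) by metis
    qed
  qed
  then obtain xs u v ys zs where l: "?l = xs @ u # ys @ v # zs" and uv: "(u, v) \<in> A" "(u, v) \<notin> edges ?l"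
    by blast
  have ys: "ys \<noteq> []"
  proof
    assume "ys = []"
    then have "edges ?l = edges (xs @ [u]) \<union> edges (u # v # zs)" using l edges_append[of xs u "v # zs"] by simp
    then show False using uv by simp
  qed
  have e1: "edges (xs @ u # v # zs) \<subseteq> A"
  proof -
    have "edges (xs @ u # ys @ v # zs) = edges (xs @ [u]) \<union> edges (u # ys @ [v]) \<union> edges (v # zs)"
      using edges_append[of xs u "ys @ v # zs"] edges_append[of "u # ys" v zs] by auto
    moreover have "edges (xs @ u # v # zs) = edges (xs @ [u]) \<union> {(u,v),(v,u)} \<union> edges (v # zs)"
      using edges_append[of xs u "v # zs"] by auto
    ultimately show ?thesis using assms(2) l uv(1) symA by auto
  qed
  have hd1: "hd (xs @ u # v # zs) = a" using l by (metis append_Nil hd_append list.sel(1))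
  have last1: "last (xs @ u # v # zs) = b"
  proof -
    have "last (xs @ u # v # zs) = last (xs @ u # ys @ v # zs)" by simp
    also have "\<dots> = b" using l by (metis append_is_Nil_conv last.simps last_snoc list.distinct(1))
    finally show ?thesis .
  qed
  let ?L = "xs @ u # v # zs"
  have t: "tl ?L \<noteq> []" "?L = hd ?L # tl ?L" by (cases xs; simp)+
  then have "tl ?L = butlast (tl ?L) @ [last ?L]" by (metis append_butlast_last_id last_tl)
  then obtain p' where p': "?L = a # p' @ [b]" using t(2) hd1 last1 by metis
  have d: "distinct (xs @ u # ys @ v # zs)" using assms(1) l by simp
  then have d': "distinct (a # p' @ [b])" using p'[symmetric] by auto
  have "set (a # p' @ [b]) \<subseteq> set ?l" unfolding l p'[symmetric] by auto
  moreover have "hd ys \<in> set ?l" "hd ys \<notin> set (a # p' @ [b])" using ys d unfolding l p'[symmetric]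
    by (cases ys; auto)+
  ultimately have "set p' \<subset> set p" using d' assms(1) by auto
  then show ?thesis using d' e1 p' by auto
qed

lemma min_K4_smaller:
  assumes "K4_model A X B D a b c d p q r s t z" "min_K4 X"
    and "mset (a # b # c # d # p @ q @ r @ s @ t @ z) =
         mset (a' # b' # c' # d' # p' @ q' @ r' @ s' @ t' @ z') + mset w"
    and "edges (a' # p' @ [b']) \<subseteq> A" "edges (a' # q' @ [c']) \<subseteq> A" "edges (a' # r' @ [d']) \<subseteq> A"
        "edges (b' # s' @ [c']) \<subseteq> A" "edges (b' # t' @ [d']) \<subseteq> A" "edges (c' # z' @ [d']) \<subseteq> A"
  shows "w = []"
proof (rule ccontr)
  assume "w \<noteq> []"
  note * = distinct_mset_plus[OF K4_modelD(7)[OF assms(1)] assms(3)]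
  have "K4_on A (set (a' # b' # c' # d' # p' @ q' @ r' @ s' @ t' @ z'))"
    by (rule K4_onI[OF *(1) refl assms(4-9)])
  moreover have "set (a' # b' # c' # d' # p' @ q' @ r' @ s' @ t' @ z') \<subset> X"
    unfolding K4_modelD(8)[OF assms(1)] using *(3) \<open>w \<noteq> []\<close> by blast
  ultimately show False using assms(2) unfolding min_K4_def by blast
qed

lemma chord_same:
  assumes M: "K4_model A X B D a b c d p q r s t z" and min: "min_K4 X"
    and "u \<in> set (a # p @ [b])" "v \<in> set (a # p @ [b])" "(u, v) \<in> A"
  shows "(u, v) \<in> D"
proof (rule ccontr)
  note m = K4_modelD[OF M]
  assume "(u, v) \<notin> D"
  then have "(u, v) \<notin> edges (a # p @ [b])" using M unfolding K4_model_def by auto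
  moreover have "distinct (a # p @ [b])" using m(7) by auto
  ultimately obtain p' where p': "distinct p'" "set p' \<subset> set p" "edges (a # p' @ [b]) \<subseteq> A"
    using shortcut assms(3-5) m(1) by metis
  then obtain w where w: "mset p = mset p' + mset w" "w \<noteq> []"
  proof -
    have "mset p' \<subseteq># mset p"
      using distinct_mset_subset[OF p'(1)] p'(2) by blast
    then obtain W where W: "mset p = mset p' + W" by (metis subset_mset.le_iff_add)
    obtain w where "mset w = W" using ex_mset by blast
    with W p'(2) show ?thesis using that by (metis add.right_neutral mset.simps(1) mset_eq_setD psubset_eq)
  qed
  show False using min_K4_smaller[OF M min _ p'(3) m(2-6), of w] w by (simp add: ac_simps)
qed

text \<open>With the chord, the model becomes a subdivided prism; the path from \<open>a\<close> to \<open>u\<close> can then be deleted.\<close>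

lemma chord_adjacent_aux:
  assumes M: "K4_model A X B D a b c d p q r s t z" and min: "min_K4 X"
    and p: "p = p1 @ u # p2" and q: "q = q1 @ v # q2" and uv: "(u, v) \<in> A"
  shows "p1 = []"
proof -
  note m = K4_modelD[OF M]
  show ?thesis
    by (rule min_K4_smaller[OF M min, of b c d v s t "rev p2 @ [u]" z "rev q2" "rev r @ a # q1"])
      (use m uv symA in \<open>simp_all add: p q ac_simps add_mset_commute\<close>)
qed

text \<open>The auxiliary lemma, applied also with \<open>p\<close> and \<open>q\<close> exchanged,
  places both \<open>u\<close> and \<open>v\<close> next to \<open>a\<close>, which gives a
  triangle.\<close>

lemma chord_adjacent:
  assumes M: "K4_model A X B D a b c d p q r s t z" and min: "min_K4 X"
    and "u \<in> set p" "v \<in> set q"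
  shows "(u, v) \<notin> A"
proof
  assume uv: "(u, v) \<in> A"
  obtain p1 p2 where p: "p = p1 @ u # p2" using assms(3) by (metis split_list)
  obtain q1 q2 where q: "q = q1 @ v # q2" using assms(4) by (metis split_list)
  have "p1 = []" "q1 = []"
    using chord_adjacent_aux[OF M min p q uv] chord_adjacent_aux[OF K4_model_swap23[OF M] min q p symA[OF uv]] by auto
  then have "(a, u) \<in> A" "(a, v) \<in> A" using K4_modelD(1,2)[OF M] p q by auto
  then show False using uv tri_free by blast
qed

text \<open>With the chord, the model becomes a subdivided \<open>K\<^sub>3\<^sub>,\<^sub>3\<close>, of which any path can be deleted.\<close>

lemma chord_opposite_aux1:
  assumes M: "K4_model A X B D a b c d p q r s t z" and min: "min_K4 X"
    and p: "p = p1 @ u # p2" and z: "z = z1 @ v # z2" and uv: "(u, v) \<in> A"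
  shows "p1 = []"
proof -
  note m = K4_modelD[OF M]
  show ?thesis
    by (rule min_K4_smaller[OF M min, of b v c d "rev p2 @ [u]" s t "rev z1" z2 "rev q @ a # r"])
      (use m uv symA in \<open>simp_all add: p z ac_simps add_mset_commute\<close>)
qed

lemma chord_opposite_aux2:
  assumes M: "K4_model A X B D a b c d p q r s t z" and min: "min_K4 X"
    and p: "p = p1 @ u # p2" and z: "z = z1 @ v # z2" and uv: "(u, v) \<in> A"
  shows "q = []"
proof -
  note m = K4_modelD[OF M]
  show ?thesis
    by (rule min_K4_smaller[OF M min, of b v d u "s @ c # z1" t "rev p2" z2 "[]" "rev r @ a # p1"])
      (use m uv symA in \<open>simp_all add: p z ac_simps add_mset_commute\<close>)
qed

text \<open>By symmetry \<open>p\<close> and \<open>z\<close> shrink to the single vertices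
  \<open>u\<close> and \<open>v\<close> and all other paths are empty, so \<open>{a, b, v}\<close>
  and \<open>{c, d, u}\<close> are the sides.\<close>

lemma chord_opposite:
  assumes M: "K4_model A X B D a b c d p q r s t z" and min: "min_K4 X"
    and "u \<in> set p" "v \<in> set z" and uv: "(u, v) \<in> A"
  shows "K33_in X"
proof -
  obtain p1 p2 where p: "p = p1 @ u # p2" using assms(3) by (metis split_list)
  obtain z1 z2 where z: "z = z1 @ v # z2" using assms(4) by (metis split_list)
  have rp: "rev p = rev p2 @ u # rev p1" and rz: "rev z = rev z2 @ v # rev z1" using p z by auto
  note m = K4_modelD[OF M]
  note sw = K4_model_swap12[OF M] K4_model_swap34[OF M] K4_model_swap34[OF K4_model_swap12[OF M]] K4_model_swap_pairs[OF M] K4_model_swap12[OF K4_model_swap_pairs[OF M]]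
  have "p1 = []" "q = []"
    using chord_opposite_aux1[OF M min p z uv] chord_opposite_aux2[OF M min p z uv] by auto
  moreover have "p2 = []" "s = []"
    using chord_opposite_aux1[OF sw(1) min rp z uv] chord_opposite_aux2[OF sw(1) min rp z uv] by auto
  moreover have "r = []" using chord_opposite_aux2[OF sw(2) min p rz uv] by auto
  moreover have "t = []" using chord_opposite_aux2[OF sw(3) min rp rz uv] by auto
  moreover have "z1 = []" "z2 = []"
    using chord_opposite_aux1[OF sw(4) min z p symA[OF uv]] chord_opposite_aux1[OF sw(5) min rz p symA[OF uv]]
    by auto
  ultimately have "distinct [a, b, v, c, d, u]" "{a, b, v, c, d, u} \<subseteq> X" "{a, b, v} \<times> {c, d, u} \<subseteq> A"
    using m p z uv symA by auto
  then show ?thesis unfolding K33_in_def by blast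
qed

lemma chord_centre_aux1:
  assumes M: "K4_model A X B D a b c d p q r s t z" and min: "min_K4 X"
    and p: "p = p1 @ u # p2" and uv: "(u, c) \<in> A"
  shows "q = []"
proof -
  note m = K4_modelD[OF M]
  show ?thesis
    by (rule min_K4_smaller[OF M min, of c u b d "[]" "rev s" z p2 "rev p1 @ a # r" t])
      (use m uv symA in \<open>simp_all add: p ac_simps add_mset_commute\<close>)
qed

lemma chord_centre_aux2:
  assumes M: "K4_model A X B D a b c d p q r s t z" and min: "min_K4 X"
    and p: "p = p1 @ u # p2" and uv: "(u, c) \<in> A"
  shows "z = []"
proof -
  note m = K4_modelD[OF M]
  show ?thesis
    by (rule min_K4_smaller[OF M min, of a b u c "r @ d # rev t" p1 q "rev p2" s "[]"])
      (use m uv symA in \<open>simp_all add: p ac_simps add_mset_commute\<close>)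
qed

lemma chord_centre:
  assumes M: "K4_model A X B D a b c d p q r s t z" and min: "min_K4 X"
    and "u \<in> set p" and uv: "(u, c) \<in> A"
  shows "q = []" "s = []" "z = []"
proof -
  obtain p1 p2 where p: "p = p1 @ u # p2" using assms(3) by (metis split_list)
  have rp: "rev p = rev p2 @ u # rev p1" using p by auto
  show "q = []" "s = []" "z = []"
    using chord_centre_aux1[OF M min p uv] chord_centre_aux1[OF K4_model_swap12[OF M] min rp uv]
      chord_centre_aux2[OF M min p uv] by auto
qed

end

section \<open>Vertex-minimal subdivisions of \<open>K\<^sub>4\<close>\<close>

text \<open>Up to symmetry these are the positions of two vertices: on one path, inside paths
  sharing a branch vertex, inside opposite paths, or one inside a path and the other a branch vertex
  off it.\<close>

definition chord_position where
  "chord_position u v a b c p q z \<longleftrightarrow>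
     {u, v} \<subseteq> set (a # p @ [b]) \<or> (u \<in> set p \<and> v \<in> set q) \<or> (u \<in> set p \<and> v \<in> set z) \<or> (u \<in> set p \<and> v = c)"

lemma chord_position_interior:
  assumes M: "K4_model A X B D a b c d p q r s t z" and "u \<in> set p" "v \<in> X"
  shows "\<exists>a b c d p q r s t z. K4_model A X B D a b c d p q r s t z \<and> chord_position u v a b c p q z"
proof -
  note sw = K4_model_swap12[OF M] K4_model_swap34[OF M] K4_model_swap34[OF K4_model_swap12[OF M]]
  have "v \<in> {a, b} \<union> set p \<or> v \<in> set q \<or> v \<in> set z \<or> v = c \<or> v = d \<or> v \<in> set r \<or> v \<in> set s \<or> v \<in> set t"
    using assms(3) K4_modelD(8)[OF M] by auto
  then consider "chord_position u v a b c p q z" | "chord_position u v b a c (rev p) s z"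
    | "chord_position u v a b d p r (rev z)" | "chord_position u v b a d (rev p) t (rev z)"
    unfolding chord_position_def using assms(2) by auto
  then show ?thesis using M sw by (cases) blast+
qed

lemma chord_position_exists:
  assumes M: "K4_model A X B D a b c d p q r s t z" and "u \<in> X" "v \<in> X"
  shows "\<exists>a b c d p q r s t z. K4_model A X B D a b c d p q r s t z \<and>
    (chord_position u v a b c p q z \<or> chord_position v u a b c p q z)"
proof -
  note X = K4_modelD(8)[OF M]
  note m23 = K4_model_swap23[OF M]
  note m24 = K4_model_swap23[OF K4_model_swap34[OF M]]
  note m13 = K4_model_swap23[OF K4_model_swap12[OF M]]
  note m14 = K4_model_swap23[OF K4_model_swap34[OF K4_model_swap12[OF M]]]
  note m34 = K4_model_swap_pairs[OF M]
  let ?Q = "\<lambda>x y. \<exists>a b c d p q r s t z. K4_model A X B D a b c d p q r s t z \<and> chord_position x y a b c p q z"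
  have int: "?Q x y" if "x \<in> set p \<union> set q \<union> set r \<union> set s \<union> set t \<union> set z" "y \<in> X" for x y
  proof -
    from that(1) consider "x \<in> set p" | "x \<in> set q" | "x \<in> set r" | "x \<in> set (rev s)" | "x \<in> set (rev t)" | "x \<in> set z"
      by auto
    then show ?thesis
    proof cases
      case 1 from chord_position_interior[OF M 1 that(2)] show ?thesis .
    next
      case 2 from chord_position_interior[OF m23 2 that(2)] show ?thesis .
    next
      case 3 from chord_position_interior[OF m24 3 that(2)] show ?thesis .
    next
      case 4
      then have "x \<in> set s" by simp
      from chord_position_interior[OF m13 this that(2)] show ?thesis .
    next
      case 5
      then have "x \<in> set t" by simp
      from chord_position_interior[OF m14 this that(2)] show ?thesis .
    next
      case 6 from chord_position_interior[OF m34 6 that(2)] show ?thesis .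
    qed
  qed
  have branch: "?Q u v" if "K4_model A X B D a b c d p q r s t z" "{u, v} \<subseteq> {a, b}" for a b c d p q r s t z
  proof -
    have "chord_position u v a b c p q z" using that(2) unfolding chord_position_def by auto
    with that(1) show ?thesis by blast
  qed
  consider "u \<in> set p \<union> set q \<union> set r \<union> set s \<union> set t \<union> set z" | "v \<in> set p \<union> set q \<union> set r \<union> set s \<union> set t \<union> set z"
    | "{u, v} \<subseteq> {a, b}" | "{u, v} \<subseteq> {a, c}" | "{u, v} \<subseteq> {a, d}" | "{u, v} \<subseteq> {b, c}" | "{u, v} \<subseteq> {b, d}" | "{u, v} \<subseteq> {c, d}"
    using assms(2,3) unfolding X by auto
  then have "?Q u v \<or> ?Q v u"
  proof cases
    case 1 from int[OF 1 assms(3)] show ?thesis by (rule disjI1)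
  next
    case 2 from int[OF 2 assms(2)] show ?thesis by (rule disjI2)
  next
    case 3 from branch[OF M 3] show ?thesis by (rule disjI1)
  next
    case 4 from branch[OF m23 4] show ?thesis by (rule disjI1)
  next
    case 5 from branch[OF m24 5] show ?thesis by (rule disjI1)
  next
    case 6 from branch[OF m13 6] show ?thesis by (rule disjI1)
  next
    case 7 from branch[OF m14 7] show ?thesis by (rule disjI1)
  next
    case 8 from branch[OF m34 8] show ?thesis by (rule disjI1)
  qed
  then show ?thesis by blast
qed

text \<open>The rim is an induced cycle, listed from a spoke onwards. With exactly three spokes it
  would form an ISK4 together with the hub, hence the bound four.\<close>

definition wheel where
  "wheel A X x C \<longleftrightarrow> X = insert x (set C) \<and> x \<notin> set C \<and> distinct C \<and> C \<noteq> [] \<and> (x, hd C) \<in> A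
     \<and> (\<forall>u\<in>set C. \<forall>v\<in>set C. (u, v) \<in> A \<longleftrightarrow> (u, v) \<in> edges (C @ [hd C]))
     \<and> 4 \<le> card {v \<in> set C. (x, v) \<in> A}"

lemma K4_model_sym: "K4_model A X B D a b c d p q r s t z \<Longrightarrow> (x, y) \<in> D \<longleftrightarrow> (y, x) \<in> D"
  unfolding K4_model_def by (simp add: edges_sym[of x y])

context triangle_free_relation begin

text \<open>Every chord position except the last is ruled out. The relabelled model keeps
  \<open>B\<close> and \<open>D\<close>, so that the models obtained from two different chords can
  be compared.\<close>

lemma chord_minimal:
  assumes M: "K4_model A X B D a b c d p q r s t z" and min: "min_K4 X" and k33: "\<not> K33_in X"
    and "u \<in> X" "v \<in> X" "(u, v) \<in> A" "(u, v) \<notin> D"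
  shows "\<exists>a b c d p q r s t z. K4_model A X B D a b c d p q r s t z \<and> q = [] \<and> s = [] \<and> z = []
    \<and> c \<in> {u, v} \<and> (\<exists>w\<in>set p. (c, w) \<in> A)"
proof -
  have aux: ?thesis if M: "K4_model A X B D a b c d p q r s t z" and pos: "chord_position x y a b c p q z"
    and xy: "{x, y} = {u, v}" for x y a b c d p q r s t z
  proof -
    have e: "(x, y) \<in> A" "(x, y) \<notin> D" "(y, x) \<in> A"
      using xy assms(6,7) symA K4_model_sym[OF M] unfolding doubleton_eq_iff by metis+
    have 1: "\<not> {x, y} \<subseteq> set (a # p @ [b])" using chord_same[OF M min _ _ e(1)] e(2) by auto
    have 2: "\<not> (x \<in> set p \<and> y \<in> set q)" using chord_adjacent[OF M min] e(1) by auto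
    have 3: "\<not> (x \<in> set p \<and> y \<in> set z)" using chord_opposite[OF M min _ _ e(1)] k33 by auto
    have 4: "x \<in> set p" "y = c" using 1 2 3 pos unfolding chord_position_def by blast+
    have "q = []" "s = []" "z = []" using chord_centre[OF M min 4(1)] e(1) 4(2) by auto
    moreover have "c \<in> {u, v}" using xy 4(2) by auto
    moreover have "\<exists>w\<in>set p. (c, w) \<in> A" using 4 e(3) by auto
    ultimately show ?thesis using M by blast
  qed
  obtain a b c d p q r s t z where "K4_model A X B D a b c d p q r s t z"
    and "chord_position u v a b c p q z \<or> chord_position v u a b c p q z"
    using chord_position_exists[OF M assms(4,5)] by blast
  then show ?thesis using aux[of a b c d p q r s t z u v] aux[of a b c d p q r s t z v u] by auto
qed

text \<open>The end \<open>c\<close> of a chord becomes the hub: it sees \<open>a\<close>,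
  \<open>b\<close>, \<open>d\<close> and a fourth vertex inside \<open>p\<close>. The cycle through
  \<open>p\<close>, \<open>t\<close> and \<open>r\<close> is the rim.\<close>

lemma minimal_K4:
  assumes M: "K4_model A X B D a b c d p q r s t z" and min: "min_K4 X" and k33: "\<not> K33_in X"
    and nind: "\<not> A \<inter> X \<times> X \<subseteq> D"
  shows "\<exists>x C. wheel A X x C"
proof -
  obtain u v where "u \<in> X" "v \<in> X" "(u, v) \<in> A" "(u, v) \<notin> D" using nind by auto
  from chord_minimal[OF M min k33 this] obtain a b c d p r t w
    where M: "K4_model A X B D a b c d p [] r [] t []" and w: "w \<in> set p" "(c, w) \<in> A" by blast
  note m = K4_modelD[OF M]
  have D: "D = edges (a # p @ [b]) \<union> edges [a, c] \<union> edges (a # r @ [d]) \<union> edges [b, c] \<union> edges (b # t @ [d]) \<union> edges [c, d]"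
    and B: "B = {a, b, c, d}" using M unfolding K4_model_def by auto
  have ca: "(c, a) \<in> A" "(c, b) \<in> A" "(c, d) \<in> A" using m by auto
  define C where "C = a # p @ b # t @ d # rev r"
  have X: "X = insert c (set C)" "c \<notin> set C" "distinct C" "C \<noteq> []" "hd C = a" using m unfolding C_def by auto
  have edC: "edges (C @ [a]) = edges (a # p @ [b]) \<union> edges (b # t @ [d]) \<union> edges (a # r @ [d])"
    unfolding C_def
    using edges_append[of "a # p" b "t @ d # rev r @ [a]"] edges_append[of "b # t" d "rev r @ [a]"] by auto
  have 1: "(u, v) \<in> edges (C @ [a])" if uv: "u \<in> set C" "v \<in> set C" "(u, v) \<in> A" for u v
  proof -
    \<comment> \<open>A chord of the rim would give a second hub \<open>c'\<close>, lying on the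
      rim. Both hubs are branch vertices adjacent to all other branch vertices, so together with a
      third one they form a triangle.\<close>
    have "(u, v) \<in> D"
    proof (rule ccontr)
      assume "(u, v) \<notin> D"
      then obtain a' b' c' d' p' r' t'
        where M': "K4_model A X B D a' b' c' d' p' [] r' [] t' []" and c': "c' \<in> {u, v}"
        using chord_minimal[OF M min k33 _ _ uv(3)] uv(1,2) X(1) by blast
      have B': "B = {a', b', c', d'}" and dist: "distinct [a', b', c', d']" using M' unfolding K4_model_def by auto
      have adj: "(c', e) \<in> A" if "e \<in> B" "e \<noteq> c'" for e
        using K4_modelD[OF M'] that symA unfolding B' by auto
      have adjc: "(c, e) \<in> A" if "e \<in> B" "e \<noteq> c" for e using ca that unfolding B by auto
      have "c' \<noteq> c" using c' uv X(2) by auto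
      moreover have "c' \<in> B" "c \<in> B" using B B' by auto
      moreover obtain e where "e \<in> B" "e \<noteq> c" "e \<noteq> c'"
        using dist unfolding B' by (metis distinct.simps(2) insertCI list.set_intros)
      ultimately have "(c, c') \<in> A" "(c', e) \<in> A" "(c, e) \<in> A" using adj adjc by auto
      then show False using tri_free by blast
    qed
    then show ?thesis using uv X(2) unfolding D edC by auto
  qed
  have 2: "(u, v) \<in> A" if "(u, v) \<in> edges (C @ [a])" for u v
    using that m unfolding edC by auto
  have "{a, b, d, w} \<subseteq> {v \<in> set C. (c, v) \<in> A}" unfolding C_def using ca w by auto
  moreover have "w \<noteq> a" "w \<noteq> b" "w \<noteq> d" using m(7) w(1) by auto
  then have "card {a, b, d, w} = 4" using m(7) by auto
  ultimately have "4 \<le> card {v \<in> set C. (c, v) \<in> A}"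
    using card_mono[of "{v \<in> set C. (c, v) \<in> A}" "{a, b, d, w}"] by simp
  then have "wheel A X c C" unfolding wheel_def using X ca 1 2 by auto
  then show ?thesis by blast
qed

end

definition (in triangle_free_relation) degree_in :: "'a \<Rightarrow> 'a set \<Rightarrow> nat" where
  "degree_in v S = card {w \<in> S. (v, w) \<in> A}"

text \<open>\<open>D\<close> always lies inside \<open>A \<inter> X \<times> X\<close>, and equality
  would make the subdivision induced; so the assumption says that every model has a chord.\<close>

locale ISK4_free_relation = triangle_free_relation +
  assumes no_ISK4: "K4_model A X B D a b c d p q r s t z \<Longrightarrow> \<not> A \<inter> X \<times> X \<subseteq> D"
begin

lemma wheel_of_minimal_K4:
  assumes "K4_on A X" "min_K4 X" "\<not> K33_in X"
  shows "\<exists>x C. wheel A X x C"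
  using assms minimal_K4 no_ISK4 unfolding K4_on_def by meson

lemma K4_on_finite: "K4_on A X \<Longrightarrow> finite X"
  unfolding K4_on_def K4_model_def by auto

lemma min_K4_exists:
  assumes "K4_on A X"
  shows "\<exists>Y\<subseteq>X. K4_on A Y \<and> min_K4 Y"
  using K4_on_finite[OF assms] assms
proof (induction X rule: finite_psubset_induct)
  case (psubset X)
  then show ?case unfolding min_K4_def by (metis order_refl order_trans psubset_imp_subset)
qed

text \<open>The degree bound passes to a minimal subset, where only a wheel is left, and its hub has
  at least four neighbours.\<close>

lemma no_K4_of_small_degree:
  assumes "K4_on A X" "\<not> K33_in X"
    and deg: "\<And>v. v \<in> X \<Longrightarrow> degree_in v X \<le> 3"
  shows False
proof -
  obtain Y where Y: "Y \<subseteq> X" "K4_on A Y" "min_K4 Y" using min_K4_exists[OF assms(1)] by blast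
  moreover have "\<not> K33_in Y" using Y(1) assms(2) unfolding K33_in_def by (meson order_trans)
  ultimately obtain x C where w: "wheel A Y x C" using wheel_of_minimal_K4 by blast
  then have "x \<in> X" using Y unfolding wheel_def by auto
  then have "degree_in x X \<le> 3" by (rule deg)
  moreover have "card {v \<in> set C. (x, v) \<in> A} \<le> degree_in x X"
    unfolding degree_in_def using w Y K4_on_finite[OF assms(1)] unfolding wheel_def by (intro card_mono) auto
  ultimately show False using w unfolding wheel_def by auto
qed

end

section \<open>Connected sets and induced paths\<close>

lemma edges_append2: "l \<noteq> [] \<Longrightarrow> l' \<noteq> [] \<Longrightarrow> edges (l @ l') = edges l \<union> edges l' \<union> {(last l, hd l'), (hd l', last l)}"
proof (induction l rule: edges.induct)
  case (1 x y l)
  then show ?case by auto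
next
  case ("2_2" x)
  then show ?case by (cases l') auto
qed auto

lemma edges_Cons2: "l \<noteq> [] \<Longrightarrow> edges (u # l) = edges l \<union> {(u, hd l), (hd l, u)}"
  by (cases l) auto

lemma edges_snoc: "l \<noteq> [] \<Longrightarrow> edges (l @ [w]) = edges l \<union> {(last l, w), (w, last l)}"
  using edges_append2[of l "[w]"] by auto

lemma edges_hd: "distinct (a # l) \<Longrightarrow> (a, w) \<in> edges (a # l) \<Longrightarrow> w = hd l"
  using edges_subset[of l] by (cases l) auto

lemma edges_last: "distinct (l @ [a]) \<Longrightarrow> (a, w) \<in> edges (l @ [a]) \<Longrightarrow> w = last l"
  using edges_hd[of a "rev l" w] edges_rev[of "l @ [a]"] by (cases "l = []") (auto simp: hd_rev)

lemma edges_inner: "distinct l \<Longrightarrow> \<exists>e f. \<forall>w. (v, w) \<in> edges l \<longrightarrow> w \<in> {e, f}"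
proof (cases "v \<in> set l")
  case True
  then obtain xs ys where l: "l = xs @ v # ys" by (metis split_list)
  assume "distinct l"
  then have "distinct (xs @ [v])" "distinct (v # ys)" using l by auto
  then have "\<forall>w. (v, w) \<in> edges l \<longrightarrow> w \<in> {last xs, hd ys}"
    unfolding l edges_append[of xs v ys] using edges_hd edges_last by fast
  then show ?thesis by blast
next
  case False
  then show ?thesis using edges_subset[of l] by blast
qed

context triangle_free_relation begin

lemma degree_in_le_length: "(\<And>w. w \<in> S \<Longrightarrow> (v, w) \<in> A \<Longrightarrow> w \<in> set l) \<Longrightarrow> degree_in v S \<le> length l"
  unfolding degree_in_def using card_mono[of "set l" "{w \<in> S. (v, w) \<in> A}"] card_length[of l] by fastforce

text \<open>Stated by cuts instead of paths: its failure is a separation, and an edge leaving a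
  proper part is obtained in one step. The empty set counts as connected.\<close>

definition connected_on :: "'a set \<Rightarrow> bool" where
  "connected_on K \<longleftrightarrow> (\<forall>L. L \<subseteq> K \<longrightarrow> L \<noteq> {} \<longrightarrow> L \<noteq> K \<longrightarrow> (\<exists>u\<in>L. \<exists>v\<in>K - L. (u, v) \<in> A))"

lemma connected_on_Un:
  assumes "connected_on K" "connected_on L" "k \<in> K" "l \<in> L" "(k, l) \<in> A"
  shows "connected_on (K \<union> L)"
  unfolding connected_on_def
proof (intro allI impI)
  fix M assume M: "M \<subseteq> K \<union> L" "M \<noteq> {}" "M \<noteq> K \<union> L"
  show "\<exists>u\<in>M. \<exists>w\<in>K \<union> L - M. (u, w) \<in> A"
  proof (cases "(M \<inter> K = {} \<or> K \<subseteq> M) \<and> (M \<inter> L = {} \<or> L \<subseteq> M)")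
    case True
    then consider "M \<inter> K = {}" "L \<subseteq> M" | "K \<subseteq> M" "M \<inter> L = {}" using M by blast
    then show ?thesis
    proof cases
      case 1
      then have "l \<in> M" "k \<in> K \<union> L - M" using assms(3,4) by auto
      then show ?thesis using symA[OF assms(5)] by blast
    next
      case 2
      then have "k \<in> M" "l \<in> K \<union> L - M" using assms(3,4) by auto
      then show ?thesis using assms(5) by blast
    qed
  next
    case False
    then consider "M \<inter> K \<subseteq> K" "M \<inter> K \<noteq> {}" "M \<inter> K \<noteq> K" | "M \<inter> L \<subseteq> L" "M \<inter> L \<noteq> {}" "M \<inter> L \<noteq> L" by blast
    then show ?thesis
    proof cases
      case 1
      then obtain u w where "u \<in> M \<inter> K" "w \<in> K - M \<inter> K" "(u, w) \<in> A" using assms(1) unfolding connected_on_def by meson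
      then show ?thesis by blast
    next
      case 2
      then obtain u w where "u \<in> M \<inter> L" "w \<in> L - M \<inter> L" "(u, w) \<in> A" using assms(2) unfolding connected_on_def by meson
      then show ?thesis by blast
    qed
  qed
qed

lemma connected_on_singleton: "connected_on {v}"
  unfolding connected_on_def by blast

lemma connected_on_insert: "connected_on K \<Longrightarrow> k \<in> K \<Longrightarrow> (k, v) \<in> A \<Longrightarrow> connected_on (insert v K)"
  using connected_on_Un[OF _ connected_on_singleton, of K k v v] by simp

text \<open>The set \<open>L\<close> of ends of such paths is closed under adjacency in
  \<open>K\<close>: a neighbour of an end either extends the path or already lies on it, and then
  the path is cut there.\<close>

lemma connected_on_walk:
  assumes "connected_on K" "a \<notin> K" "(a, k) \<in> A" "k \<in> K" "k' \<in> K"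
  shows "\<exists>r. set r \<subseteq> K \<and> distinct (r @ [k']) \<and> edges (a # r @ [k']) \<subseteq> A"
proof -
  define L where "L = {k' \<in> K. \<exists>r. set r \<subseteq> K \<and> distinct (r @ [k']) \<and> edges (a # r @ [k']) \<subseteq> A}"
  have "k \<in> L" unfolding L_def using assms symA by (auto intro!: exI[of _ "[]"])
  have "L = K"
  proof (rule ccontr)
    assume "L \<noteq> K"
    moreover have "L \<subseteq> K" "L \<noteq> {}" using \<open>k \<in> L\<close> unfolding L_def by auto
    ultimately obtain u w where uw: "u \<in> L" "w \<in> K - L" "(u, w) \<in> A"
      using assms(1) unfolding connected_on_def by meson
    then obtain r where r: "set r \<subseteq> K" "distinct (r @ [u])" "edges (a # r @ [u]) \<subseteq> A" unfolding L_def by blast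
    have "w \<in> set r"
    proof (rule ccontr)
      assume "w \<notin> set r"
      then have "distinct ((r @ [u]) @ [w])" using r uw by auto
      moreover have "edges (a # (r @ [u]) @ [w]) \<subseteq> A"
        using r(3) uw(3) symA edges_append[of "a # r" u "[w]"] by auto
      moreover have "set (r @ [u]) \<subseteq> K" using r(1) uw(1) L_def by auto
      ultimately have "w \<in> L" using uw(2) unfolding L_def by blast
      then show False using uw by blast
    qed
    then obtain r1 r2 where r12: "r = r1 @ w # r2" by (metis split_list)
    then have "set r1 \<subseteq> K" "distinct (r1 @ [w])" "edges (a # r1 @ [w]) \<subseteq> A"
      using r edges_append[of "a # r1" w "r2 @ [u]"] by auto
    then have "w \<in> L" using uw unfolding L_def by blast
    then show False using uw by blast
  qed
  then show ?thesis using assms(5) unfolding L_def by blast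
qed

text \<open>A path with the fewest inner vertices has no chord, by \<open>shortcut\<close>.\<close>

lemma connected_on_induced_path:
  assumes "connected_on K" "a \<notin> K" "b \<notin> K" "a \<noteq> b" "(a, k) \<in> A" "k \<in> K" "(b, k') \<in> A" "k' \<in> K"
  shows "\<exists>r. set r \<subseteq> K \<and> distinct (a # r @ [b]) \<and> edges (a # r @ [b]) \<subseteq> A \<and>
    (\<forall>u\<in>set (a # r @ [b]). \<forall>v\<in>set (a # r @ [b]). (u, v) \<in> A \<longrightarrow> (u, v) \<in> edges (a # r @ [b]))"
proof -
  define P where "P r \<longleftrightarrow> set r \<subseteq> K \<and> distinct (a # r @ [b]) \<and> edges (a # r @ [b]) \<subseteq> A" for r
  obtain r where r: "set r \<subseteq> K" "distinct (r @ [k'])" "edges (a # r @ [k']) \<subseteq> A"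
    using connected_on_walk[OF assms(1,2,5,6,8)] by blast
  have "P (r @ [k'])"
    unfolding P_def using r assms symA edges_append[of "a # r" k' "[b]"] by auto
  then obtain r where r: "P r" "\<And>r'. P r' \<Longrightarrow> card (set r) \<le> card (set r')"
    using exists_least_iff[of "\<lambda>n. \<exists>r. P r \<and> card (set r) = n"] by (metis not_less)
  have "(u, v) \<in> edges (a # r @ [b])" if uv: "u \<in> set (a # r @ [b])" "v \<in> set (a # r @ [b])" "(u, v) \<in> A" for u v
  proof (rule ccontr)
    assume "(u, v) \<notin> edges (a # r @ [b])"
    then obtain r' where r': "distinct r'" "set r' \<subset> set r" "edges (a # r' @ [b]) \<subseteq> A"
      using shortcut[OF _ _ uv] r(1) unfolding P_def by blast
    then have "P r'" using r(1) unfolding P_def by auto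
    then show False using r(2) psubset_card_mono[OF _ r'(2)] by fastforce
  qed
  then show ?thesis using r(1) unfolding P_def by blast
qed

end

section \<open>Paths that meet the neighbourhood of a fixed vertex\<close>

text \<open>In the application the path is the rim of a wheel up to its last spoke. Indices make
  positions of neighbours a matter of linear arithmetic; a spoke is an index \<open>t\<close> with
  \<open>(x, q t) \<in> A\<close>.\<close>

locale spoke_path = ISK4_free_relation +
  fixes q :: "nat \<Rightarrow> 'a" and N :: nat and x :: 'a
  assumes path_adj: "i \<le> N \<Longrightarrow> j \<le> N \<Longrightarrow> (q i, q j) \<in> A \<longleftrightarrow> i = Suc j \<or> j = Suc i"
    and path_inj: "inj_on q {..N}"
    and x_notin: "i \<le> N \<Longrightarrow> q i \<noteq> x"
    and no_K33: "\<not> K33_in UNIV"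
begin

lemma common_nbrs_apart: "t \<le> N \<Longrightarrow> s \<le> N \<Longrightarrow> (u, q t) \<in> A \<Longrightarrow> (u, q s) \<in> A \<Longrightarrow> t \<noteq> Suc s"
  using tri_free[of u "q t" "q s"] path_adj by blast

lemma q_eq: "i \<le> N \<Longrightarrow> j \<le> N \<Longrightarrow> q i = q j \<longleftrightarrow> i = j"
  using path_inj unfolding inj_on_def by auto

lemma edges_seg: "b \<le> Suc N \<Longrightarrow> edges (map q [a..<b]) \<subseteq> A"
proof (induction b)
  case (Suc b)
  show ?case
  proof (cases "a < b")
    case True
    then have "edges (map q [a..<Suc b]) = edges (map q [a..<b]) \<union> {(q (b - 1), q b), (q b, q (b - 1))}"
      using edges_snoc[of "map q [a..<b]" "q b"] by (simp add: last_map)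
    then show ?thesis using Suc True path_adj by auto
  qed auto
qed auto

text \<open>The empty segment \<open>a = b\<close> is included, because the constructions degenerate
  in this way when an attachment is itself a branch vertex.\<close>

lemma edges_seg_ends:
  assumes "a \<le> b" "b \<le> Suc N" "a < b \<Longrightarrow> (u, q a) \<in> A" "a < b \<Longrightarrow> (q (b - 1), w) \<in> A" "a = b \<Longrightarrow> (u, w) \<in> A"
  shows "edges (u # map q [a..<b] @ [w]) \<subseteq> A"
proof (cases "a = b")
  case True
  then show ?thesis using assms(5) symA by auto
next
  case False
  then have ab: "a < b" using assms(1) by auto
  then have "edges (u # map q [a..<b] @ [w]) =
      edges (map q [a..<b]) \<union> {(u, q a), (q a, u)} \<union> {(q (b - 1), w), (w, q (b - 1))}"
    using edges_snoc[of "u # map q [a..<b]" w] by (simp add: last_map hd_map edges_Cons2)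
  then show ?thesis using assms ab edges_seg symA by auto
qed

lemma edges_seg_q:
  assumes "a < b" "b \<le> N"
  shows "edges (q a # map q [Suc a..<b] @ [q b]) \<subseteq> A"
  by (rule edges_seg_ends) (use assms path_adj in auto)

lemma no_K4_listed:
  assumes "distinct (a # b # c # d # i1 @ i2 @ i3 @ i4 @ i5 @ i6)"
    "edges (a # i1 @ [b]) \<subseteq> A" "edges (a # i2 @ [c]) \<subseteq> A" "edges (a # i3 @ [d]) \<subseteq> A"
    "edges (b # i4 @ [c]) \<subseteq> A" "edges (b # i5 @ [d]) \<subseteq> A" "edges (c # i6 @ [d]) \<subseteq> A"
    "\<And>v. v \<in> set (a # b # c # d # i1 @ i2 @ i3 @ i4 @ i5 @ i6) \<Longrightarrow>
      degree_in v (set (a # b # c # d # i1 @ i2 @ i3 @ i4 @ i5 @ i6)) \<le> 3"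
  shows False
proof -
  let ?X = "set (a # b # c # d # i1 @ i2 @ i3 @ i4 @ i5 @ i6)"
  have 1: "K4_on A ?X" by (rule K4_onI[OF assms(1) refl]) (fact assms(2-7))+
  have 2: "\<not> K33_in ?X" using no_K33 K33_in_mono[OF _ subset_UNIV] by blast
  show False by (rule no_K4_of_small_degree[OF 1 2]) (rule assms(8))
qed

end

text \<open>\<open>L\<close> continues the path from its end \<open>q h\<close> to a vertex \<open>v\<close> whose first and last neighbours strictly
  between \<open>q l\<close> and \<open>q h\<close> are \<open>q i\<close> and \<open>q j\<close>. Together with \<open>q j, \<dots>, q h\<close> it forms a cycle on which
  \<open>x\<close> has exactly the two neighbours \<open>q y\<close> and \<open>q h\<close>; each lemma below finds a third path from \<open>x\<close> to it.\<close>

locale attached_path = spoke_path +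
  fixes l h i j y :: nat and v :: 'a and L :: "'a list"
  assumes ord: "l < i" "i \<le> j" "j \<le> y" "y < h" "h \<le> N"
    and sp: "(x, q l) \<in> A" "(x, q y) \<in> A" "(x, q h) \<in> A"
    and y_only: "j \<le> t \<Longrightarrow> t < h \<Longrightarrow> (x, q t) \<in> A \<Longrightarrow> t = y"
    and vi: "(v, q i) \<in> A" and vj: "(v, q j) \<in> A"
    and v_range: "l < t \<Longrightarrow> t < h \<Longrightarrow> (v, q t) \<in> A \<Longrightarrow> i \<le> t \<and> t \<le> j"
    and L_ne: "L \<noteq> []" and L_last: "last L = v" and L_dist: "distinct (q h # L)"
    and L_ed: "edges (q h # L) \<subseteq> A"
    and L_ind: "u \<in> set (q h # L) \<Longrightarrow> w \<in> set (q h # L) \<Longrightarrow> (u, w) \<in> A \<Longrightarrow> (u, w) \<in> edges (q h # L)"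
    and L_x: "x \<notin> set L" "u \<in> set L \<Longrightarrow> (x, u) \<notin> A"
    and L_disj: "t \<in> {l..h} \<Longrightarrow> q t \<notin> set L"
    and L_anti: "u \<in> set L \<Longrightarrow> u \<noteq> v \<Longrightarrow> l < t \<Longrightarrow> t < h \<Longrightarrow> (u, q t) \<notin> A"
begin

lemma L_two_nbrs: "\<exists>e f. \<forall>w\<in>set (q h # L). (u, w) \<in> A \<longrightarrow> u \<in> set L \<longrightarrow> w \<in> {e, f}"
  using edges_inner[OF L_dist, of u] L_ind by (metis list.set_intros(2))

lemma h_nbr_on_L: "w \<in> set L \<Longrightarrow> (q h, w) \<in> A \<Longrightarrow> w = hd L"
  using L_ind[of "q h" w] edges_hd[OF L_dist] by auto

lemma v_nbr_on_L: "w \<in> set (q h # L) \<Longrightarrow> (v, w) \<in> A \<Longrightarrow> w = last (q h # butlast L)"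
proof -
  assume w: "w \<in> set (q h # L)" "(v, w) \<in> A"
  have L: "q h # L = (q h # butlast L) @ [v]" using L_ne L_last append_butlast_last_id[of L] by simp
  have "(v, w) \<in> edges (q h # L)" using w L_ind[of v w] L_ne L_last by auto
  then show "w = last (q h # butlast L)" using edges_last[of "q h # butlast L" v w] L_dist unfolding L by simp
qed

lemma v_in_L: "v \<in> set L" using L_ne L_last by auto

lemma v_x: "v \<noteq> x" "(x, v) \<notin> A" "x \<noteq> v" "(v, x) \<notin> A" using v_in_L L_x symA by auto

text \<open>An inner vertex of the path has at most two neighbours on the induced path from
  \<open>q h\<close> through \<open>L\<close>; beyond these only \<open>q l\<close> can be
  seen.\<close>

lemma degree_on_L:
  assumes "u \<in> set L" "u \<noteq> v" "\<And>w. w \<in> X \<Longrightarrow> w \<in> {x, q l} \<union> q ` {l<..h} \<union> set L"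
  shows "degree_in u X \<le> 3"
proof -
  obtain e f where ef: "\<And>w. w \<in> set (q h # L) \<Longrightarrow> (u, w) \<in> A \<Longrightarrow> w \<in> {e, f}"
    using L_two_nbrs[of u] assms(1) by blast
  have "w \<in> set [e, f, q l]" if w: "w \<in> X" "(u, w) \<in> A" for w
  proof -
    have "w \<noteq> x" using L_x(2)[OF assms(1)] w(2) symA by auto
    moreover have "w \<in> set (q h # L) \<Longrightarrow> ?thesis" using ef w(2) by auto
    moreover have "w = q h" if "t \<in> {l<..h}" "w = q t" for t
      using L_anti[OF assms(1,2), of t] that w(2) by (cases "t < h") auto
    ultimately show ?thesis using assms(3)[OF w(1)] by fastforce
  qed
  from degree_in_le_length[of X u, OF this] show ?thesis by simp
qed

lemma distinct_mixed:
  assumes "mset l' = mset (x # L' @ map q ns)" "distinct L'" "set L' \<subseteq> set L" "distinct ns" "set ns \<subseteq> {l..h}"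
  shows "distinct l'"
proof -
  have ns: "n \<le> N" if "n \<in> set ns" for n using that assms(5) ord(5) by auto
  then have "inj_on q (set ns)" by (intro inj_onI) (auto simp: q_eq)
  moreover have "x \<notin> q ` set ns" using ns x_notin by auto
  moreover have "set L' \<inter> q ` set ns = {}" using L_disj assms(3,5) by fastforce
  moreover have "x \<notin> set L'" using L_x(1) assms(3) by auto
  ultimately have "distinct (x # L' @ map q ns)" using assms(2,4) by (simp add: distinct_map)
  then show ?thesis using mset_eq_imp_distinct_iff[OF assms(1)] by blast
qed

text \<open>The third path leaves \<open>x\<close> by the spoke \<open>q z\<close> and follows the
  rim to \<open>q i\<close> and \<open>v\<close>; the branch vertices are \<open>x\<close>,
  \<open>v\<close>, \<open>q y\<close>, \<open>q h\<close>. For \<open>z = l\<close> the vertex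
  \<open>q l\<close> is on it and must not see \<open>L\<close>.\<close>

lemma arm_far:
  assumes z: "l \<le> z" "z \<le> i" "i < j" "(x, q z) \<in> A"
    and z_only: "\<And>t. z \<le> t \<Longrightarrow> t \<le> i \<Longrightarrow> (x, q t) \<in> A \<Longrightarrow> t = z"
    and zl: "\<And>u. z = l \<Longrightarrow> u \<in> set L \<Longrightarrow> (q l, u) \<notin> A"
  shows False
proof -
  define r where "r = butlast L"
  have L: "L = r @ [v]" unfolding r_def using L_ne L_last append_butlast_last_id by metis
  let ?l = "x # v # q y # q h # map q [z..<Suc i] @ [] @ [] @ map q [j..<y] @ rev r @ map q [Suc y..<h]"
  define X where "X = set ?l"
  define J where "J t \<longleftrightarrow> z \<le> t \<and> t \<le> i \<or> j \<le> t \<and> t \<le> h" for t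
  have X: "w = x \<or> w \<in> set L \<or> (\<exists>t. (z \<le> t \<and> t \<le> i \<or> j \<le> t \<and> t \<le> h) \<and> w = q t)" if "w \<in> X" for w
  proof -
    have "set ?l \<subseteq> {x} \<union> set L \<union> q ` ({z..i} \<union> {j..h})" using ord unfolding L by auto
    then have "w \<in> {x} \<union> set L \<union> q ` ({z..i} \<union> {j..h})" using that unfolding X_def by (rule subsetD)
    then show ?thesis by auto
  qed
  have Xs: "w \<in> {x, q l} \<union> q ` {l<..h} \<union> set L" if "w \<in> X" for w
    using X[OF that] ord z by (auto simp: image_iff) (metis greaterThanAtMost_iff le_trans less_le order.strict_trans2)+
  show False
  proof (rule no_K4_listed)
    show "distinct ?l"
      by (rule distinct_mixed[where L' = L and ns = "y # h # [z..<Suc i] @ [j..<y] @ [Suc y..<h]"])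
        (use L_dist ord z in \<open>auto simp: L ac_simps\<close>)
    show "edges (x # map q [z..<Suc i] @ [v]) \<subseteq> A"
      by (rule edges_seg_ends) (use ord z vi symA in auto)
    show "edges (x # [] @ [q y]) \<subseteq> A" "edges (x # [] @ [q h]) \<subseteq> A" using sp symA by auto
    show "edges (v # map q [j..<y] @ [q y]) \<subseteq> A"
      by (rule edges_seg_ends) (use ord vj path_adj in auto)
    show "edges (v # rev r @ [q h]) \<subseteq> A" using L_ed unfolding L by simp
    show "edges (q y # map q [Suc y..<h] @ [q h]) \<subseteq> A" by (rule edges_seg_q) (use ord in auto)
    fix u assume "u \<in> set ?l"
    then have u: "u \<in> X" unfolding X_def .
    have "degree_in u X \<le> 3"
    proof -
      consider "u = x" | "u = v" | "u \<in> set L" "u \<noteq> v" | t where "u = q t" "z \<le> t \<and> t \<le> i \<or> j \<le> t \<and> t \<le> h" "u \<noteq> x"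
        using X[OF u] by blast
      then show ?thesis
      proof cases
        case 1
        have "w \<in> set [q z, q y, q h]" if w: "w \<in> X" "(u, w) \<in> A" for w
          using X[OF w(1)] w(2) 1 irreflA L_x z_only y_only by (metis le_neq_implies_less list.set_intros)
        from degree_in_le_length[of X u, OF this] show ?thesis by simp
      next
        case 2
        have "w \<in> set [q i, q j, last (q h # butlast L)]" if w: "w \<in> X" "(u, w) \<in> A" for w
        proof -
          have "w \<noteq> x" using v_x 2 w by auto
          moreover have P: ?thesis if "w \<in> set (q h # L)" using v_nbr_on_L[OF that] w(2) 2 by auto
          moreover have ?thesis if t: "z \<le> t \<and> t \<le> i \<or> j \<le> t \<and> t \<le> h" "w = q t" for t
          proof -
            consider "t = l" | "t = h" | "t \<noteq> l" "t \<noteq> h" by blast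
            then show ?thesis
            proof cases
              case 1
              then show ?thesis using zl[OF _ v_in_L] t z ord w(2) 2 symA by auto
            next
              case 2
              then show ?thesis using P t(2) by simp
            next
              case 3
              then have "i \<le> t \<and> t \<le> j" using v_range[of t] t w(2) 2 z ord by auto
              then show ?thesis using t by auto
            qed
          qed
          ultimately show ?thesis using X[OF w(1)] by fastforce
        qed
        from degree_in_le_length[of X u, OF this] show ?thesis by simp
      next
        case 3
        then show ?thesis using degree_on_L Xs by blast
      next
        case (4 t)
        have tN: "t \<le> N" "l \<le> t" using 4 ord z by auto
        have nb: "w = x \<or> w \<in> set L \<or> w = q (t - 1) \<and> 0 < t \<and> J (t - 1) \<or> w = q (Suc t) \<and> J (Suc t)"
          if w: "w \<in> X" "(u, w) \<in> A" for w
          using X[OF w(1)] w(2) path_adj[OF tN(1)] ord z 4(1) by (auto simp: J_def Suc_le_eq)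
        \<comment> \<open>Since \<open>q i\<close> and \<open>q j\<close> share the neighbour
          \<open>v\<close>, they are not consecutive. So each of them has lost one rim neighbour,
          which makes room for \<open>v\<close>.\<close>
        have J: "\<not> J (Suc h)" "\<not> J (Suc i)" "\<not> J (j - 1)"
          using common_nbrs_apart[OF _ _ vj vi] ord z unfolding J_def by auto
        have nbL: "w = hd L \<and> t = h \<or> w = v \<and> (t = i \<or> t = j)" if w: "w \<in> set L" "(u, w) \<in> A" for w
        proof (cases "t = h")
          case True
          then show ?thesis using h_nbr_on_L w 4 by auto
        next
          case False
          then have th: "t < h" using 4 ord z by auto
          show ?thesis
          proof (cases "t = l")
            case True
            then show ?thesis using zl[OF _ w(1)] w(2) 4 z ord by auto
          next
            case False
            then have lt: "l < t" using tN by auto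
            then have "w = v" using L_anti[OF w(1) _ lt th] w(2) 4 symA by auto
            then show ?thesis using v_range[OF lt th] w(2) 4 symA by fastforce
          qed
        qed
        consider "t = h" | "t = i" | "t = j" | "t \<noteq> h" "t \<noteq> i" "t \<noteq> j" by blast
        then show ?thesis
        proof cases
          case 1
          have "w \<in> set [x, q (t - 1), hd L]" if w: "w \<in> X" "(u, w) \<in> A" for w
            using nb[OF w] nbL[OF _ w(2)] 1 J ord by auto
          from degree_in_le_length[of X u, OF this] show ?thesis by simp
        next
          case 2
          have "w \<in> set [x, q (t - 1), v]" if w: "w \<in> X" "(u, w) \<in> A" for w
            using nb[OF w] nbL[OF _ w(2)] 2 J ord z by auto
          from degree_in_le_length[of X u, OF this] show ?thesis by simp
        next
          case 3
          have "w \<in> set [x, q (Suc t), v]" if w: "w \<in> X" "(u, w) \<in> A" for w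
            using nb[OF w] nbL[OF _ w(2)] 3 J ord z by auto
          from degree_in_le_length[of X u, OF this] show ?thesis by simp
        next
          case 4
          have "w \<in> set [x, q (t - 1), q (Suc t)]" if w: "w \<in> X" "(u, w) \<in> A" for w
            using nb[OF w] nbL[OF _ w(2)] 4 by auto
          from degree_in_le_length[of X u, OF this] show ?thesis by simp
        qed
      qed
    qed
    then show "degree_in u (set ?l) \<le> 3" unfolding X_def .
  qed
qed

lemma edges_L_snoc: "(v, w) \<in> A \<Longrightarrow> edges (q h # L @ [w]) \<subseteq> A"
  using L_ed L_ne L_last edges_snoc[of "q h # L" w] symA by auto

text \<open>Here \<open>v\<close> has \<open>q j\<close> as its single inner neighbour, and
  \<open>q j\<close> takes the place of \<open>v\<close> as a branch vertex. It is not a spoke, so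
  its three neighbours are \<open>v\<close> and two rim vertices.\<close>

lemma arm_mid:
  assumes z: "l < z" "z < j" "j < y" "i = j" "(x, q z) \<in> A"
    and z_only: "\<And>t. z \<le> t \<Longrightarrow> t < j \<Longrightarrow> (x, q t) \<in> A \<Longrightarrow> t = z"
  shows False
proof -
  let ?l = "x # q j # q y # q h # map q [z..<j] @ [] @ [] @ map q [Suc j..<y] @ rev L @ map q [Suc y..<h]"
  define X where "X = set ?l"
  have X: "w = x \<or> w \<in> set L \<or> (\<exists>t. z \<le> t \<and> t \<le> h \<and> w = q t)" if "w \<in> X" for w
  proof -
    have "set ?l \<subseteq> {x} \<union> set L \<union> q ` {z..h}" using ord z by auto
    then have "w \<in> {x} \<union> set L \<union> q ` {z..h}" using that unfolding X_def by (rule subsetD)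
    then show ?thesis by auto
  qed
  have Xs: "w \<in> {x, q l} \<union> q ` {l<..h} \<union> set L" if "w \<in> X" for w
    using X[OF that] z(1) by auto
  have jx: "(x, q j) \<notin> A" using y_only[of j] z ord by auto
  show False
  proof (rule no_K4_listed)
    show "distinct ?l"
      by (rule distinct_mixed[where L' = L and ns = "j # y # h # [z..<j] @ [Suc j..<y] @ [Suc y..<h]"])
        (use L_dist ord z in \<open>auto simp: ac_simps\<close>)
    show "edges (x # map q [z..<j] @ [q j]) \<subseteq> A"
      by (rule edges_seg_ends) (use ord z path_adj in auto)
    show "edges (x # [] @ [q y]) \<subseteq> A" "edges (x # [] @ [q h]) \<subseteq> A" using sp symA by auto
    show "edges (q j # map q [Suc j..<y] @ [q y]) \<subseteq> A" by (rule edges_seg_q) (use ord z in auto)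
    show "edges (q j # rev L @ [q h]) \<subseteq> A" using edges_L_snoc[OF vj] by simp
    show "edges (q y # map q [Suc y..<h] @ [q h]) \<subseteq> A" by (rule edges_seg_q) (use ord in auto)
    fix u assume "u \<in> set ?l"
    then have u: "u \<in> X" unfolding X_def .
    have "degree_in u X \<le> 3"
    proof -
      consider "u = x" | "u = v" | "u \<in> set L" "u \<noteq> v" | t where "u = q t" "z \<le> t" "t \<le> h" "u \<noteq> x"
        using X[OF u] by blast
      then show ?thesis
      proof cases
        case 1
        have "w \<in> set [q z, q y, q h]" if w: "w \<in> X" "(u, w) \<in> A" for w
          using X[OF w(1)] w(2) 1 irreflA L_x z_only y_only by (metis le_neq_implies_less list.set_intros not_le)
        from degree_in_le_length[of X u, OF this] show ?thesis by simp
      next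
        case 2
        have "w \<in> set [q j, last (q h # butlast L)]" if w: "w \<in> X" "(u, w) \<in> A" for w
        proof -
          have "w \<noteq> x" using v_x 2 w by auto
          moreover have P: ?thesis if "w \<in> set (q h # L)" using v_nbr_on_L[OF that] w(2) 2 by auto
          moreover have ?thesis if t: "z \<le> t" "t \<le> h" "w = q t" for t
          proof (cases "t = h")
            case True
            then show ?thesis using P t by simp
          next
            case False
            then have "t = j" using v_range[of t] t w(2) 2 z by auto
            then show ?thesis using t by auto
          qed
          ultimately show ?thesis using X[OF w(1)] by fastforce
        qed
        from degree_in_le_length[of X u, OF this] show ?thesis by simp
      next
        case 3
        then show ?thesis using degree_on_L Xs by blast
      next
        case (4 t)
        have tN: "t \<le> N" "l < t" using 4 ord z by auto
        have nb: "w = x \<or> w \<in> set L \<or> w = q (t - 1) \<or> w = q (Suc t) \<and> t < h"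
          if w: "w \<in> X" "(u, w) \<in> A" for w
          using X[OF w(1)] w(2) path_adj[OF tN(1)] ord z 4(1) by (auto simp: Suc_le_eq)
        have nbL: "w = hd L \<and> t = h \<or> w = v \<and> t = j" if w: "w \<in> set L" "(u, w) \<in> A" for w
        proof (cases "t = h")
          case True
          then show ?thesis using h_nbr_on_L w 4 by auto
        next
          case False
          then have th: "t < h" using 4 by auto
          then have "w = v" using L_anti[OF w(1) _ tN(2) th] w(2) 4 symA by auto
          then show ?thesis using v_range[OF tN(2) th] w(2) 4 symA z by fastforce
        qed
        consider "t = h" | "t = j" | "t \<noteq> h" "t \<noteq> j" by blast
        then show ?thesis
        proof cases
          case 1
          have "w \<in> set [x, q (t - 1), hd L]" if w: "w \<in> X" "(u, w) \<in> A" for w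
            using nb[OF w] nbL[OF _ w(2)] 1 ord by auto
          from degree_in_le_length[of X u, OF this] show ?thesis by simp
        next
          case 2
          have "w \<in> set [q (Suc t), q (t - 1), v]" if w: "w \<in> X" "(u, w) \<in> A" for w
            using nb[OF w] nbL[OF _ w(2)] 2 ord z jx w(2) 4(1) symA by auto
          from degree_in_le_length[of X u, OF this] show ?thesis by simp
        next
          case 3
          have "w \<in> set [x, q (t - 1), q (Suc t)]" if w: "w \<in> X" "(u, w) \<in> A" for w
            using nb[OF w] nbL[OF _ w(2)] 3 by auto
          from degree_in_le_length[of X u, OF this] show ?thesis by simp
        qed
      qed
    qed
    then show "degree_in u (set ?l) \<le> 3" unfolding X_def .
  qed
qed

text \<open>The degree count shared by the two constructions whose third path starts with the spoke
  \<open>q l\<close>; \<open>f\<close> and \<open>g\<close> are the neighbours of \<open>q l\<close>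
  on \<open>L\<close> that are kept. By \<open>i < j\<close> no \<open>q t\<close> with
  \<open>j \<le> t\<close> is consecutive to \<open>q l\<close>.\<close>

lemma end_degree:
  assumes X: "\<And>w. w \<in> X \<Longrightarrow> w = x \<or> w \<in> set L \<or> w = q l \<or> (\<exists>t. j \<le> t \<and> t \<le> h \<and> w = q t)"
    and fg: "\<And>w. w \<in> X \<Longrightarrow> w \<in> set L \<Longrightarrow> (q l, w) \<in> A \<Longrightarrow> w \<in> {f, g}"
    and ij: "i < j" and u: "u \<in> X"
  shows "degree_in u X \<le> 3"
proof -
  have Xs: "w \<in> {x, q l} \<union> q ` {l<..h} \<union> set L" if "w \<in> X" for w
  proof -
    have "w \<in> q ` {l<..h}" if "j \<le> t" "t \<le> h" "w = q t" for t using that ord by auto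
    then show ?thesis using X[OF that] by blast
  qed
  consider "u = x" | "u = v" | "u \<in> set L" "u \<noteq> v" | "u = q l" | t where "u = q t" "j \<le> t" "t \<le> h" "u \<noteq> x"
    using X[OF u] by blast
  then show ?thesis
  proof cases
    case 1
    have "w \<in> set [q l, q y, q h]" if w: "w \<in> X" "(u, w) \<in> A" for w
      using X[OF w(1)] w(2) 1 irreflA L_x y_only by (metis le_neq_implies_less list.set_intros)
    from degree_in_le_length[of X u, OF this] show ?thesis by simp
  next
    case 2
    have "w \<in> set [q l, q j, last (q h # butlast L)]" if w: "w \<in> X" "(u, w) \<in> A" for w
    proof -
      have "w \<noteq> x" using v_x 2 w by auto
      moreover have P: ?thesis if "w \<in> set (q h # L)" using v_nbr_on_L[OF that] w(2) 2 by auto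
      moreover have ?thesis if t: "j \<le> t" "t \<le> h" "w = q t" for t
      proof (cases "t = h")
        case True
        then show ?thesis using P t by simp
      next
        case False
        then have "t = j" using v_range[of t] t w(2) 2 ord by auto
        then show ?thesis using t by auto
      qed
      ultimately show ?thesis using X[OF w(1)] by fastforce
    qed
    from degree_in_le_length[of X u, OF this] show ?thesis by simp
  next
    case 3
    then show ?thesis using degree_on_L Xs by blast
  next
    case 4
    have "w \<in> set [x, f, g]" if w: "w \<in> X" "(u, w) \<in> A" for w
    proof -
      have "(q l, q t) \<notin> A" if "j \<le> t" "t \<le> h" for t using that path_adj[of l t] ord ij by auto
      moreover have "(q l, q l) \<notin> A" by (rule irreflA)
      ultimately show ?thesis using X[OF w(1)] fg[OF w(1)] w(2) 4 by auto
    qed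
    from degree_in_le_length[of X u, OF this] show ?thesis by simp
  next
    case (5 t)
    have tN: "t \<le> N" "l < t" "Suc l < t" using 5 ord ij by auto
    have "j - 1 \<noteq> l" using ord ij by auto
    then have nb: "w = x \<or> w \<in> set L \<or> w = q (t - 1) \<and> j < t \<or> w = q (Suc t) \<and> t < h"
      if w: "w \<in> X" "(u, w) \<in> A" for w
      using X[OF w(1)] w(2) path_adj[OF tN(1)] ord tN 5 by (auto simp: Suc_le_eq)
    have nbL: "w = hd L \<and> t = h \<or> w = v \<and> t = j" if w: "w \<in> set L" "(u, w) \<in> A" for w
    proof (cases "t = h")
      case True
      then show ?thesis using h_nbr_on_L w 5 by auto
    next
      case False
      then have th: "t < h" using 5 by auto
      then have "w = v" using L_anti[OF w(1) _ tN(2) th] w(2) 5 symA by auto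
      then show ?thesis using v_range[OF tN(2) th] w(2) 5 symA by fastforce
    qed
    consider "t = h" | "t = j" | "t \<noteq> h" "t \<noteq> j" by blast
    then show ?thesis
    proof cases
      case 1
      have "w \<in> set [x, q (t - 1), hd L]" if w: "w \<in> X" "(u, w) \<in> A" for w
        using nb[OF w] nbL[OF _ w(2)] 1 ord by auto
      from degree_in_le_length[of X u, OF this] show ?thesis by simp
    next
      case 2
      have "w \<in> set [x, q (Suc t), v]" if w: "w \<in> X" "(u, w) \<in> A" for w
        using nb[OF w] nbL[OF _ w(2)] 2 ord by auto
      from degree_in_le_length[of X u, OF this] show ?thesis by simp
    next
      case 3
      have "w \<in> set [x, q (t - 1), q (Suc t)]" if w: "w \<in> X" "(u, w) \<in> A" for w
        using nb[OF w] nbL[OF _ w(2)] 3 by auto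
      from degree_in_le_length[of X u, OF this] show ?thesis by simp
    qed
  qed
qed

text \<open>The third path is \<open>x\<close>, \<open>q l\<close>, \<open>f\<close>, and
  \<open>f\<close> is the fourth branch vertex. It splits \<open>L\<close> into \<open>L1\<close>
  towards \<open>q h\<close> and \<open>L2\<close> towards \<open>v\<close>; for
  \<open>f = v\<close> the latter is empty.\<close>

lemma arm_single:
  assumes ij: "i < j" and L12: "L = L1 @ f # L2" and f: "(q l, f) \<in> A"
    and only: "\<And>w. w \<in> set L1 \<union> set L2 \<Longrightarrow> (q l, w) \<notin> A"
  shows False
proof -
  let ?l = "x # q y # q h # f # [] @ [] @ [q l] @ map q [Suc y..<h] @ rev (L2 @ map q [j..<y]) @ L1"
  have sub: "set ?l \<subseteq> {x} \<union> set L \<union> {q l} \<union> q ` {j..h}" using ord L12 by auto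
  have X: "w = x \<or> w \<in> set L \<or> w = q l \<or> (\<exists>t. j \<le> t \<and> t \<le> h \<and> w = q t)" if "w \<in> set ?l" for w
    using subsetD[OF sub that] by auto
  have last: "last (f # L2) = v" using L_last L12 by simp
  have dec: "edges (q h # L) = edges (q h # L1 @ [f]) \<union> edges (f # L2)" using edges_append[of "q h # L1" f L2] L12 by simp
  show False
  proof (rule no_K4_listed)
    show "distinct ?l"
      by (rule distinct_mixed[where L' = L and ns = "l # y # h # [j..<y] @ [Suc y..<h]"])
        (use L_dist ord in \<open>auto simp: ac_simps L12\<close>)
    show "edges (x # [] @ [q y]) \<subseteq> A" "edges (x # [] @ [q h]) \<subseteq> A" "edges (x # [q l] @ [f]) \<subseteq> A" using sp f symA by auto
    show "edges (q y # map q [Suc y..<h] @ [q h]) \<subseteq> A" by (rule edges_seg_q) (use ord in auto)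
    show "edges (q h # L1 @ [f]) \<subseteq> A" using L_ed dec by auto
    have 1: "edges (v # map q [j..<y] @ [q y]) \<subseteq> A" by (rule edges_seg_ends) (use ord vj path_adj in auto)
    have 2: "f # L2 = butlast (f # L2) @ [v]" using last append_butlast_last_id[of "f # L2"] by simp
    have "edges (f # (L2 @ map q [j..<y]) @ [q y]) = edges ((f # L2) @ (map q [j..<y] @ [q y]))" by simp
    also have "\<dots> = edges (butlast (f # L2) @ v # (map q [j..<y] @ [q y]))" by (subst 2) simp
    also have "\<dots> = edges (butlast (f # L2) @ [v]) \<union> edges (v # map q [j..<y] @ [q y])" by (rule edges_append)
    also have "\<dots> \<subseteq> A" using 1 L_ed dec 2 by auto
    finally show "edges (q y # rev (L2 @ map q [j..<y]) @ [f]) \<subseteq> A" by (simp only: edges_rev_path)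
  next
    fix u assume u: "u \<in> set ?l"
    show "degree_in u (set ?l) \<le> 3"
      by (rule end_degree[where f = f and g = f, OF X _ ij u]) (use only L12 in auto)
  qed
qed

text \<open>Now \<open>q l\<close> is itself the fourth branch vertex. The part \<open>L2\<close>
  between its first and last neighbour on \<open>L\<close> is left out, and with it all further
  neighbours of \<open>q l\<close>.\<close>

lemma arm_double:
  assumes ij: "i < j" and L12: "L = L1 @ f # L2 @ g # L3" and fg: "(q l, f) \<in> A" "(q l, g) \<in> A"
    and only: "\<And>w. w \<in> set L1 \<union> set L3 \<Longrightarrow> (q l, w) \<notin> A"
  shows False
proof -
  let ?l = "x # q l # q y # q h # [] @ [] @ [] @ (g # L3 @ map q [j..<y]) @ (f # rev L1) @ map q [Suc y..<h]"
  have sub: "set ?l \<subseteq> {x} \<union> set L \<union> {q l} \<union> q ` {j..h}" using ord L12 by auto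
  have X: "w = x \<or> w \<in> set L \<or> w = q l \<or> (\<exists>t. j \<le> t \<and> t \<le> h \<and> w = q t)" if "w \<in> set ?l" for w
    using subsetD[OF sub that] by auto
  have last: "last (g # L3) = v" using L_last L12 by simp
  have dec: "edges (q h # L) = edges (q h # L1 @ [f]) \<union> edges (f # L2 @ [g]) \<union> edges (g # L3)"
    using edges_append[of "q h # L1" f "L2 @ g # L3"] edges_append[of "f # L2" g L3] L12 by auto
  show False
  proof (rule no_K4_listed)
    show "distinct ?l"
      by (rule distinct_mixed[where L' = "L1 @ f # g # L3" and ns = "l # y # h # [j..<y] @ [Suc y..<h]"])
        (use L_dist ord in \<open>auto simp: ac_simps L12\<close>)
    show "edges (x # [] @ [q l]) \<subseteq> A" "edges (x # [] @ [q y]) \<subseteq> A" "edges (x # [] @ [q h]) \<subseteq> A" using sp symA by auto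
    show "edges (q y # map q [Suc y..<h] @ [q h]) \<subseteq> A" by (rule edges_seg_q) (use ord in auto)
    have "edges (q h # L1 @ f # [q l]) \<subseteq> A"
      using L_ed dec edges_append[of "q h # L1" f "[q l]"] fg(1) symA by auto
    then show "edges (q l # (f # rev L1) @ [q h]) \<subseteq> A" using edges_rev_path[of "q l" "L1 @ [f]" "q h"] by simp
    have 1: "edges (v # map q [j..<y] @ [q y]) \<subseteq> A" by (rule edges_seg_ends) (use ord vj path_adj in auto)
    have 2: "g # L3 = butlast (g # L3) @ [v]" using last append_butlast_last_id[of "g # L3"] by simp
    have "edges (q l # (g # L3 @ map q [j..<y]) @ [q y]) = {(q l, g), (g, q l)} \<union> edges ((g # L3) @ (map q [j..<y] @ [q y]))" by auto
    also have "edges ((g # L3) @ (map q [j..<y] @ [q y])) = edges (butlast (g # L3) @ v # (map q [j..<y] @ [q y]))" by (subst 2) simp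
    also have "\<dots> = edges (butlast (g # L3) @ [v]) \<union> edges (v # map q [j..<y] @ [q y])" by (rule edges_append)
    also have "{(q l, g), (g, q l)} \<union> \<dots> \<subseteq> A" using 1 L_ed dec 2 fg(2) symA by auto
    finally show "edges (q l # (g # L3 @ map q [j..<y]) @ [q y]) \<subseteq> A" .
  next
    have in_L: "w \<in> set (L1 @ f # g # L3)" if "w \<in> set ?l" "w \<in> set L" for w
      using that L_disj ord L_x(1) by auto
    have only': "w \<in> {f, g}" if "w \<in> set ?l" "w \<in> set L" "(q l, w) \<in> A" for w
      using in_L[OF that(1,2)] only that(3) by auto
    fix u assume u: "u \<in> set ?l"
    show "degree_in u (set ?l) \<le> 3"
      by (rule end_degree[where f = f and g = g, OF X only' ij u])
  qed
qed

text \<open>If \<open>i = j\<close>, one of the two inner spokes lies before \<open>j\<close>, as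
  \<open>y\<close> is the only one from \<open>j\<close> on, and \<open>arm_mid\<close> applies.
  Otherwise \<open>arm_far\<close> uses a spoke between \<open>l\<close> and \<open>i\<close>, or
  \<open>q l\<close> itself when it sees nothing of \<open>L\<close>; the remaining case splits by
  the number of neighbours of \<open>q l\<close> on \<open>L\<close>.\<close>

lemma end_contradiction:
  assumes H2: "\<And>a b. l < a \<Longrightarrow> a < b \<Longrightarrow> b \<le> i \<Longrightarrow> (x, q a) \<in> A \<Longrightarrow> (x, q b) \<notin> A"
    and H4: "l < a" "a < b" "b < h" "(x, q a) \<in> A" "(x, q b) \<in> A"
  shows False
proof (cases "i = j")
  case True
  have "a < j"
  proof (rule ccontr)
    assume "\<not> a < j"
    then have "a = y" "b = y" using y_only[of a] y_only[of b] H4 by auto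
    then show False using H4 by simp
  qed
  moreover have "(x, q j) \<notin> A" using H2[of a j] H4 True \<open>a < j\<close> by auto
  then have "j < y" using ord sp by (metis le_neq_implies_less)
  moreover have "t = a" if "a \<le> t" "t < j" "(x, q t) \<in> A" for t
    using H2[of a t] that H4 True by (metis le_neq_implies_less less_imp_le)
  ultimately show False using arm_mid[of a] True H4 by blast
next
  case False
  then have ij: "i < j" using ord by auto
  show False
  proof (cases "\<exists>z. l < z \<and> z \<le> i \<and> (x, q z) \<in> A")
    case True
    then obtain z where z: "l < z" "z \<le> i" "(x, q z) \<in> A" by blast
    have "t = z" if "z \<le> t" "t \<le> i" "(x, q t) \<in> A" for t
      using H2[of z t] that z by (metis le_neq_implies_less)
    then show False using arm_far[of z] z ij by auto
  next
    case no: False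
    show False
    proof (cases "\<exists>w\<in>set L. (q l, w) \<in> A")
      case True
      then obtain L1 f L2 where L: "L = L1 @ f # L2" "(q l, f) \<in> A" "\<forall>w\<in>set L1. (q l, w) \<notin> A"
        using split_list_first_prop[of L "\<lambda>w. (q l, w) \<in> A"] by blast
      show False
      proof (cases "\<exists>w\<in>set L2. (q l, w) \<in> A")
        case True
        then obtain L2' g L3 where "L2 = L2' @ g # L3" "(q l, g) \<in> A" "\<forall>w\<in>set L3. (q l, w) \<notin> A"
          using split_list_last_prop[of L2 "\<lambda>w. (q l, w) \<in> A"] by blast
        then show False using arm_double[OF ij _ L(2), of L1 L2' g L3] L by auto
      next
        case False
        then show False using arm_single[OF ij L(1,2)] L(3) by auto
      qed
    next
      case False
      have "t = l" if "l \<le> t" "t \<le> i" "(x, q t) \<in> A" for t using no that by (metis le_neq_implies_less)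
      then show False using arm_far[of l] False ord ij sp(1) by (metis less_imp_le order_refl)
    qed
  qed
qed

end

section \<open>Segments closed through a connected set of non-neighbours of the centre\<close>

context spoke_path begin

text \<open>An induced path through \<open>K\<close> completes the segment to a cycle on which
  \<open>x\<close> has exactly three neighbours.\<close>

lemma three_spokes:
  assumes ord: "l < m" "m < h" "h \<le> N" and sp: "(x, q l) \<in> A" "(x, q m) \<in> A" "(x, q h) \<in> A"
    and only: "\<And>t. l < t \<Longrightarrow> t < h \<Longrightarrow> (x, q t) \<in> A \<Longrightarrow> t = m"
    and K: "connected_on K" "\<And>t. l \<le> t \<Longrightarrow> t \<le> h \<Longrightarrow> q t \<notin> K" "\<And>k t. k \<in> K \<Longrightarrow> l < t \<Longrightarrow> t < h \<Longrightarrow> (k, q t) \<notin> A"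
      "x \<notin> K" "\<And>k. k \<in> K \<Longrightarrow> (x, k) \<notin> A" "(q l, k1) \<in> A" "k1 \<in> K" "(q h, k2) \<in> A" "k2 \<in> K"
  shows False
proof -
  have lh: "q h \<noteq> q l" using ord q_eq[of h l] by auto
  have "q h \<notin> K" "q l \<notin> K" using K(2) ord by auto
  from connected_on_induced_path[OF K(1) this lh K(8,9,6,7)]
  obtain r where r: "set r \<subseteq> K" "distinct (q h # r @ [q l])" "edges (q h # r @ [q l]) \<subseteq> A"
    and ind: "\<And>u w. u \<in> set (q h # r @ [q l]) \<Longrightarrow> w \<in> set (q h # r @ [q l]) \<Longrightarrow> (u, w) \<in> A \<Longrightarrow> (u, w) \<in> edges (q h # r @ [q l])"
    by blast
  let ?l = "x # q l # q m # q h # [] @ [] @ [] @ map q [Suc l..<m] @ rev r @ map q [Suc m..<h]"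
  have sub: "set ?l \<subseteq> {x} \<union> set r \<union> q ` {l..h}" using ord by auto
  have X: "w = x \<or> w \<in> set r \<or> (\<exists>t. l \<le> t \<and> t \<le> h \<and> w = q t)" if "w \<in> set ?l" for w
    using subsetD[OF sub that] by auto
  show False
  proof (rule no_K4_listed)
    have "inj_on q {l..h}" using path_inj ord by (auto simp: inj_on_def)
    moreover have "distinct (l # m # h # [Suc l..<m] @ [Suc m..<h])" "set (l # m # h # [Suc l..<m] @ [Suc m..<h]) \<subseteq> {l..h}"
      using ord by auto
    ultimately have "distinct (map q (l # m # h # [Suc l..<m] @ [Suc m..<h]))"
      unfolding distinct_map using inj_on_subset by blast
    moreover have "x \<notin> q ` {l..h}" using x_notin ord by (metis atLeastAtMost_iff image_iff order_trans)
    moreover have "set r \<inter> q ` {l..h} = {}" using r(1) K(2) by auto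
    moreover have "x \<notin> set r" using r(1) K(4) by auto
    ultimately have "distinct (x # r @ map q (l # m # h # [Suc l..<m] @ [Suc m..<h]))"
      using r(2) \<open>set (l # m # h # _) \<subseteq> _\<close> unfolding distinct.simps distinct_append set_append set_map by blast
    then show "distinct ?l"
      by (rule iffD1[OF mset_eq_imp_distinct_iff, rotated]) (simp add: ac_simps)
    show "edges (x # [] @ [q l]) \<subseteq> A" "edges (x # [] @ [q m]) \<subseteq> A" "edges (x # [] @ [q h]) \<subseteq> A" using sp symA by auto
    show "edges (q l # map q [Suc l..<m] @ [q m]) \<subseteq> A" "edges (q m # map q [Suc m..<h] @ [q h]) \<subseteq> A"
      using edges_seg_q ord by auto
    show "edges (q l # rev r @ [q h]) \<subseteq> A" using r(3) by simp
    fix u assume u: "u \<in> set ?l"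
    have h_r: "w = hd (r @ [q l])" if "w \<in> set r" "(q h, w) \<in> A" for w
      using ind[of "q h" w] that edges_hd[OF r(2)] by auto
    have l_r: "w = last (q h # r)" if "w \<in> set r" "(q l, w) \<in> A" for w
      using ind[of "q l" w] that edges_last[of "q h # r" "q l" w] r(2) by auto
    consider "u = x" | "u \<in> set r" | t where "u = q t" "l \<le> t" "t \<le> h" "u \<noteq> x" using X[OF u] by blast
    then show "degree_in u (set ?l) \<le> 3"
    proof cases
      case 1
      have "w \<in> set [q l, q m, q h]" if w: "w \<in> set ?l" "(u, w) \<in> A" for w
        using X[OF w(1)] w(2) 1 irreflA K(5) r(1) only by (metis le_neq_implies_less list.set_intros subsetD)
      from degree_in_le_length[of "set ?l" u, OF this] show ?thesis by simp
    next
      case 2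
      obtain e f where ef: "\<And>w. (u, w) \<in> edges (q h # r @ [q l]) \<Longrightarrow> w \<in> {e, f}" using edges_inner[OF r(2), of u] by blast
      have "w \<in> set [e, f]" if w: "w \<in> set ?l" "(u, w) \<in> A" for w
      proof -
        have uK: "u \<in> K" using 2 r(1) by auto
        have P: ?thesis if "w \<in> set (q h # r @ [q l])" using ef ind[of u w] that w(2) 2 by auto
        have "w \<noteq> x" using K(5)[OF uK] symA w(2) by auto
        moreover have ?thesis if t: "l \<le> t" "t \<le> h" "w = q t" for t
          using K(3)[OF uK, of t] t w(2) P by (cases "t = l \<or> t = h") auto
        ultimately show ?thesis using X[OF w(1)] P by fastforce
      qed
      from degree_in_le_length[of "set ?l" u, OF this] show ?thesis by simp
    next
      case (3 t)
      have tN: "t \<le> N" using 3 ord by auto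
      have nb: "w = x \<or> w \<in> set r \<or> w = q (t - 1) \<and> l < t \<or> w = q (Suc t) \<and> t < h"
        if w: "w \<in> set ?l" "(u, w) \<in> A" for w
        using X[OF w(1)] w(2) path_adj[OF tN] ord 3 by (auto simp: Suc_le_eq)
      have nbL: "w = hd (r @ [q l]) \<and> t = h \<or> w = last (q h # r) \<and> t = l" if w: "w \<in> set r" "(u, w) \<in> A" for w
        using h_r l_r w 3 K(3)[of w t] r(1) symA by (cases "t = h"; cases "t = l") auto
      consider "t = h" | "t = l" | "t \<noteq> h" "t \<noteq> l" by blast
      then show ?thesis
      proof cases
        case 1
        have "w \<in> set [x, q (t - 1), hd (r @ [q l])]" if w: "w \<in> set ?l" "(u, w) \<in> A" for w
          using nb[OF w] nbL[OF _ w(2)] 1 ord by auto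
        from degree_in_le_length[of "set ?l" u, OF this] show ?thesis by simp
      next
        case 2
        have "w \<in> set [x, q (Suc t), last (q h # r)]" if w: "w \<in> set ?l" "(u, w) \<in> A" for w
          using nb[OF w] nbL[OF _ w(2)] 2 ord by auto
        from degree_in_le_length[of "set ?l" u, OF this] show ?thesis by simp
      next
        case 3
        have "w \<in> set [x, q (t - 1), q (Suc t)]" if w: "w \<in> set ?l" "(u, w) \<in> A" for w
          using nb[OF w] nbL[OF _ w(2)] 3 by auto
        from degree_in_le_length[of "set ?l" u, OF this] show ?thesis by simp
      qed
    qed
  qed
qed

text \<open>By \<open>H1\<close> a spoke \<open>q y\<close> would be the only one from
  \<open>q j\<close> to just before \<open>q h\<close>. An induced path from \<open>q h\<close>
  through \<open>K\<close> to \<open>v\<close> then serves as the \<open>L\<close> of an attached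
  path.\<close>

lemma no_spoke_at_end:
  assumes ord: "l < i" "i \<le> j" "j < h" "h \<le> N" and sp: "(x, q l) \<in> A" "(x, q h) \<in> A"
    and v: "(v, q i) \<in> A" "(v, q j) \<in> A" "\<And>t. l < t \<Longrightarrow> t < h \<Longrightarrow> (v, q t) \<in> A \<Longrightarrow> i \<le> t \<and> t \<le> j"
      "v \<notin> K" "v \<noteq> x" "(x, v) \<notin> A" "\<And>t. l \<le> t \<Longrightarrow> t \<le> h \<Longrightarrow> q t \<noteq> v"
    and K: "connected_on K" "\<And>t. l \<le> t \<Longrightarrow> t \<le> h \<Longrightarrow> q t \<notin> K" "\<And>k t. k \<in> K \<Longrightarrow> l < t \<Longrightarrow> t < h \<Longrightarrow> (k, q t) \<notin> A"
      "x \<notin> K" "\<And>k. k \<in> K \<Longrightarrow> (x, k) \<notin> A" "(v, k1) \<in> A" "k1 \<in> K" "(q h, k2) \<in> A" "k2 \<in> K"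
    and H1: "\<And>a b. j \<le> a \<Longrightarrow> a < b \<Longrightarrow> b < h \<Longrightarrow> (x, q a) \<in> A \<Longrightarrow> (x, q b) \<notin> A"
    and H2: "\<And>a b. l < a \<Longrightarrow> a < b \<Longrightarrow> b \<le> i \<Longrightarrow> (x, q a) \<in> A \<Longrightarrow> (x, q b) \<notin> A"
    and H4: "l < a" "a < b" "b < h" "(x, q a) \<in> A" "(x, q b) \<in> A"
    and y: "j \<le> y" "y < h"
  shows "(x, q y) \<notin> A"
proof
  assume yx: "(x, q y) \<in> A"
  have "q h \<notin> K" "q h \<noteq> v" using K(2) v ord by auto
  from connected_on_induced_path[OF K(1) this(1) v(4) this(2) K(8,9,6,7)]
  obtain r where r: "set r \<subseteq> K" "distinct (q h # r @ [v])" "edges (q h # r @ [v]) \<subseteq> A"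
    and ind: "\<And>u w. u \<in> set (q h # r @ [v]) \<Longrightarrow> w \<in> set (q h # r @ [v]) \<Longrightarrow> (u, w) \<in> A \<Longrightarrow> (u, w) \<in> edges (q h # r @ [v])"
    by blast
  have rK: "u \<in> K" if "u \<in> set (r @ [v])" "u \<noteq> v" for u using that r(1) by auto
  interpret attached_path A q N x l h i j y v "r @ [v]"
  proof unfold_locales
    fix t assume "j \<le> t" "t < h" "(x, q t) \<in> A"
    then show "t = y" using H1[of t y] H1[of y t] yx y by (metis linorder_neqE_nat)
  next
    fix u w assume "u \<in> set (q h # r @ [v])" "w \<in> set (q h # r @ [v])" "(u, w) \<in> A"
    then show "(u, w) \<in> edges (q h # r @ [v])" by (rule ind)
  next
    show "x \<notin> set (r @ [v])" using r(1) K(4) v(5) by auto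
    show "(x, u) \<notin> A" if "u \<in> set (r @ [v])" for u using that r(1) K(5) v(6) by auto
    show "q t \<notin> set (r @ [v])" if "t \<in> {l..h}" for t using that r(1) K(2) v(7) by auto
    show "(u, q t) \<notin> A" if "u \<in> set (r @ [v])" "u \<noteq> v" "l < t" "t < h" for u t
      using K(3) rK that by blast
    show "i \<le> t \<and> t \<le> j" if "l < t" "t < h" "(v, q t) \<in> A" for t using v(3) that by blast
  qed (use ord sp v(1,2) r(2,3) y yx in auto)
  show False using end_contradiction[of a b] H2 H4 by blast
qed

lemma spoke_path_rev: "spoke_path A (\<lambda>t. q (N - t)) N x"
proof unfold_locales
  show "(q (N - i), q (N - j)) \<in> A \<longleftrightarrow> i = Suc j \<or> j = Suc i" if "i \<le> N" "j \<le> N" for i j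
    by (subst path_adj) (use that in arith)+
  show "inj_on (\<lambda>t. q (N - t)) {..N}"
  proof (rule inj_onI)
    fix s t assume "s \<in> {..N}" "t \<in> {..N}" "q (N - s) = q (N - t)"
    then show "s = t" using q_eq[of "N - s" "N - t"] by auto
  qed
qed (use x_notin no_K33 in auto)

text \<open>The mirror image under \<open>t \<mapsto> N - t\<close>; \<open>H1\<close> and
  \<open>H2\<close> exchange roles.\<close>

lemma no_spoke_at_start:
  assumes ord: "l < i" "i \<le> j" "j < h" "h \<le> N" and sp: "(x, q l) \<in> A" "(x, q h) \<in> A"
    and v: "(v, q i) \<in> A" "(v, q j) \<in> A" "\<And>t. l < t \<Longrightarrow> t < h \<Longrightarrow> (v, q t) \<in> A \<Longrightarrow> i \<le> t \<and> t \<le> j"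
      "v \<notin> K" "v \<noteq> x" "(x, v) \<notin> A" "\<And>t. l \<le> t \<Longrightarrow> t \<le> h \<Longrightarrow> q t \<noteq> v"
    and K: "connected_on K" "\<And>t. l \<le> t \<Longrightarrow> t \<le> h \<Longrightarrow> q t \<notin> K" "\<And>k t. k \<in> K \<Longrightarrow> l < t \<Longrightarrow> t < h \<Longrightarrow> (k, q t) \<notin> A"
      "x \<notin> K" "\<And>k. k \<in> K \<Longrightarrow> (x, k) \<notin> A" "(v, k1) \<in> A" "k1 \<in> K" "(q l, k2) \<in> A" "k2 \<in> K"
    and H1: "\<And>a b. j \<le> a \<Longrightarrow> a < b \<Longrightarrow> b < h \<Longrightarrow> (x, q a) \<in> A \<Longrightarrow> (x, q b) \<notin> A"
    and H2: "\<And>a b. l < a \<Longrightarrow> a < b \<Longrightarrow> b \<le> i \<Longrightarrow> (x, q a) \<in> A \<Longrightarrow> (x, q b) \<notin> A"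
    and H4: "l < a" "a < b" "b < h" "(x, q a) \<in> A" "(x, q b) \<in> A"
    and y: "l < y" "y \<le> i"
  shows "(x, q y) \<notin> A"
proof -
  interpret R: spoke_path A "\<lambda>t. q (N - t)" N x by (rule spoke_path_rev)
  have id: "q (N - (N - t)) = q t" if "t \<le> h" for t using that ord by simp
  have "(x, q (N - (N - y))) \<notin> A"
  proof (rule R.no_spoke_at_end[of "N - h" "N - j" "N - i" "N - l" v K k1 k2 "N - b" "N - a" "N - y"])
    show "N - j \<le> t \<and> t \<le> N - i" if "N - h < t" "t < N - l" "(v, q (N - t)) \<in> A" for t
    proof -
      have "l < N - t" "N - t < h" using that ord by arith+
      then have "i \<le> N - t" "N - t \<le> j" using v(3)[of "N - t"] that by auto
      then show ?thesis using that ord by arith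
    qed
    show "q (N - t) \<noteq> v" if "N - h \<le> t" "t \<le> N - l" for t using v(7)[of "N - t"] that ord by auto
    show "q (N - t) \<notin> K" if "N - h \<le> t" "t \<le> N - l" for t using K(2)[of "N - t"] that ord by auto
    show "(k, q (N - t)) \<notin> A" if "k \<in> K" "N - h < t" "t < N - l" for k t using K(3)[of k "N - t"] that ord by auto
    show "(x, q (N - d)) \<notin> A" if "N - i \<le> c" "c < d" "d < N - l" "(x, q (N - c)) \<in> A" for c d
    proof -
      have "l < N - d" "N - d < N - c" "N - c \<le> i" using that ord by arith+
      then show ?thesis using H2[of "N - d" "N - c"] that by auto
    qed
    show "(x, q (N - d)) \<notin> A" if "N - h < c" "c < d" "d \<le> N - j" "(x, q (N - c)) \<in> A" for c d
    proof -
      have "j \<le> N - d" "N - d < N - c" "N - c < h" using that ord by arith+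
      then show ?thesis using H1[of "N - d" "N - c"] that by auto
    qed
  qed (use ord sp v(1,2,4-6) K(1,4-9) H4 y id in auto)
  then show ?thesis using y ord by simp
qed

lemma connected_on_add_up:
  assumes "connected_on K" "u \<in> K" "(u, q a) \<in> A" "b \<le> Suc N"
  shows "connected_on (K \<union> q ` {a..<b})"
  using assms(4)
proof (induction b)
  case (Suc b)
  consider "Suc b \<le> a" | "b = a" | "a < b" by linarith
  then show ?case
  proof cases
    case 2
    then show ?thesis using connected_on_insert[OF assms(1-3)] by simp
  next
    case 3
    then obtain c where c: "b = Suc c" "a \<le> c" by (cases b) auto
    then have "(q c, q b) \<in> A" using Suc path_adj by auto
    moreover have "q c \<in> K \<union> q ` {a..<b}" using c by auto
    ultimately have "connected_on (insert (q b) (K \<union> q ` {a..<b}))" using connected_on_insert Suc by auto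
    moreover have "insert (q b) (K \<union> q ` {a..<b}) = K \<union> q ` {a..<Suc b}"
      using 3 by (simp add: atLeastLessThanSuc)
    ultimately show ?thesis by simp
  qed (use assms in simp)
qed (use assms in simp)

lemma connected_on_add_down:
  assumes "connected_on K" "u \<in> K" "(u, q b) \<in> A" "b \<le> N"
  shows "connected_on (K \<union> q ` {a<..b})"
proof -
  interpret R: spoke_path A "\<lambda>t. q (N - t)" N x by (rule spoke_path_rev)
  have "connected_on (K \<union> (\<lambda>t. q (N - t)) ` {N - b..<N - a})"
    by (rule R.connected_on_add_up) (use assms in auto)
  moreover have "(\<lambda>t. q (N - t)) ` {N - b..<N - a} = q ` {a<..b}"
  proof -
    have "(\<lambda>t. N - t) ` {N - b..<N - a} = {a<..b}"
    proof safe
      fix t assume "t \<in> {a<..b}"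
      then show "t \<in> (\<lambda>t. N - t) ` {N - b..<N - a}" using assms(4) by (intro image_eqI[of _ _ "N - t"]) auto
    qed (use assms(4) in auto)
    then show ?thesis by (metis image_image)
  qed
  ultimately show ?thesis by simp
qed

text \<open>Reduces constructions with the two centres \<open>x\<close> and \<open>v\<close> to
  index sets: each centre sees at most three listed path vertices, and a path vertex seen by both
  must lack one of its path neighbours. Then all degrees are at most three.\<close>

lemma segment_K4:
  assumes ms: "mset (a # b # c # d # i1 @ i2 @ i3 @ i4 @ i5 @ i6) = mset (x # v # map q ns)"
    and ns: "distinct ns" "\<And>t. t \<in> set ns \<Longrightarrow> t \<le> N" "\<And>t. t \<in> set ns \<Longrightarrow> q t \<noteq> v"
    and v: "v \<noteq> x" "(x, v) \<notin> A"
    and eds: "edges (a # i1 @ [b]) \<subseteq> A" "edges (a # i2 @ [c]) \<subseteq> A" "edges (a # i3 @ [d]) \<subseteq> A"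
    "edges (b # i4 @ [c]) \<subseteq> A" "edges (b # i5 @ [d]) \<subseteq> A" "edges (c # i6 @ [d]) \<subseteq> A"
    and xs: "\<And>t. t \<in> set ns \<Longrightarrow> (x, q t) \<in> A \<Longrightarrow> t = s1 \<or> t = s2 \<or> t = s3"
    and vs: "\<And>t. t \<in> set ns \<Longrightarrow> (v, q t) \<in> A \<Longrightarrow> t = t1 \<or> t = t2 \<or> t = t3"
    and both: "\<And>t. t \<in> set ns \<Longrightarrow> (x, q t) \<in> A \<Longrightarrow> (v, q t) \<in> A \<Longrightarrow> t - 1 \<notin> set ns \<or> Suc t \<notin> set ns"
  shows False
proof -
  let ?l = "a # b # c # d # i1 @ i2 @ i3 @ i4 @ i5 @ i6"
  have set_l: "set ?l = {x, v} \<union> q ` set ns" using mset_eq_setD[OF ms] by simp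
  show False
  proof (rule no_K4_listed[OF _ eds])
    have "inj_on q (set ns)" by (intro inj_onI) (auto simp: q_eq ns)
    moreover have "x \<notin> q ` set ns" using ns(2) x_notin by auto
    moreover have "v \<notin> q ` set ns" using ns(3) by auto
    ultimately have "distinct (x # v # map q ns)" using ns(1) v(1) by (simp add: distinct_map)
    then show "distinct ?l" using mset_eq_imp_distinct_iff[OF ms] by blast
    fix u assume "u \<in> set ?l"
    then consider "u = x" | "u = v" | t where "u = q t" "t \<in> set ns" unfolding set_l by auto
    then have "degree_in u ({x, v} \<union> q ` set ns) \<le> 3"
    proof cases
      case 1
      have "w \<in> set [q s1, q s2, q s3]" if w: "w \<in> {x, v} \<union> q ` set ns" "(u, w) \<in> A" for w
        using w 1 v irreflA xs by auto
      from degree_in_le_length[of "{x, v} \<union> q ` set ns" u, OF this] show ?thesis by simp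
    next
      case 2
      have "(v, x) \<notin> A" using v(2) symA by blast
      then have "w \<in> set [q t1, q t2, q t3]" if w: "w \<in> {x, v} \<union> q ` set ns" "(u, w) \<in> A" for w
        using w 2 irreflA vs by auto
      from degree_in_le_length[of "{x, v} \<union> q ` set ns" u, OF this] show ?thesis by simp
    next
      case (3 t)
      have nb: "w = x \<and> (x, q t) \<in> A \<or> w = v \<and> (v, q t) \<in> A \<or> w = q (t - 1) \<and> t - 1 \<in> set ns \<or> w = q (Suc t) \<and> Suc t \<in> set ns"
        if w: "w \<in> {x, v} \<union> q ` set ns" "(u, w) \<in> A" for w
        using w path_adj[OF ns(2)[OF 3(2)] ns(2)] symA unfolding 3(1) by auto
      consider "(x, q t) \<notin> A" | "(v, q t) \<notin> A" | "t - 1 \<notin> set ns" | "Suc t \<notin> set ns" using both[OF 3(2)] by blast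
      then show ?thesis
      proof cases
        case 1
        have "w \<in> set [v, q (t - 1), q (Suc t)]" if w: "w \<in> {x, v} \<union> q ` set ns" "(u, w) \<in> A" for w
          using nb[OF w] 1 by auto
        from degree_in_le_length[of "{x, v} \<union> q ` set ns" u, OF this] show ?thesis by simp
      next
        case 2
        have "w \<in> set [x, q (t - 1), q (Suc t)]" if w: "w \<in> {x, v} \<union> q ` set ns" "(u, w) \<in> A" for w
          using nb[OF w] 2 by auto
        from degree_in_le_length[of "{x, v} \<union> q ` set ns" u, OF this] show ?thesis by simp
      next
        case 3
        have "w \<in> set [x, v, q (Suc t)]" if w: "w \<in> {x, v} \<union> q ` set ns" "(u, w) \<in> A" for w
          using nb[OF w] 3 by auto
        from degree_in_le_length[of "{x, v} \<union> q ` set ns" u, OF this] show ?thesis by simp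
      next
        case 4
        have "w \<in> set [x, v, q (t - 1)]" if w: "w \<in> {x, v} \<union> q ` set ns" "(u, w) \<in> A" for w
          using nb[OF w] 4 by auto
        from degree_in_le_length[of "{x, v} \<union> q ` set ns" u, OF this] show ?thesis by simp
      qed
    qed
    then show "degree_in u (set ?l) \<le> 3" unfolding set_l .
  qed
qed

lemma edges_seg_rev:
  assumes "a < b" "b \<le> Suc N" "(u, q (b - 1)) \<in> A" "(q a, w) \<in> A"
  shows "edges (u # rev (map q [a..<b]) @ [w]) \<subseteq> A"
proof -
  have "edges (w # map q [a..<b] @ [u]) \<subseteq> A" by (rule edges_seg_ends) (use assms symA in auto)
  then show ?thesis by (simp only: edges_rev_path)
qed

end

text \<open>Here \<open>q y1\<close> and \<open>q y2\<close> are the first two inner spokes, and \<open>q j'\<close> is the last neighbour of \<open>v\<close>, so that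
  \<open>q j', \<dots>, q h\<close> is a path from \<open>v\<close> to \<open>x\<close>.\<close>

locale two_centres = spoke_path +
  fixes v :: 'a and l h y1 y2 j' :: nat
  assumes v: "v \<noteq> x" "(x, v) \<notin> A"
    and vq: "l \<le> t \<Longrightarrow> t \<le> h \<Longrightarrow> q t \<noteq> v"
    and ord: "l < y1" "y1 < y2" "y2 < j'" "j' \<le> h" "h \<le> N"
    and sp: "(x, q l) \<in> A" "(x, q h) \<in> A" "(x, q y1) \<in> A" "(x, q y2) \<in> A"
    and spl: "l < t \<Longrightarrow> t < y2 \<Longrightarrow> (x, q t) \<in> A \<Longrightarrow> t = y1"
    and sph: "j' \<le> t \<Longrightarrow> t < h \<Longrightarrow> (x, q t) \<notin> A"
    and vj: "(v, q j') \<in> A" and vh: "j' < t \<Longrightarrow> t \<le> h \<Longrightarrow> (v, q t) \<notin> A"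
begin

lemma edges_tail: "edges (x # rev (map q [j'..<Suc h]) @ [v]) \<subseteq> A"
  by (rule edges_seg_rev) (use ord sp vj symA in auto)

text \<open>The branch vertices are \<open>x\<close>, \<open>v\<close>, \<open>q s1\<close>,
  \<open>q s2\<close>: \<open>x\<close> reaches \<open>q s1\<close> by way of \<open>q y1\<close>,
  \<open>q s2\<close> by way of \<open>q y2\<close>, and \<open>v\<close> along
  \<open>q h, ..., q j'\<close>.\<close>

lemma sector_v_two:
  assumes s: "y1 \<le> s1" "s1 < s2" "s2 \<le> y2" "(v, q s1) \<in> A" "(v, q s2) \<in> A"
    and only: "\<And>t. y1 \<le> t \<Longrightarrow> t \<le> y2 \<Longrightarrow> (v, q t) \<in> A \<Longrightarrow> t = s1 \<or> t = s2"
  shows False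
proof (rule segment_K4[where v = v and a = x and b = v and c = "q s1" and d = "q s2"
      and ?i1.0 = "rev (map q [j'..<Suc h])" and ?i2.0 = "map q [y1..<s1]" and ?i3.0 = "rev (map q [Suc s2..<Suc y2])"
      and ?i4.0 = "[]" and ?i5.0 = "[]" and ?i6.0 = "map q [Suc s1..<s2]"
      and ns = "s1 # s2 # [j'..<Suc h] @ [y1..<s1] @ [Suc s2..<Suc y2] @ [Suc s1..<s2]"
      and ?s1.0 = y1 and ?s2.0 = y2 and ?s3.0 = h and ?t1.0 = s1 and ?t2.0 = s2 and ?t3.0 = j', OF _ _ _ _ v edges_tail])
  let ?ns = "s1 # s2 # [j'..<Suc h] @ [y1..<s1] @ [Suc s2..<Suc y2] @ [Suc s1..<s2]"
  have ns: "t \<in> set ?ns \<longleftrightarrow> y1 \<le> t \<and> t \<le> y2 \<or> j' \<le> t \<and> t \<le> h" for t using s ord by auto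
  show "distinct ?ns" using s ord by auto
  show "t \<le> N" if "t \<in> set ?ns" for t using that ord unfolding ns by auto
  show "q t \<noteq> v" if "t \<in> set ?ns" for t using that ord vq[of t] unfolding ns by auto
  show "edges (x # map q [y1..<s1] @ [q s1]) \<subseteq> A" by (rule edges_seg_ends) (use s ord sp path_adj in auto)
  show "edges (x # rev (map q [Suc s2..<Suc y2]) @ [q s2]) \<subseteq> A"
  proof (cases "s2 = y2")
    case True
    then show ?thesis using sp symA by simp
  next
    case False
    then show ?thesis by (intro edges_seg_rev) (use s ord sp path_adj in auto)
  qed
  show "edges (v # [] @ [q s1]) \<subseteq> A" "edges (v # [] @ [q s2]) \<subseteq> A" using s(4,5) symA by auto
  show "edges (q s1 # map q [Suc s1..<s2] @ [q s2]) \<subseteq> A" by (rule edges_seg_q) (use s ord in auto)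
  show "t = y1 \<or> t = y2 \<or> t = h" if "t \<in> set ?ns" "(x, q t) \<in> A" for t
    using that spl[of t] sph[of t] ord unfolding ns by (metis le_neq_implies_less less_le_trans)
  show "t = s1 \<or> t = s2 \<or> t = j'" if "t \<in> set ?ns" "(v, q t) \<in> A" for t
    using that only[of t] vh[of t] ord unfolding ns by (metis le_neq_implies_less)
  show "t - 1 \<notin> set ?ns \<or> Suc t \<notin> set ?ns" if t: "t \<in> set ?ns" "(x, q t) \<in> A" "(v, q t) \<in> A" for t
  proof -
    have "t = y1 \<or> t = y2 \<or> t = h" using \<open>\<And>t. t \<in> set ?ns \<Longrightarrow> (x, q t) \<in> A \<Longrightarrow> _\<close> t by blast
    moreover have ?thesis if "t = y2"
    proof -
      \<comment> \<open>If \<open>v\<close> sees \<open>q y2\<close>, its neighbours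
        \<open>q y2\<close> and \<open>q j'\<close> are not consecutive, so \<open>Suc y2\<close>
        falls into the gap before \<open>j'\<close>.\<close>
      have "j' \<noteq> Suc y2" using common_nbrs_apart[OF _ _ vj, of y2] t(3) that ord by auto
      then show ?thesis using that ord unfolding ns by auto
    qed
    moreover have "Suc h \<notin> set ?ns" using ord unfolding ns by auto
    moreover have "y1 - 1 \<notin> set ?ns" using ord unfolding ns by auto
    ultimately show ?thesis by metis
  qed
qed (use s in \<open>simp add: ac_simps\<close>)

text \<open>With one neighbour in the sector, a second path of \<open>v\<close> goes back to
  \<open>q i'\<close> and along the rim to \<open>q y1\<close>. The branch vertices are
  \<open>x\<close>, \<open>v\<close>, \<open>q y1\<close>, \<open>q s\<close>.\<close>

lemma sector_v_one:
  assumes s: "l < i'" "i' < y1" "y1 < s" "s < y2" "(v, q i') \<in> A" "(v, q s) \<in> A"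
    and only: "\<And>t. i' < t \<Longrightarrow> t \<le> y2 \<Longrightarrow> (v, q t) \<in> A \<Longrightarrow> t = s"
  shows False
proof (rule segment_K4[where v = v and a = x and b = v and c = "q y1" and d = "q s"
      and ?i1.0 = "rev (map q [j'..<Suc h])" and ?i2.0 = "[]" and ?i3.0 = "rev (map q [Suc s..<Suc y2])"
      and ?i4.0 = "map q [i'..<y1]" and ?i5.0 = "[]" and ?i6.0 = "map q [Suc y1..<s]"
      and ns = "y1 # s # [j'..<Suc h] @ [Suc s..<Suc y2] @ [i'..<y1] @ [Suc y1..<s]"
      and ?s1.0 = y1 and ?s2.0 = y2 and ?s3.0 = h and ?t1.0 = i' and ?t2.0 = s and ?t3.0 = j', OF _ _ _ _ v edges_tail])
  let ?ns = "y1 # s # [j'..<Suc h] @ [Suc s..<Suc y2] @ [i'..<y1] @ [Suc y1..<s]"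
  have ns: "t \<in> set ?ns \<longleftrightarrow> i' \<le> t \<and> t \<le> y2 \<or> j' \<le> t \<and> t \<le> h" for t using s ord by auto
  show "distinct ?ns" using s ord by auto
  show "t \<le> N" if "t \<in> set ?ns" for t using that ord unfolding ns by auto
  show "q t \<noteq> v" if "t \<in> set ?ns" for t using that ord vq[of t] s unfolding ns by auto
  show "edges (x # [] @ [q y1]) \<subseteq> A" "edges (v # [] @ [q s]) \<subseteq> A" using s(6) sp symA by auto
  show "edges (x # rev (map q [Suc s..<Suc y2]) @ [q s]) \<subseteq> A"
    by (rule edges_seg_rev) (use s ord sp path_adj in auto)
  show "edges (v # map q [i'..<y1] @ [q y1]) \<subseteq> A" by (rule edges_seg_ends) (use s ord sp path_adj in auto)
  show "edges (q y1 # map q [Suc y1..<s] @ [q s]) \<subseteq> A" by (rule edges_seg_q) (use s ord in auto)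
  show "t = y1 \<or> t = y2 \<or> t = h" if "t \<in> set ?ns" "(x, q t) \<in> A" for t
    using that spl[of t] sph[of t] ord s unfolding ns by (metis le_neq_implies_less less_le_trans)
  show "t = i' \<or> t = s \<or> t = j'" if "t \<in> set ?ns" "(v, q t) \<in> A" for t
    using that only[of t] vh[of t] ord unfolding ns by (metis le_neq_implies_less)
  show "t - 1 \<notin> set ?ns \<or> Suc t \<notin> set ?ns" if t: "t \<in> set ?ns" "(x, q t) \<in> A" "(v, q t) \<in> A" for t
  proof -
    have "t = y1 \<or> t = y2 \<or> t = h" using \<open>\<And>t. t \<in> set ?ns \<Longrightarrow> (x, q t) \<in> A \<Longrightarrow> _\<close> t by blast
    moreover have "t \<noteq> y1" using only[of y1] s ord t by auto
    moreover have "t \<noteq> y2" using only[of y2] s ord t by auto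
    moreover have "Suc h \<notin> set ?ns" using ord unfolding ns by auto
    ultimately show ?thesis by metis
  qed
qed (use s in \<open>simp add: ac_simps\<close>)

text \<open>The roles of \<open>x\<close> and \<open>v\<close> are exchanged: a sector of
  \<open>v\<close>, from \<open>q i'\<close> to \<open>q k\<close>, contains exactly the two spokes
  \<open>q y1\<close> and \<open>q y2\<close>.\<close>

lemma v_sector_two:
  assumes s: "l < i'" "i' \<le> y1" "y2 \<le> k" "k \<le> j'" "(v, q i') \<in> A" "(v, q k) \<in> A" "k < h"
    and only: "\<And>t. i' < t \<Longrightarrow> t < k \<Longrightarrow> (v, q t) \<notin> A"
    and sp_only: "\<And>t. y2 < t \<Longrightarrow> t \<le> k \<Longrightarrow> (x, q t) \<notin> A"
  shows False
\<comment> \<open>If \<open>k = j'\<close>, the path leaving \<open>x\<close> by \<open>q h\<close>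
  arrives at \<open>q k\<close>. Then \<open>q k\<close> is the branch vertex and \<open>v\<close>
  is an inner vertex of the path from \<open>q y1\<close> to \<open>q k\<close>.\<close>
proof (cases "k = j'")
  case True
  show False
  proof (rule segment_K4[where v = v and a = x and b = "q y1" and c = "q y2" and d = "q k"
      and ?i1.0 = "[]" and ?i2.0 = "[]" and ?i3.0 = "rev (map q [Suc k..<Suc h])"
      and ?i4.0 = "map q [Suc y1..<y2]" and ?i5.0 = "rev (map q [i'..<y1]) @ [v]" and ?i6.0 = "map q [Suc y2..<k]"
      and ns = "y1 # y2 # k # [Suc k..<Suc h] @ [Suc y1..<y2] @ [i'..<y1] @ [Suc y2..<k]"
      and ?s1.0 = y1 and ?s2.0 = y2 and ?s3.0 = h and ?t1.0 = i' and ?t2.0 = k and ?t3.0 = k, OF _ _ _ _ v])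
    let ?ns = "y1 # y2 # k # [Suc k..<Suc h] @ [Suc y1..<y2] @ [i'..<y1] @ [Suc y2..<k]"
    have ns: "t \<in> set ?ns \<longleftrightarrow> i' \<le> t \<and> t \<le> h" for t using s ord True by auto
    show "distinct ?ns" using s ord True by auto
    show "t \<le> N" if "t \<in> set ?ns" for t using that ord unfolding ns by auto
    show "q t \<noteq> v" if "t \<in> set ?ns" for t using that ord vq[of t] s unfolding ns by auto
    show "edges (x # [] @ [q y1]) \<subseteq> A" "edges (x # [] @ [q y2]) \<subseteq> A" using sp symA by auto
    show "edges (x # rev (map q [Suc k..<Suc h]) @ [q k]) \<subseteq> A"
      by (rule edges_seg_rev) (use s ord sp path_adj in auto)
    show "edges (q y1 # map q [Suc y1..<y2] @ [q y2]) \<subseteq> A" "edges (q y2 # map q [Suc y2..<k] @ [q k]) \<subseteq> A"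
      using edges_seg_q s ord True by auto
    have "edges (v # map q [i'..<y1] @ [q y1]) \<subseteq> A" by (rule edges_seg_ends) (use s ord sp path_adj in auto)
    then have "edges (q k # v # map q [i'..<y1] @ [q y1]) \<subseteq> A"
      using s(6) symA edges_Cons2[of "v # map q [i'..<y1] @ [q y1]" "q k"] by auto
    then show "edges (q y1 # (rev (map q [i'..<y1]) @ [v]) @ [q k]) \<subseteq> A"
      using edges_rev_path[of "q y1" "v # map q [i'..<y1]" "q k"] by simp
    show "t = y1 \<or> t = y2 \<or> t = h" if "t \<in> set ?ns" "(x, q t) \<in> A" for t
    proof -
      have "l < t \<longrightarrow> t < y2 \<longrightarrow> t = y1" "\<not> (j' \<le> t \<and> t < h)" "\<not> (y2 < t \<and> t \<le> k)"
        using spl[of t] sph[of t] sp_only[of t] that(2) by blast+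
      then show ?thesis using that(1) ord s(1-4) True unfolding ns by arith
    qed
    show "t = i' \<or> t = k \<or> t = k" if "t \<in> set ?ns" "(v, q t) \<in> A" for t
      using that only[of t] vh[of t] ord True unfolding ns by (metis le_neq_implies_less linorder_neqE_nat)
    show "t - 1 \<notin> set ?ns \<or> Suc t \<notin> set ?ns" if t: "t \<in> set ?ns" "(x, q t) \<in> A" "(v, q t) \<in> A" for t
    proof -
      have "t = i' \<or> t = k" using \<open>\<And>t. t \<in> set ?ns \<Longrightarrow> (v, q t) \<in> A \<Longrightarrow> _\<close> t by blast
      moreover have "t \<noteq> k" using sp_only[of k] t s ord True by auto
      moreover have "i' - 1 \<notin> set ?ns" using s unfolding ns by auto
      ultimately show ?thesis by metis
    qed
  qed (use s in \<open>simp add: ac_simps\<close>)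
next
  case False
  then have kj: "k < j'" using s by auto
  show False
  proof (rule segment_K4[where v = v and a = x and b = v and c = "q y1" and d = "q y2"
      and ?i1.0 = "rev (map q [j'..<Suc h])" and ?i2.0 = "[]" and ?i3.0 = "[]"
      and ?i4.0 = "map q [i'..<y1]" and ?i5.0 = "rev (map q [Suc y2..<Suc k])" and ?i6.0 = "map q [Suc y1..<y2]"
      and ns = "y1 # y2 # [j'..<Suc h] @ [i'..<y1] @ [Suc y2..<Suc k] @ [Suc y1..<y2]"
      and ?s1.0 = y1 and ?s2.0 = y2 and ?s3.0 = h and ?t1.0 = i' and ?t2.0 = k and ?t3.0 = j', OF _ _ _ _ v edges_tail])
    let ?ns = "y1 # y2 # [j'..<Suc h] @ [i'..<y1] @ [Suc y2..<Suc k] @ [Suc y1..<y2]"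
    have ns: "t \<in> set ?ns \<longleftrightarrow> i' \<le> t \<and> t \<le> k \<or> j' \<le> t \<and> t \<le> h" for t using s ord by auto
    show "distinct ?ns" using s ord kj by auto
    show "t \<le> N" if "t \<in> set ?ns" for t using that ord s unfolding ns by auto
    show "q t \<noteq> v" if "t \<in> set ?ns" for t using that ord vq[of t] s unfolding ns by auto
    show "edges (x # [] @ [q y1]) \<subseteq> A" "edges (x # [] @ [q y2]) \<subseteq> A" using sp symA by auto
    show "edges (v # map q [i'..<y1] @ [q y1]) \<subseteq> A" by (rule edges_seg_ends) (use s ord sp path_adj in auto)
    show "edges (q y1 # map q [Suc y1..<y2] @ [q y2]) \<subseteq> A" using edges_seg_q ord by auto
    show "edges (v # rev (map q [Suc y2..<Suc k]) @ [q y2]) \<subseteq> A"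
    proof (cases "k = y2")
      case True
      then show ?thesis using s symA by simp
    next
      case False
      then show ?thesis by (intro edges_seg_rev) (use s ord sp path_adj in auto)
    qed
    show "t = y1 \<or> t = y2 \<or> t = h" if "t \<in> set ?ns" "(x, q t) \<in> A" for t
    proof -
      have "l < t \<longrightarrow> t < y2 \<longrightarrow> t = y1" "\<not> (j' \<le> t \<and> t < h)" "\<not> (y2 < t \<and> t \<le> k)"
        using spl[of t] sph[of t] sp_only[of t] that(2) by blast+
      then show ?thesis using that(1) ord s(1-4) unfolding ns by arith
    qed
    show "t = i' \<or> t = k \<or> t = j'" if "t \<in> set ?ns" "(v, q t) \<in> A" for t
      using that only[of t] vh[of t] ord unfolding ns by (metis le_neq_implies_less linorder_neqE_nat)
    show "t - 1 \<notin> set ?ns \<or> Suc t \<notin> set ?ns" if t: "t \<in> set ?ns" "(x, q t) \<in> A" "(v, q t) \<in> A" for t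
    proof -
      have "t = i' \<or> t = k \<or> t = j'" using \<open>\<And>t. t \<in> set ?ns \<Longrightarrow> (v, q t) \<in> A \<Longrightarrow> _\<close> t by blast
      moreover have "j' \<noteq> Suc k" using common_nbrs_apart[OF _ _ vj s(6)] s ord by auto
      then have "Suc k \<notin> set ?ns" "j' - 1 \<notin> set ?ns" using s ord kj unfolding ns by auto
      moreover have "i' - 1 \<notin> set ?ns" using s ord unfolding ns by auto
      ultimately show ?thesis by metis
    qed
  qed (use s in \<open>simp add: ac_simps\<close>)
qed

end

lemma least_nat: "P (n :: nat) \<Longrightarrow> \<exists>m. P m \<and> m \<le> n \<and> (\<forall>k<m. \<not> P k)"
  using LeastI[of P n] Least_le[of P n] not_less_Least by blast

lemma greatest_nat:
  assumes "P (n :: nat)" "n \<le> b"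
  shows "\<exists>m. P m \<and> n \<le> m \<and> m \<le> b \<and> (\<forall>k. m < k \<longrightarrow> k \<le> b \<longrightarrow> \<not> P k)"
proof -
  have f: "finite {k. P k \<and> k \<le> b}" "{k. P k \<and> k \<le> b} \<noteq> {}" using assms by auto
  then have "Max {k. P k \<and> k \<le> b} \<in> {k. P k \<and> k \<le> b}" by (rule Max_in)
  moreover have "k \<le> Max {k. P k \<and> k \<le> b}" if "P k" "k \<le> b" for k using f that by auto
  ultimately show ?thesis using assms by (metis (no_types, lifting) mem_Collect_eq not_le)
qed

section \<open>Shrinking the rim of a wheel\<close>

text \<open>\<open>D\<close> will be the set of all non-neighbours of \<open>x\<close> other than
  \<open>x\<close>. The assumption \<open>clean\<close> is what remains of the choice of a smallest
  wheel: at most two neighbours in a closed sector.\<close>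

locale clean_spoke_path = spoke_path +
  fixes D :: "'a set"
  assumes finite_D: "finite D" and connected_on_D: "connected_on D" and D_x: "u \<in> D \<Longrightarrow> u \<noteq> x \<and> (x, u) \<notin> A"
    and nonspoke_D: "t \<le> N \<Longrightarrow> (x, q t) \<notin> A \<Longrightarrow> q t \<in> D"
    and clean: "v \<in> D \<Longrightarrow> s < t \<Longrightarrow> t \<le> N \<Longrightarrow> (x, q s) \<in> A \<Longrightarrow> (x, q t) \<in> A \<Longrightarrow>
      (\<And>k. s < k \<Longrightarrow> k < t \<Longrightarrow> (x, q k) \<notin> A) \<Longrightarrow> s \<le> a \<Longrightarrow> a < b \<Longrightarrow> b < c \<Longrightarrow> c \<le> t \<Longrightarrow>
      (v, q a) \<in> A \<Longrightarrow> (v, q b) \<in> A \<Longrightarrow> (v, q c) \<in> A \<Longrightarrow> False"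
begin

text \<open>\<open>K\<close> closes the segment from \<open>q l\<close> to \<open>q h\<close> to the rim of a wheel with centre \<open>x\<close>.\<close>

definition closes :: "nat \<Rightarrow> nat \<Rightarrow> 'a set \<Rightarrow> bool" where
  "closes l h K \<longleftrightarrow> l < h \<and> h \<le> N \<and> (x, q l) \<in> A \<and> (x, q h) \<in> A \<and> (\<exists>m. l < m \<and> m < h \<and> (x, q m) \<in> A)
     \<and> K \<subseteq> D \<and> connected_on K \<and> (\<forall>t. l \<le> t \<longrightarrow> t \<le> h \<longrightarrow> q t \<notin> K)
     \<and> (\<forall>k\<in>K. \<forall>t. l < t \<longrightarrow> t < h \<longrightarrow> (k, q t) \<notin> A)
     \<and> (\<exists>k\<in>K. (q l, k) \<in> A) \<and> (\<exists>k\<in>K. (q h, k) \<in> A)"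

lemma closesI:
  assumes "l < m" "m < h" "h \<le> N" "(x, q l) \<in> A" "(x, q m) \<in> A" "(x, q h) \<in> A"
    "K \<subseteq> D" "connected_on K" "\<And>t. l \<le> t \<Longrightarrow> t \<le> h \<Longrightarrow> q t \<notin> K"
    "\<And>k t. k \<in> K \<Longrightarrow> l < t \<Longrightarrow> t < h \<Longrightarrow> (k, q t) \<notin> A"
    "k1 \<in> K" "(q l, k1) \<in> A" "k2 \<in> K" "(q h, k2) \<in> A"
  shows "closes l h K"
proof -
  have "l < h" using assms(1,2) by (rule less_trans)
  then show ?thesis unfolding closes_def using assms by blast
qed

lemma closes_maximal:
  assumes "closes l h K"
  shows "\<exists>K. closes l h K \<and> (\<forall>K'. closes l h K' \<longrightarrow> K \<subseteq> K' \<longrightarrow> K = K')"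
proof -
  have "finite {K. closes l h K}"
    by (rule finite_subset[of _ "Pow D"]) (auto simp: closes_def finite_D)
  from finite_has_maximal[OF this] assms show ?thesis by blast
qed

text \<open>The non-spoke \<open>q (Suc l)\<close> shows that \<open>K\<close> is a proper part of
  the connected set \<open>D\<close>. A vertex of \<open>D\<close> next to \<open>K\<close> that saw
  nothing inside the segment could be added to \<open>K\<close>.\<close>

lemma closes_attachment:
  assumes K: "closes l h K" and max: "\<And>K'. closes l h K' \<Longrightarrow> K \<subseteq> K' \<Longrightarrow> K = K'"
  shows "\<exists>k v t. k \<in> K \<and> v \<in> D - K \<and> (k, v) \<in> A \<and> (\<forall>t. l \<le> t \<longrightarrow> t \<le> h \<longrightarrow> q t \<noteq> v) \<and>
    l < t \<and> t < h \<and> (v, q t) \<in> A"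
proof -
  note c = K[unfolded closes_def]
  have l1: "Suc l < h" using c by (metis Suc_lessI not_less_eq)
  then have "(x, q (Suc l)) \<notin> A" using common_nbrs_apart[of "Suc l" l x] c by auto
  then have "q (Suc l) \<in> D - K" using nonspoke_D[of "Suc l"] c l1 by auto
  moreover have "K \<subseteq> D" "K \<noteq> {}" using c by auto
  ultimately obtain k v where kv: "k \<in> K" "v \<in> D - K" "(k, v) \<in> A"
    using connected_on_D unfolding connected_on_def by (metis Diff_iff)
  have vq: "q t \<noteq> v" if "l \<le> t" "t \<le> h" for t
  proof
    assume t: "q t = v"
    then have "t \<noteq> l" "t \<noteq> h" using D_x[of v] kv c by auto
    then have "l < t" "t < h" using that by auto
    then show False using c kv t by blast
  qed
  have "\<exists>t. l < t \<and> t < h \<and> (v, q t) \<in> A"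
  proof (rule ccontr)
    assume no: "\<not> ?thesis"
    have "closes l h (insert v K)"
      unfolding closes_def
    proof (intro conjI)
      show "connected_on (insert v K)" using connected_on_insert kv c by blast
    qed (use c no vq kv in auto)
    then show False using max[of "insert v K"] kv by auto
  qed
  then show ?thesis using kv vq by blast
qed

text \<open>The non-spokes from \<open>q p\<close> to just before \<open>q a\<close> are added to
  the connected set. The path is induced, so they see nothing beyond \<open>q a\<close>, and the
  enlarged set attaches exactly at this end.\<close>

lemma extend_left:
  assumes K: "connected_on K" "K \<subseteq> D" "v \<in> K" and p: "p \<le> a" "a \<le> N" "(v, q p) \<in> A"
    and ns: "\<And>t. p \<le> t \<Longrightarrow> t < a \<Longrightarrow> (x, q t) \<notin> A"
  shows "\<exists>K'. connected_on K' \<and> K' \<subseteq> D \<and> K \<subseteq> K' \<and> (\<exists>k\<in>K'. (q a, k) \<in> A) \<and>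
    (\<forall>t. a \<le> t \<longrightarrow> t \<le> N \<longrightarrow> q t \<notin> K \<longrightarrow> q t \<notin> K') \<and>
    (\<forall>t. a < t \<longrightarrow> t \<le> N \<longrightarrow> (\<forall>k\<in>K. (k, q t) \<notin> A) \<longrightarrow> (\<forall>k\<in>K'. (k, q t) \<notin> A))"
proof (intro exI conjI)
  let ?K = "K \<union> q ` {p..<a}"
  show "connected_on ?K" using connected_on_add_up[OF K(1,3) p(3)] p(2) by simp
  show "?K \<subseteq> D" using K(2) nonspoke_D ns p(2) by auto
  show "K \<subseteq> ?K" by blast
  show "\<exists>k\<in>?K. (q a, k) \<in> A"
  proof (cases "p = a")
    case True
    then show ?thesis using K(3) symA[OF p(3)] by auto
  next
    case False
    then have "q (a - 1) \<in> ?K" "(q a, q (a - 1)) \<in> A" using p path_adj[of a "a - 1"] by auto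
    then show ?thesis by blast
  qed
  show "\<forall>t. a \<le> t \<longrightarrow> t \<le> N \<longrightarrow> q t \<notin> K \<longrightarrow> q t \<notin> ?K" using q_eq by auto
  show "\<forall>t. a < t \<longrightarrow> t \<le> N \<longrightarrow> (\<forall>k\<in>K. (k, q t) \<notin> A) \<longrightarrow> (\<forall>k\<in>?K. (k, q t) \<notin> A)"
  proof (intro allI impI ballI)
    fix t k assume t: "a < t" "t \<le> N" "\<forall>k\<in>K. (k, q t) \<notin> A" "k \<in> ?K"
    then consider "k \<in> K" | s where "k = q s" "s < a" by auto
    then show "(k, q t) \<notin> A"
    proof cases
      case 2
      then show ?thesis using path_adj[of s t] t by simp
    qed (use t in blast)
  qed
qed

lemma extend_right:
  assumes K: "connected_on K" "K \<subseteq> D" "v \<in> K" and p: "b \<le> p" "p \<le> N" "(v, q p) \<in> A"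
    and ns: "\<And>t. b < t \<Longrightarrow> t \<le> p \<Longrightarrow> (x, q t) \<notin> A"
  shows "\<exists>K'. connected_on K' \<and> K' \<subseteq> D \<and> K \<subseteq> K' \<and> (\<exists>k\<in>K'. (q b, k) \<in> A) \<and>
    (\<forall>t. t \<le> b \<longrightarrow> q t \<notin> K \<longrightarrow> q t \<notin> K') \<and>
    (\<forall>t. t < b \<longrightarrow> (\<forall>k\<in>K. (k, q t) \<notin> A) \<longrightarrow> (\<forall>k\<in>K'. (k, q t) \<notin> A))"
proof (intro exI conjI)
  let ?K = "K \<union> q ` {b<..p}"
  show "connected_on ?K" using connected_on_add_down[OF K(1,3) p(3)] p(2) by simp
  show "?K \<subseteq> D" using K(2) nonspoke_D ns p(2) by auto
  show "K \<subseteq> ?K" by blast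
  show "\<exists>k\<in>?K. (q b, k) \<in> A"
  proof (cases "p = b")
    case True
    then show ?thesis using K(3) symA[OF p(3)] by auto
  next
    case False
    then have "q (Suc b) \<in> ?K" "(q b, q (Suc b)) \<in> A" using p path_adj[of b "Suc b"] by auto
    then show ?thesis by blast
  qed
  show "\<forall>t. t \<le> b \<longrightarrow> q t \<notin> K \<longrightarrow> q t \<notin> ?K" using q_eq p by auto
  show "\<forall>t. t < b \<longrightarrow> (\<forall>k\<in>K. (k, q t) \<notin> A) \<longrightarrow> (\<forall>k\<in>?K. (k, q t) \<notin> A)"
  proof (intro allI impI ballI)
    fix t k assume t: "t < b" "\<forall>k\<in>K. (k, q t) \<notin> A" "k \<in> ?K"
    then consider "k \<in> K" | s where "k = q s" "b < s" "s \<le> N" using p by auto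
    then show "(k, q t) \<notin> A"
    proof cases
      case 2
      then show ?thesis using path_adj[of s t] t by simp
    qed (use t in blast)
  qed
qed

text \<open>All inner spokes are shown to lie strictly between the first and the last inner
  neighbour of \<open>v\<close>: two spokes outside, at one end, would give a shorter segment, and a
  single one is excluded by an attached path. The rest depends on how many neighbours
  \<open>v\<close> has in the sector between the first two inner spokes.\<close>

lemma closes_shrink:
  assumes "closes l h K0"
  shows "\<exists>l' h' K'. closes l' h' K' \<and> h' - l' < h - l"
proof (rule ccontr)
  assume no: "\<not> ?thesis"
  have small: False if "closes l' h' K'" "l \<le> l'" "h' \<le> h" "l < l' \<or> h' < h" for l' h' K'
  proof -
    have "l' < h'" using that(1) unfolding closes_def by blast
    then have "h' - l' < h - l" using that(2-4) by linarith
    then show False using no that(1) by blast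
  qed
  obtain K where K: "closes l h K" and max: "\<And>K'. closes l h K' \<Longrightarrow> K \<subseteq> K' \<Longrightarrow> K = K'"
    using closes_maximal[OF assms] by blast
  obtain k v t0 where kv: "k \<in> K" "v \<in> D - K" "(k, v) \<in> A" and vq: "\<And>t. l \<le> t \<Longrightarrow> t \<le> h \<Longrightarrow> q t \<noteq> v"
    and t0: "l < t0" "t0 < h" "(v, q t0) \<in> A"
    using closes_attachment[OF K max] by blast
  have lh: "l < h" "h \<le> N" and sp: "(x, q l) \<in> A" "(x, q h) \<in> A" and KD: "K \<subseteq> D" and cK: "connected_on K"
    and Kq: "\<And>t. l \<le> t \<Longrightarrow> t \<le> h \<Longrightarrow> q t \<notin> K" and Ka: "\<And>k t. k \<in> K \<Longrightarrow> l < t \<Longrightarrow> t < h \<Longrightarrow> (k, q t) \<notin> A"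
    using K unfolding closes_def by blast+
  obtain m where m: "l < m" "m < h" "(x, q m) \<in> A" using K unfolding closes_def by blast
  obtain k1 k2 where k12: "k1 \<in> K" "(q l, k1) \<in> A" "k2 \<in> K" "(q h, k2) \<in> A" using K unfolding closes_def by blast
  have v_x: "v \<noteq> x" "(x, v) \<notin> A" using D_x[of v] kv by auto
  have Kx: "x \<notin> K" "\<And>k. k \<in> K \<Longrightarrow> (x, k) \<notin> A" using D_x KD by auto

  obtain i where i: "l < i" "i \<le> t0" "(v, q i) \<in> A" "\<And>t. l < t \<Longrightarrow> t < i \<Longrightarrow> (v, q t) \<notin> A"
    using least_nat[of "\<lambda>t. l < t \<and> (v, q t) \<in> A" t0] t0 by auto
  obtain j where j: "t0 \<le> j" "j < h" "(v, q j) \<in> A" "\<And>t. j < t \<Longrightarrow> t < h \<Longrightarrow> (v, q t) \<notin> A"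
    using greatest_nat[of "\<lambda>t. t < h \<and> (v, q t) \<in> A" t0 h] t0 by (metis less_imp_le)
  have ij: "i \<le> t \<and> t \<le> j" if "l < t" "t < h" "(v, q t) \<in> A" for t
    using that i(4) j(4) by (meson not_le)
  have ij1: "i \<le> j" using i(2) j(1) by simp

  have "\<exists>b. l < b \<and> b < h \<and> b \<noteq> m \<and> (x, q b) \<in> A"
  proof (rule ccontr)
    assume no: "\<not> ?thesis"
    show False
      by (rule three_spokes[OF m(1,2) lh(2) sp(1) m(3) sp(2) _ cK Kq Ka Kx k12(2,1,4,3)]) (use no in blast)+
  qed
  then obtain a b where ab: "l < a" "a < b" "b < h" "(x, q a) \<in> A" "(x, q b) \<in> A"
    using m by (metis linorder_neqE_nat)

  have cKv: "connected_on (insert v K)" using connected_on_insert[OF cK kv(1,3)] .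
  have KvD: "insert v K \<subseteq> D" using KD kv by blast
  have v_K: "v \<in> insert v K" by simp
  have Kvq: "q t \<notin> insert v K" if "l \<le> t" "t \<le> h" for t using Kq vq that by auto
  have Kva: "k \<in> insert v K \<Longrightarrow> (k, q t) \<notin> A" if "l < t" "t < h" "t < i \<or> j < t" for k t
    using Ka ij[of t] that by auto

  \<comment> \<open>\<open>insert v K\<close> grows along the rim from \<open>q j\<close> to the
    first spoke \<open>q a'\<close>. It then closes the shorter segment from \<open>q a'\<close> to
    \<open>q h\<close>, with \<open>q b\<close> as inner spoke.\<close>
  have H1: "(x, q b) \<notin> A" if ab: "j \<le> a" "a < b" "b < h" "(x, q a) \<in> A" for a b
  proof
    assume b: "(x, q b) \<in> A"
    obtain a' where a': "j \<le> a'" "a' \<le> a" "(x, q a') \<in> A" "\<And>t. j \<le> t \<Longrightarrow> t < a' \<Longrightarrow> (x, q t) \<notin> A"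
      using least_nat[of "\<lambda>t. j \<le> t \<and> (x, q t) \<in> A" a] ab by blast
    have "a' \<le> N" "a' < b" "l < a'" using a' ab lh i ij1 by linarith+
    then obtain K' where K': "connected_on K'" "K' \<subseteq> D" "insert v K \<subseteq> K'" "\<exists>k\<in>K'. (q a', k) \<in> A"
      "\<And>t. a' \<le> t \<Longrightarrow> t \<le> N \<Longrightarrow> q t \<notin> insert v K \<Longrightarrow> q t \<notin> K'"
      "\<And>t k. a' < t \<Longrightarrow> t \<le> N \<Longrightarrow> \<forall>k\<in>insert v K. (k, q t) \<notin> A \<Longrightarrow> k \<in> K' \<Longrightarrow> (k, q t) \<notin> A"
      using extend_left[OF cKv KvD v_K a'(1) _ j(3) a'(4)] by metis
    obtain k' where k': "k' \<in> K'" "(q a', k') \<in> A" using K'(4) by blast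
    have "closes a' h K'"
    proof (rule closesI[of a' b h K' k' k2])
      show "q t \<notin> K'" if "a' \<le> t" "t \<le> h" for t using K'(5)[of t] Kvq[of t] that lh \<open>l < a'\<close> by auto
      show "(k, q t) \<notin> A" if "k \<in> K'" "a' < t" "t < h" for k t
        using K'(6)[of t k] Kva[of t] that lh \<open>l < a'\<close> a'(1) by auto
    qed (use K'(1-3) k' ab b a'(3) sp(2) k12(3,4) lh(2) \<open>a' < b\<close> in auto)
    then show False using small[of a' h K'] \<open>l < a'\<close> by auto
  qed
  have H2: "(x, q b) \<notin> A" if ab: "l < a" "a < b" "b \<le> i" "(x, q a) \<in> A" for a b
  proof
    assume b: "(x, q b) \<in> A"
    obtain b' where b': "b \<le> b'" "b' \<le> i" "(x, q b') \<in> A" "\<And>t. b' < t \<Longrightarrow> t \<le> i \<Longrightarrow> (x, q t) \<notin> A"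
      using greatest_nat[of "\<lambda>t. (x, q t) \<in> A" b i] ab b by blast
    have bN: "i \<le> N" "a < b'" "b' < h" using b' ab lh j ij1 by linarith+
    obtain K' where K': "connected_on K'" "K' \<subseteq> D" "insert v K \<subseteq> K'" "\<exists>k\<in>K'. (q b', k) \<in> A"
      "\<And>t. t \<le> b' \<Longrightarrow> q t \<notin> insert v K \<Longrightarrow> q t \<notin> K'"
      "\<And>t k. t < b' \<Longrightarrow> \<forall>k\<in>insert v K. (k, q t) \<notin> A \<Longrightarrow> k \<in> K' \<Longrightarrow> (k, q t) \<notin> A"
      using extend_right[OF cKv KvD v_K b'(2) bN(1) i(3) b'(4)] by metis
    obtain k' where k': "k' \<in> K'" "(q b', k') \<in> A" using K'(4) by blast
    have "closes l b' K'"
    proof (rule closesI[of l a b' K' k1 k'])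
      show "q t \<notin> K'" if "l \<le> t" "t \<le> b'" for t using K'(5)[of t] Kvq[of t] that bN by auto
      show "(k, q t) \<notin> A" if "k \<in> K'" "l < t" "t < b'" for k t
        using K'(6)[of t k] Kva[of t] that b' bN by auto
    qed (use K'(1-3) k' ab b b'(3) sp(1) k12(1,2) lh(2) bN in auto)
    then show False using small[of l b' K'] bN by auto
  qed
  have vK: "v \<notin> K" and vk: "(v, k) \<in> A" using kv symA by auto
  have end_h: "(x, q y) \<notin> A" if "j \<le> y" "y < h" for y
    by (rule no_spoke_at_end[OF i(1) ij1 j(2) lh(2) sp i(3) j(3) ij vK v_x vq cK Kq Ka Kx vk kv(1) k12(4,3) H1 H2 ab that])
  have end_l: "(x, q y) \<notin> A" if "l < y" "y \<le> i" for y
    by (rule no_spoke_at_start[OF i(1) ij1 j(2) lh(2) sp i(3) j(3) ij vK v_x vq cK Kq Ka Kx vk kv(1) k12(2,1) H1 H2 ab that])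

  obtain y1 where y1: "l < y1" "y1 \<le> a" "(x, q y1) \<in> A" "\<And>t. l < t \<Longrightarrow> t < y1 \<Longrightarrow> (x, q t) \<notin> A"
    using least_nat[of "\<lambda>t. l < t \<and> (x, q t) \<in> A" a] ab by blast
  have "y1 < b" using y1 ab by simp
  obtain y2 where y2: "y1 < y2" "y2 \<le> b" "(x, q y2) \<in> A" "\<And>t. y1 < t \<Longrightarrow> t < y2 \<Longrightarrow> (x, q t) \<notin> A"
    using least_nat[of "\<lambda>t. y1 < t \<and> (x, q t) \<in> A" b] ab \<open>y1 < b\<close> by blast
  have iy1: "i < y1" using end_l[of y1] y1 by (meson not_le)
  have y2j: "y2 < j" using end_h[of y2] y2 ab by (meson not_le le_less_trans)
  have y2h: "y2 < h" using y2 ab by simp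

  \<comment> \<open>The index \<open>j\<close> is the last neighbour strictly before
    \<open>h\<close>. The rim path from \<open>v\<close> to \<open>q h\<close> has to start at the
    last neighbour overall, which may be \<open>q h\<close> itself.\<close>
  define j' where "j' = (if (v, q h) \<in> A then h else j)"
  have j': "j \<le> j'" "j' \<le> h" "(v, q j') \<in> A" using j unfolding j'_def by auto
  interpret two_centres A q N x v l h y1 y2 j'
  proof unfold_locales
    show "(v, q t) \<notin> A" if "j' < t" "t \<le> h" for t
    proof (cases "(v, q h) \<in> A")
      case True
      then show ?thesis using that unfolding j'_def by simp
    next
      case False
      then show ?thesis using that j(4)[of t] unfolding j'_def by (cases "t = h") auto
    qed
    show "t = y1" if "l < t" "t < y2" "(x, q t) \<in> A" for t
      using y1(4)[of t] y2(4)[of t] that by (cases t y1 rule: linorder_cases) auto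
    show "(x, q t) \<notin> A" if "j' \<le> t" "t < h" for t using end_h that j'(1) by simp
    show "q t \<noteq> v" if "l \<le> t" "t \<le> h" for t using vq that .
  qed (use v_x y1(1) y2(1) y2j j' lh sp y1(3) y2(3) in auto)

  have "\<exists>s. y1 < s \<and> s < y2 \<and> (v, q s) \<in> A"
  proof (rule ccontr)
    assume between: "\<not> ?thesis"
    obtain i' where i': "i \<le> i'" "i' \<le> y1" "(v, q i') \<in> A" "\<And>t. i' < t \<Longrightarrow> t \<le> y1 \<Longrightarrow> (v, q t) \<notin> A"
      using greatest_nat[of "\<lambda>t. (v, q t) \<in> A" i y1] i iy1 by (metis less_imp_le)
    obtain c where c: "y2 \<le> c" "c \<le> j" "(v, q c) \<in> A" "\<And>t. y2 \<le> t \<Longrightarrow> t < c \<Longrightarrow> (v, q t) \<notin> A"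
      using least_nat[of "\<lambda>t. y2 \<le> t \<and> (v, q t) \<in> A" j] j y2j by (metis less_imp_le)
    have gap: "(v, q t) \<notin> A" if "i' < t" "t < c" for t
      using between i'(4) c(4) that by (meson not_le)
    show False
    proof (cases "\<exists>e. y2 < e \<and> e \<le> c \<and> (x, q e) \<in> A")
      case False
      show False
        by (rule v_sector_two[of i' c]) (use False i' i c j j' gap in \<open>auto intro: order.strict_trans2\<close>)
    next
      case True
      then obtain e0 where e0: "y2 < e0" "e0 \<le> c" "(x, q e0) \<in> A" by blast
      \<comment> \<open>With \<open>q e\<close> the last spoke up to \<open>q c\<close>, the vertex
        \<open>v\<close> alone, extended along the rim to \<open>q y1\<close> and to
        \<open>q e\<close>, closes the segment between these two: \<open>v\<close> sees nothing
        between \<open>q i'\<close> and \<open>q c\<close>. The inner spoke is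
        \<open>q y2\<close>.\<close>
      obtain e where e: "e0 \<le> e" "e \<le> c" "(x, q e) \<in> A" "\<And>t. e < t \<Longrightarrow> t \<le> c \<Longrightarrow> (x, q t) \<notin> A"
        using greatest_nat[of "\<lambda>t. (x, q t) \<in> A" e0 c] e0 by blast
      have o: "l < i'" "y1 \<le> N" "e < h" "c \<le> N" "y2 < e" using i' i e c j lh y2h y2 e0 by linarith+
      have vD: "{v} \<subseteq> D" "v \<in> {v}" using kv by auto
      have ns1: "(x, q t) \<notin> A" if "i' \<le> t" "t < y1" for t using y1(4) that o by simp
      obtain K1 where K1: "connected_on K1" "K1 \<subseteq> D" "{v} \<subseteq> K1" "\<exists>k\<in>K1. (q y1, k) \<in> A"
        "\<And>t. y1 \<le> t \<Longrightarrow> t \<le> N \<Longrightarrow> q t \<notin> {v} \<Longrightarrow> q t \<notin> K1"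
        "\<And>t k. y1 < t \<Longrightarrow> t \<le> N \<Longrightarrow> \<forall>k\<in>{v}. (k, q t) \<notin> A \<Longrightarrow> k \<in> K1 \<Longrightarrow> (k, q t) \<notin> A"
        using extend_left[OF connected_on_singleton vD i'(2) o(2) i'(3) ns1] by metis
      have vK1: "v \<in> K1" using K1(3) by blast
      obtain K2 where K2: "connected_on K2" "K2 \<subseteq> D" "K1 \<subseteq> K2" "\<exists>k\<in>K2. (q e, k) \<in> A"
        "\<And>t. t \<le> e \<Longrightarrow> q t \<notin> K1 \<Longrightarrow> q t \<notin> K2"
        "\<And>t k. t < e \<Longrightarrow> \<forall>k\<in>K1. (k, q t) \<notin> A \<Longrightarrow> k \<in> K2 \<Longrightarrow> (k, q t) \<notin> A"
        using extend_right[OF K1(1,2) vK1 e(2) o(4) c(3) e(4)] by metis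
      obtain k3 k4 where k34: "k3 \<in> K2" "(q y1, k3) \<in> A" "k4 \<in> K2" "(q e, k4) \<in> A" using K1(4) K2(3,4) by blast
      have "closes y1 e K2"
      proof (rule closesI[of y1 y2 e K2 k3 k4])
        show "q t \<notin> K2" if "y1 \<le> t" "t \<le> e" for t
        proof -
          have "q t \<notin> {v}" using vq[of t] that o(3) y1(1) by simp
          moreover have "t \<le> N" using that(2) o(3) lh(2) by simp
          ultimately have "q t \<notin> K1" using K1(5)[OF that(1)] by blast
          then show ?thesis using K2(5)[OF that(2)] by blast
        qed
        show "(k, q t) \<notin> A" if "k \<in> K2" "y1 < t" "t < e" for k t
        proof -
          have "(v, q t) \<notin> A" using gap[of t] that(2,3) i'(2) e(2) by simp
          moreover have "t \<le> N" using that(3) o(3) lh(2) by simp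
          ultimately have "\<forall>k\<in>K1. (k, q t) \<notin> A" using K1(6)[OF that(2)] by blast
          then show ?thesis using K2(6)[OF that(3) _ that(1)] by blast
        qed
      qed (use K2(1,2) k34 y1(3) y2(1,3) e(3) o lh in auto)
      then show False using small[of y1 e K2] y1 o by auto
    qed
  qed
  then obtain s where s: "y1 < s" "s < y2" "(v, q s) \<in> A" by blast
  show False
  proof (cases "\<exists>s'. y1 \<le> s' \<and> s' \<le> y2 \<and> s' \<noteq> s \<and> (v, q s') \<in> A")
    case True
    then obtain s' where s': "y1 \<le> s'" "s' \<le> y2" "s' \<noteq> s" "(v, q s') \<in> A" by blast
    define s1 s2 where "s1 = min s s'" and "s2 = max s s'"
    have s12: "y1 \<le> s1" "s1 < s2" "s2 \<le> y2" "(v, q s1) \<in> A" "(v, q s2) \<in> A"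
      using s s' unfolding s1_def s2_def by (auto simp: min_def max_def)
    \<comment> \<open>The sector between \<open>q y1\<close> and \<open>q y2\<close> contains no
      third neighbour of \<open>v\<close>, by \<open>clean\<close>.\<close>
    have cl: False if "y1 \<le> a" "a < b" "b < c" "c \<le> y2" "(v, q a) \<in> A" "(v, q b) \<in> A" "(v, q c) \<in> A" for a b c
      by (rule clean[of v y1 y2 a b c]) (use kv y2 y1 lh y2h that in auto)
    have "t = s1 \<or> t = s2" if "y1 \<le> t" "t \<le> y2" "(v, q t) \<in> A" for t
      using cl[of t s1 s2] cl[of s1 t s2] cl[of s1 s2 t] s12 that by (metis linorder_neqE_nat)
    then show False using sector_v_two[OF s12] by blast
  next
    case False
    obtain i' where i': "i \<le> i'" "i' \<le> y1" "(v, q i') \<in> A" "\<And>t. i' < t \<Longrightarrow> t \<le> y1 \<Longrightarrow> (v, q t) \<notin> A"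
      using greatest_nat[of "\<lambda>t. (v, q t) \<in> A" i y1] i iy1 by (metis less_imp_le)
    have "y1 \<le> y2" "y1 \<noteq> s" using s y2(1) by simp_all
    then have "(v, q y1) \<notin> A" using False by blast
    then have "i' \<noteq> y1" using i'(3) by blast
    then have "l < i'" "i' < y1" using i i' by auto
    moreover have "t = s" if "i' < t" "t \<le> y2" "(v, q t) \<in> A" for t
      using False i'(4) that by (meson not_le less_imp_le)
    ultimately show False using sector_v_one[of i' s] i'(3) s by blast
  qed
qed

lemma not_closes: "\<not> closes l h K"
proof (induction "h - l" arbitrary: l h K rule: less_induct)
  case less
  then show ?case using closes_shrink by blast
qed

end

section \<open>From a smallest wheel to a clean path along its rim\<close>

lemma edges_nth:
  "(u, w) \<in> edges l \<longleftrightarrow> (\<exists>k. Suc k < length l \<and> (u = l ! k \<and> w = l ! Suc k \<or> w = l ! k \<and> u = l ! Suc k))"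
proof (induction l rule: edges.induct)
  case (1 x y l)
  have "(\<exists>k. Suc k < length (x # y # l) \<and> P k) \<longleftrightarrow> P 0 \<or> (\<exists>k. Suc k < length (y # l) \<and> P (Suc k))" for P
    by (metis Suc_less_eq length_Cons not0_implies_Suc zero_less_Suc)
  then show ?case using 1 by auto
qed auto

lemma edges_cycle:
  assumes "distinct C" "i < length C" "j < length C"
  shows "(C ! i, C ! j) \<in> edges (C @ [hd C]) \<longleftrightarrow>
    i = Suc j \<or> j = Suc i \<or> (i = 0 \<and> Suc j = length C) \<or> (j = 0 \<and> Suc i = length C)"
proof -
  have C: "C \<noteq> []" using assms by auto
  define nx where "nx k = (if Suc k < length C then Suc k else 0)" for k
  have nth: "(C @ [hd C]) ! k = C ! k" "(C @ [hd C]) ! Suc k = C ! nx k" "nx k < length C" if "k < length C" for k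
    using that C by (auto simp: nth_append hd_conv_nth nx_def not_less_eq)
  have eq: "C ! s = C ! t \<longleftrightarrow> s = t" if "s < length C" "t < length C" for s t
    using nth_eq_iff_index_eq[OF assms(1)] that by blast
  have "(C ! i, C ! j) \<in> edges (C @ [hd C]) \<longleftrightarrow>
      (\<exists>k<length C. C ! i = C ! k \<and> C ! j = C ! nx k \<or> C ! j = C ! k \<and> C ! i = C ! nx k)"
    unfolding edges_nth by (intro ex_cong1) (auto simp: nth)
  also have "\<dots> \<longleftrightarrow> (\<exists>k<length C. i = k \<and> j = nx k \<or> j = k \<and> i = nx k)"
    by (intro ex_cong1) (auto simp: nth(3) eq assms(2,3))
  also have "\<dots> \<longleftrightarrow> i = Suc j \<or> j = Suc i \<or> (i = 0 \<and> Suc j = length C) \<or> (j = 0 \<and> Suc i = length C)"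
    using assms(2,3) unfolding nx_def by (auto split: if_splits)
  finally show ?thesis .
qed

context triangle_free_relation begin

lemma connected_on_chain:
  assumes "a \<le> b" "\<And>t. a \<le> t \<Longrightarrow> t < b \<Longrightarrow> (q t, q (Suc t)) \<in> A"
  shows "connected_on (q ` {a..(b :: nat)})"
  using assms
proof (induction b rule: dec_induct)
  case base
  then show ?case using connected_on_singleton by simp
next
  case (step b)
  then have "connected_on (insert (q (Suc b)) (q ` {a..b}))"
    by (intro connected_on_insert[of _ "q b"]) auto
  then show ?case using step(1) by (simp add: atLeastAtMostSuc_conv)
qed

end

context spoke_path begin

text \<open>The sector and \<open>x\<close> form a cycle with three neighbours of \<open>v\<close>
  on it, so \<open>v\<close> acts as a hub. Only the number of vertices of this subdivision will
  matter.\<close>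

lemma sector_K4:
  assumes s: "s \<le> a" "a < b" "b < c" "c \<le> t" "t \<le> N" "(x, q s) \<in> A" "(x, q t) \<in> A"
    and v: "(v, q a) \<in> A" "(v, q b) \<in> A" "(v, q c) \<in> A" "v \<noteq> x" "\<And>k. s \<le> k \<Longrightarrow> k \<le> t \<Longrightarrow> q k \<noteq> v"
  shows "K4_on A ({v, x} \<union> q ` {s..t})"
proof -
  let ?l = "v # q a # q b # q c # [] @ [] @ [] @ map q [Suc a..<b] @ (rev (map q [s..<a]) @ x # rev (map q [Suc c..<Suc t]))
    @ map q [Suc b..<c]"
  let ?ns = "a # b # c # [Suc a..<b] @ [s..<a] @ [Suc c..<Suc t] @ [Suc b..<c]"
  have ms: "mset ?l = mset (v # x # map q ?ns)" using s by (simp add: ac_simps)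
  have ns: "set ?ns = {s..t}" "distinct ?ns" using s by auto
  have "inj_on q {s..t}" using s by (intro inj_onI) (auto simp: q_eq)
  moreover have "x \<notin> q ` {s..t}" using s x_notin by (metis atLeastAtMost_iff image_iff order_trans)
  moreover have "v \<notin> q ` {s..t}"
  proof
    assume "v \<in> q ` {s..t}"
    then obtain k where "v = q k" "s \<le> k" "k \<le> t" by auto
    then show False using v(5)[of k] by simp
  qed
  ultimately have "distinct (v # x # map q ?ns)" using ns v(4)
    unfolding distinct_map distinct.simps set_map list.set by simp
  then have d: "distinct ?l" using mset_eq_imp_distinct_iff[OF ms] by blast
  have "K4_on A (set ?l)"
  proof (rule K4_onI[OF d refl])
    show "edges (v # [] @ [q a]) \<subseteq> A" "edges (v # [] @ [q b]) \<subseteq> A" "edges (v # [] @ [q c]) \<subseteq> A" using v symA by auto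
    show "edges (q a # map q [Suc a..<b] @ [q b]) \<subseteq> A" "edges (q b # map q [Suc b..<c] @ [q c]) \<subseteq> A"
      using edges_seg_q s by auto
    have 1: "edges (q a # rev (map q [s..<a]) @ [x]) \<subseteq> A"
    proof (cases "s = a")
      case True
      then show ?thesis using s symA by simp
    next
      case False
      then show ?thesis by (intro edges_seg_rev) (use s path_adj symA in auto)
    qed
    have 2: "edges (x # rev (map q [Suc c..<Suc t]) @ [q c]) \<subseteq> A"
    proof (cases "c = t")
      case True
      then show ?thesis using s symA by simp
    next
      case False
      then show ?thesis by (intro edges_seg_rev) (use s path_adj symA in auto)
    qed
    have "edges (q a # (rev (map q [s..<a]) @ x # rev (map q [Suc c..<Suc t])) @ [q c]) =
      edges (q a # rev (map q [s..<a]) @ [x]) \<union> edges (x # rev (map q [Suc c..<Suc t]) @ [q c])"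
      using edges_append[of "q a # rev (map q [s..<a])" x "rev (map q [Suc c..<Suc t]) @ [q c]"] by simp
    then show "edges (q a # (rev (map q [s..<a]) @ x # rev (map q [Suc c..<Suc t])) @ [q c]) \<subseteq> A"
      using 1 2 by simp
  qed
  moreover have "set ?l = {v, x} \<union> q ` {s..t}" using mset_eq_setD[OF ms] ns(1) by (metis insert_is_Un list.set(2) set_map Un_insert_left)
  ultimately show ?thesis by simp
qed

end

context ISK4_free_relation begin

text \<open>The model has the least number of vertices overall, because the competing subdivision
  that establishes \<open>clean\<close> contains a vertex off the wheel and is not comparable by
  inclusion.\<close>

lemma no_K4_model:
  assumes V: "finite V" "A \<subseteq> V \<times> V" and k33: "\<not> K33_in UNIV"
    and connected_on: "\<And>x. x \<in> V \<Longrightarrow> connected_on {u \<in> V. u \<noteq> x \<and> (x, u) \<notin> A}"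
  shows "\<not> K4_on A X"
proof
  assume "K4_on A X"
  then obtain X where X: "K4_on A X" and least: "\<And>Y. K4_on A Y \<Longrightarrow> card X \<le> card Y"
    using exists_least_iff[of "\<lambda>n. \<exists>X. K4_on A X \<and> card X = n"] by (metis not_less)
  have "min_K4 X" unfolding min_K4_def
    using least psubset_card_mono[OF K4_on_finite[OF X]] by (meson not_less)
  moreover have "\<not> K33_in X" using k33 unfolding K33_in_def by (meson subset_UNIV)
  ultimately obtain x C where w: "wheel A X x C" using wheel_of_minimal_K4[OF X] by blast
  define q where "q t = C ! t" for t
  define M where "M = length C - 1"
  have C: "x \<notin> set C" "distinct C" "C \<noteq> []" "(x, hd C) \<in> A" "X = insert x (set C)"
    and four: "4 \<le> card {v \<in> set C. (x, v) \<in> A}" using w unfolding wheel_def by auto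
  have len: "length C = Suc M" using C(3) unfolding M_def by (cases C) auto
  have qC: "q t \<in> set C" if "t \<le> M" for t using that len unfolding q_def by simp
  have Cq: "\<exists>t\<le>M. u = q t" if "u \<in> set C" for u
    using that len unfolding q_def in_set_conv_nth by (metis less_Suc_eq_le)
  have adj: "(q i, q j) \<in> A \<longleftrightarrow> i = Suc j \<or> j = Suc i \<or> (i = 0 \<and> j = M) \<or> (j = 0 \<and> i = M)"
    if "i \<le> M" "j \<le> M" for i j
  proof -
    have "(q i, q j) \<in> A \<longleftrightarrow> (q i, q j) \<in> edges (C @ [hd C])" using w qC that unfolding wheel_def by blast
    also have "\<dots> \<longleftrightarrow> i = Suc j \<or> j = Suc i \<or> (i = 0 \<and> j = M) \<or> (j = 0 \<and> i = M)"
      unfolding q_def using edges_cycle[OF C(2), of i j] that len by auto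
    finally show ?thesis .
  qed
  have inj: "q i = q j \<longleftrightarrow> i = j" if "i \<le> M" "j \<le> M" for i j
    unfolding q_def using nth_eq_iff_index_eq[OF C(2)] that len by auto
  have x0: "(x, q 0) \<in> A" using C(3,4) unfolding q_def by (simp add: hd_conv_nth)
  \<comment> \<open>The rim is cut after its last spoke \<open>q h\<close>. The remaining vertices
    are non-spokes and form the first closing set; they exist because \<open>q M\<close> and the
    spoke \<open>q 0\<close> are adjacent, so \<open>q M\<close> is not a spoke.\<close>
  obtain h where h: "h \<le> M" "(x, q h) \<in> A" and after: "\<And>t. h < t \<Longrightarrow> t \<le> M \<Longrightarrow> (x, q t) \<notin> A"
    using greatest_nat[of "\<lambda>t. (x, q t) \<in> A" 0 M] x0 by blast
  have M3: "3 \<le> M"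
  proof -
    have "card {v \<in> set C. (x, v) \<in> A} \<le> card (set C)" by (intro card_mono) auto
    then show ?thesis using four card_length[of C] len by linarith
  qed
  have "h \<noteq> M"
  proof
    assume "h = M"
    then have "(q h, q 0) \<in> A" using adj[of h 0] M3 by auto
    from tri_free[OF h(2) this] x0 show False by blast
  qed
  then have hM: "h < M" using h(1) by simp
  have "\<exists>m. 0 < m \<and> m < h \<and> (x, q m) \<in> A"
  proof (rule ccontr)
    assume no: "\<not> ?thesis"
    have "v \<in> {q 0, q h}" if v: "v \<in> set C" "(x, v) \<in> A" for v
    proof -
      obtain t where t: "t \<le> M" "v = q t" using Cq v(1) by blast
      then have "t \<le> h" using after[of t] v(2) by (meson not_le)
      then show ?thesis using no t v(2) by (metis insertCI le_neq_implies_less not_gr_zero)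
    qed
    then have "card {v \<in> set C. (x, v) \<in> A} \<le> card {q 0, q h}" by (intro card_mono) auto
    also have "\<dots> \<le> 2" by (simp add: card_insert_if)
    finally show False using four by simp
  qed
  then obtain m where m: "0 < m" "m < h" "(x, q m) \<in> A" by blast

  interpret P: spoke_path A q h x
  proof unfold_locales
    show "(q i, q j) \<in> A \<longleftrightarrow> i = Suc j \<or> j = Suc i" if "i \<le> h" "j \<le> h" for i j
      using adj[of i j] that hM by auto
    show "inj_on q {..h}" using inj hM by (auto simp: inj_on_def)
    show "q i \<noteq> x" if "i \<le> h" for i using qC[of i] that hM C(1) by auto
  qed (fact k33)
  define D where "D = {u \<in> V. u \<noteq> x \<and> (x, u) \<notin> A}"
  have xV: "x \<in> V" using x0 V(2) by auto
  have qV: "q t \<in> V" if "t \<le> M" for t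
  proof (cases "t = M")
    case True
    then show ?thesis using adj[of t 0] that V(2) by auto
  next
    case False
    then show ?thesis using adj[of t "Suc t"] that V(2) by auto
  qed
  have qD: "q t \<in> D" if "t \<le> M" "(x, q t) \<notin> A" for t
    using that qV qC[of t] C(1) unfolding D_def by auto
  interpret clean_spoke_path A q h x D
  proof unfold_locales
    show "finite D" using V(1) unfolding D_def by simp
    show "connected_on D" using connected_on[OF xV] unfolding D_def .
    show "u \<noteq> x \<and> (x, u) \<notin> A" if "u \<in> D" for u using that unfolding D_def by auto
    show "q t \<in> D" if "t \<le> h" "(x, q t) \<notin> A" for t using qD that hM by simp
    fix v s t a b c
    assume v: "v \<in> D" and st: "s < t" "t \<le> h" "(x, q s) \<in> A" "(x, q t) \<in> A"
      and btw: "\<And>k. s < k \<Longrightarrow> k < t \<Longrightarrow> (x, q k) \<notin> A"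
      and abc: "s \<le> a" "a < b" "b < c" "c \<le> t" "(v, q a) \<in> A" "(v, q b) \<in> A" "(v, q c) \<in> A"
    show False
    proof (cases "v \<in> set C")
      case True
      then obtain r where r: "r \<le> M" "v = q r" using Cq by blast
      have "a \<le> M" "b \<le> M" "c \<le> M" using abc st hM by linarith+
      then have "(r = Suc a \<or> a = Suc r \<or> (r = 0 \<and> a = M) \<or> (a = 0 \<and> r = M))"
        "(r = Suc b \<or> b = Suc r \<or> (r = 0 \<and> b = M) \<or> (b = 0 \<and> r = M))"
        "(r = Suc c \<or> c = Suc r \<or> (r = 0 \<and> c = M) \<or> (c = 0 \<and> r = M))"
        using adj r abc(5-7) by auto
      then show False using abc(1-4) st(1,2) hM by linarith
    next
      case False
      have "q k \<noteq> v" if "k \<le> t" for k using False qC[of k] that st hM by auto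
      then have "K4_on A ({v, x} \<union> q ` {s..t})"
        using P.sector_K4[OF abc(1-4) st(2-4) abc(5-7)] v unfolding D_def by blast
      then have "card X \<le> card ({v, x} \<union> q ` {s..t})" by (rule least)
      also have "\<dots> \<le> 2 + card (q ` {s..t})" by (intro order_trans[OF card_Un_le]) (simp add: card_insert_if)
      also have "card (q ` {s..t}) \<le> Suc t - s" using card_image_le[of "{s..t}" q] by simp
      finally have "card X \<le> 2 + (Suc t - s)" by simp
      moreover have "card X = Suc (Suc M)" using C(1,2,5) len by (simp add: distinct_card)
      \<comment> \<open>The inner spoke \<open>q m\<close> keeps the sector from being the whole
        path. Together with \<open>h < M\<close> this saves at least one vertex.\<close>
      moreover have "s \<noteq> 0 \<or> t \<noteq> h" using btw[of m] m by auto
      ultimately show False using st hM by linarith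
    qed
  qed
  have "closes 0 h (q ` {Suc h..M})"
  proof (rule closesI[of 0 m h _ "q M" "q (Suc h)"])
    show "q ` {Suc h..M} \<subseteq> D" using qD after by auto
    show "connected_on (q ` {Suc h..M})" by (rule connected_on_chain) (use adj hM in auto)
    show "q t \<notin> q ` {Suc h..M}" if "0 \<le> t" "t \<le> h" for t
    proof
      assume "q t \<in> q ` {Suc h..M}"
      then obtain s where "Suc h \<le> s" "s \<le> M" "q t = q s" by auto
      then show False using inj[of t s] that hM by auto
    qed
    show "(k, q t) \<notin> A" if "k \<in> q ` {Suc h..M}" "0 < t" "t < h" for k t
    proof -
      from that(1) obtain s where "k = q s" "Suc h \<le> s" "s \<le> M" by auto
      then show ?thesis using adj[of s t] that hM by auto
    qed
    show "(q 0, q M) \<in> A" "(q h, q (Suc h)) \<in> A" using adj hM by auto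
  qed (use m x0 h hM in auto)
  then show False using not_closes by blast
qed

end

context triangle_free_relation begin

lemma connected_on_path_set: "l \<noteq> [] \<Longrightarrow> edges l \<subseteq> A \<Longrightarrow> connected_on (set l)"
proof (induction l rule: edges.induct)
  case (1 x y l)
  then have "connected_on (insert x (set (y # l)))" by (intro connected_on_insert[of _ y x]) (auto dest: symA)
  then show ?case by simp
qed (auto simp: connected_on_singleton)

text \<open>Each vertex of a \<open>K\<^sub>3\<^sub>,\<^sub>3\<close> has degree at least three in
  \<open>X\<close>, hence lies in \<open>S\<close>. This excludes
  \<open>K\<^sub>3\<^sub>,\<^sub>3\<close> from a construction although the whole graph contains
  one.\<close>

lemma K33_degree:
  assumes "K33_in X" "finite X" "\<And>v. v \<in> X \<Longrightarrow> v \<notin> S \<Longrightarrow> degree_in v X \<le> 2" "finite S"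
  shows "6 \<le> card S"
proof -
  obtain a b c d e f where K: "distinct [a, b, c, d, e, f]" "{a, b, c, d, e, f} \<subseteq> X" "{a, b, c} \<times> {d, e, f} \<subseteq> A"
    using assms(1) unfolding K33_in_def by (elim exE conjE) (rule that)
  have big: "v \<in> S" if "v \<in> X" "T \<subseteq> X" "\<And>w. w \<in> T \<Longrightarrow> (v, w) \<in> A" "card T = 3" for v T
  proof (rule ccontr)
    assume "v \<notin> S"
    have "card T \<le> degree_in v X" unfolding degree_in_def using that assms(2) by (intro card_mono) auto
    then show False using assms(3)[OF that(1) \<open>v \<notin> S\<close>] that(4) by simp
  qed
  have "card {d, e, f} = 3" "card {a, b, c} = 3" using K(1) by auto
  moreover have "\<And>u w. u \<in> {a, b, c} \<Longrightarrow> w \<in> {d, e, f} \<Longrightarrow> (u, w) \<in> A \<and> (w, u) \<in> A" using K(3) symA by blast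
  moreover have "{a, b, c} \<subseteq> X" "{d, e, f} \<subseteq> X" using K(2) by auto
  ultimately have "u \<in> S" if "u \<in> {a, b, c} \<or> u \<in> {d, e, f}" for u
    using that big[of u "{d, e, f}"] big[of u "{a, b, c}"] by (meson subsetD)
  then have "{a, b, c, d, e, f} \<subseteq> S" by blast
  moreover have "card {a, b, c, d, e, f} = 6" using K(1) by simp
  ultimately show ?thesis using card_mono[OF assms(4)] by metis
qed

section \<open>Graphs containing \<open>K\<^sub>3\<^sub>,\<^sub>3\<close>\<close>

text \<open>Infinite sets have cardinality 0, so the bounds also make both sides finite.\<close>

definition biclique :: "'a set \<Rightarrow> 'a set \<Rightarrow> bool" where
  "biclique P Q \<longleftrightarrow> P \<inter> Q = {} \<and> 3 \<le> card P \<and> 3 \<le> card Q \<and> P \<times> Q \<subseteq> A"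

lemma biclique_sym: "biclique P Q \<Longrightarrow> biclique Q P"
  unfolding biclique_def using symA by blast

lemma biclique_finite: "biclique P Q \<Longrightarrow> finite P \<and> finite Q"
  unfolding biclique_def by (metis card.infinite not_numeral_le_zero)

lemma biclique_indep: "biclique P Q \<Longrightarrow> u \<in> P \<Longrightarrow> w \<in> P \<Longrightarrow> (u, w) \<notin> A"
proof -
  assume b: "biclique P Q" and uw: "u \<in> P" "w \<in> P"
  then have "Q \<noteq> {}" unfolding biclique_def by auto
  then obtain z where "z \<in> Q" by blast
  then have "(u, z) \<in> A" "(z, w) \<in> A" using b uw symA unfolding biclique_def by blast+
  then show ?thesis by (rule tri_free)
qed

text \<open>Two different attachments within one side, either \<open>P\<close> or \<open>Q\<close>.
  Without such an \<open>F\<close>, an outer component has at most one attachment in each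
  side.\<close>

definition two_sided :: "'a set \<Rightarrow> 'a set \<Rightarrow> 'a set \<Rightarrow> bool" where
  "two_sided P Q F \<longleftrightarrow> connected_on F \<and> F \<inter> (P \<union> Q) = {} \<and>
    (\<exists>S\<in>{P, Q}. \<exists>a1\<in>S. \<exists>a2\<in>S. a1 \<noteq> a2 \<and> (\<exists>f\<in>F. (a1, f) \<in> A) \<and> (\<exists>f\<in>F. (a2, f) \<in> A))"

lemma two_sided_sym: "two_sided P Q F \<longleftrightarrow> two_sided Q P F"
  unfolding two_sided_def by (simp add: Un_commute insert_commute)

end

context ISK4_free_relation begin

text \<open>The branch vertices are \<open>a1\<close>, \<open>a2\<close>, \<open>b1\<close>,
  \<open>b2\<close>: the path \<open>r\<close> joins the first two, \<open>a3\<close> joins the last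
  two, and four edges of the biclique complete the subdivision.\<close>

lemma biclique_ISK4:
  assumes b: "biclique P Q" and a: "a1 \<in> P" "a2 \<in> P" "a1 \<noteq> a2" "a3 \<in> P" "a3 \<noteq> a1" "a3 \<noteq> a2"
    and bs: "b1 \<in> Q" "b2 \<in> Q" "b1 \<noteq> b2"
    and r: "r \<noteq> []" "set r \<inter> (P \<union> Q) = {}" "distinct (a1 # r @ [a2])" "edges (a1 # r @ [a2]) \<subseteq> A"
    and ind: "\<And>u w. u \<in> set (a1 # r @ [a2]) \<Longrightarrow> w \<in> set (a1 # r @ [a2]) \<Longrightarrow> (u, w) \<in> A \<Longrightarrow> (u, w) \<in> edges (a1 # r @ [a2])"
    and no: "\<And>f. f \<in> set r \<Longrightarrow> (f, a3) \<notin> A \<and> (f, b1) \<notin> A \<and> (f, b2) \<notin> A"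
  shows False
proof -
  let ?l = "a1 # a2 # b1 # b2 # r @ [] @ [] @ [] @ [] @ [a3]"
  have PQ: "(u, w) \<in> A \<and> (w, u) \<in> A" if "u \<in> P" "w \<in> Q" for u w using b that symA unfolding biclique_def by blast
  have disj: "P \<inter> Q = {}" using b unfolding biclique_def by blast
  have indP: "(u, w) \<notin> A" if "u \<in> P" "w \<in> P" for u w using biclique_indep[OF b that] .
  have indQ: "(u, w) \<notin> A" if "u \<in> Q" "w \<in> Q" for u w using biclique_indep[OF biclique_sym[OF b] that] .
  have dist: "distinct ?l" using a bs r(2,3) disj by auto
  have K4: "K4_on A (set ?l)"
    by (rule K4_onI[OF dist refl]) (use PQ a bs r(4) in auto)
  have deg_a1: "degree_in a1 (set ?l) \<le> 3"
  proof -
    have "w \<in> set [hd r, b1, b2]" if w: "w \<in> set ?l" "(a1, w) \<in> A" for w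
    proof (cases "w \<in> set r")
      case True
      then have "w = hd (r @ [a2])" using ind[of a1 w] w(2) edges_hd[OF r(3)] by auto
      then show ?thesis using r(1) by simp
    qed (use w indP a in auto)
    from degree_in_le_length[of "set ?l" a1, OF this] show ?thesis by simp
  qed
  have deg_a2: "degree_in a2 (set ?l) \<le> 3"
  proof -
    have "w \<in> set [last r, b1, b2]" if w: "w \<in> set ?l" "(a2, w) \<in> A" for w
    proof (cases "w \<in> set r")
      case True
      then have "w = last (a1 # r)" using ind[of a2 w] w(2) edges_last[of "a1 # r" a2 w] r(3) by auto
      then show ?thesis using r(1) by simp
    qed (use w indP a in auto)
    from degree_in_le_length[of "set ?l" a2, OF this] show ?thesis by simp
  qed
  have deg_b: "degree_in u (set ?l) \<le> 3" if u: "u = b1 \<or> u = b2" for u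
  proof -
    have "w \<in> set [a1, a2, a3]" if w: "w \<in> set ?l" "(u, w) \<in> A" for w
    proof -
      have "w \<notin> set r" using no[of w] symA[OF w(2)] u by auto
      then show ?thesis using w u indQ bs by auto
    qed
    from degree_in_le_length[of "set ?l" u, OF this] show ?thesis by simp
  qed
  have deg: "degree_in u (set ?l) \<le> 2" if u: "u \<in> set ?l" "u \<notin> {a1, a2, b1, b2}" for u
  proof (cases "u = a3")
    case True
    have "w \<in> set [b1, b2]" if w: "w \<in> set ?l" "(u, w) \<in> A" for w
    proof -
      have "w \<notin> set r" using no[of w] symA[OF w(2)] True by auto
      then show ?thesis using w True indP a by auto
    qed
    from degree_in_le_length[of "set ?l" u, OF this] show ?thesis by simp
  next
    case False
    then have ur: "u \<in> set r" using u by auto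
    obtain e f where ef: "\<And>w. (u, w) \<in> edges (a1 # r @ [a2]) \<Longrightarrow> w \<in> {e, f}" using edges_inner[OF r(3), of u] by blast
    have "w \<in> set [e, f]" if w: "w \<in> set ?l" "(u, w) \<in> A" for w
    proof -
      have "w \<in> set (a1 # r @ [a2])" using no[OF ur] w by auto
      then show ?thesis using ef ind[of u w] ur w(2) by auto
    qed
    from degree_in_le_length[of "set ?l" u, OF this] show ?thesis by simp
  qed
  have "\<not> K33_in (set ?l)"
  proof
    assume "K33_in (set ?l)"
    then have "6 \<le> card {a1, a2, b1, b2}" by (rule K33_degree) (use deg in auto)
    also have "\<dots> \<le> 4" by (simp add: card_insert_if)
    finally show False by simp
  qed
  then show False
  proof (rule no_K4_of_small_degree[OF K4])
    fix u assume u: "u \<in> set ?l"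
    show "degree_in u (set ?l) \<le> 3"
    proof (cases "u \<in> {a1, a2, b1, b2}")
      case True
      then show ?thesis using deg_a1 deg_a2 deg_b by blast
    next
      case False
      from deg[OF u False] show ?thesis by (rule order_trans) simp
    qed
  qed
qed

text \<open>An induced path \<open>r\<close> through \<open>F\<close> joins \<open>a1\<close> to
  \<open>a2\<close>. If it has several inner vertices, removing the first or the last leaves a
  proper connected part of \<open>F\<close>, so minimality limits the other attachments.\<close>

lemma two_sided_minimal:
  assumes b: "biclique P Q" and max: "\<And>P' Q'. biclique P' Q' \<Longrightarrow> card P' + card Q' \<le> card P + card Q"
    and F: "connected_on F" "F \<inter> (P \<union> Q) = {}" and min: "\<And>F'. F' \<subset> F \<Longrightarrow> \<not> two_sided P Q F'"
    and a: "a1 \<in> P" "a2 \<in> P" "a1 \<noteq> a2" "(a1, f1) \<in> A" "f1 \<in> F" "(a2, f2) \<in> A" "f2 \<in> F"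
  shows False
proof -
  have aF: "a1 \<notin> F" "a2 \<notin> F" using F(2) a by auto
  obtain r where r: "set r \<subseteq> F" "distinct (a1 # r @ [a2])" "edges (a1 # r @ [a2]) \<subseteq> A"
    and ind: "\<And>u w. u \<in> set (a1 # r @ [a2]) \<Longrightarrow> w \<in> set (a1 # r @ [a2]) \<Longrightarrow> (u, w) \<in> A \<Longrightarrow> (u, w) \<in> edges (a1 # r @ [a2])"
    using connected_on_induced_path[OF F(1) aF a(3-7)] by blast
  have ts: "two_sided P Q F'"
    if "connected_on F'" "F' \<subseteq> F" "S \<in> {P, Q}" "u \<in> S" "w \<in> S" "u \<noteq> w" "f \<in> F'" "(u, f) \<in> A" "g \<in> F'" "(w, g) \<in> A" for F' S u w f g
    using that F(2) unfolding two_sided_def by blast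
  have r0: "r \<noteq> []" using r(3) biclique_indep[OF b a(1,2)] by auto
  have rQ: "set r \<inter> (P \<union> Q) = {}" using r(1) F(2) by auto
  have ends: "(a1, hd r) \<in> A" "(a2, last r) \<in> A" "edges r \<subseteq> A"
    using r(3) r0 edges_Cons2[of "r @ [a2]" a1] edges_snoc[OF r0, of a2] by auto
  have hdQ: "(hd r, w) \<notin> A" if "w \<in> Q" for w
  proof
    assume "(hd r, w) \<in> A"
    then have "(a1, w) \<notin> A" using tri_free[OF ends(1)] by blast
    then show False using b a(1) that unfolding biclique_def by blast
  qed
  have fP: "finite P" "finite Q" using biclique_finite[OF b] by auto
  have "\<exists>a3 b1 b2. a3 \<in> P \<and> a3 \<noteq> a1 \<and> a3 \<noteq> a2 \<and> b1 \<in> Q \<and> b2 \<in> Q \<and> b1 \<noteq> b2 \<and>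
      (\<forall>f\<in>set r. (f, a3) \<notin> A \<and> (f, b1) \<notin> A \<and> (f, b2) \<notin> A)"
  proof (cases "tl r = []")
    case True
    then obtain f where f: "r = [f]" using r0 by (cases r) auto
    \<comment> \<open>Otherwise \<open>f\<close> could be added to \<open>Q\<close>, against the
      maximality of the biclique.\<close>
    have "\<exists>a3\<in>P. (f, a3) \<notin> A"
    proof (rule ccontr)
      assume no: "\<not> ?thesis"
      have "biclique P (insert f Q)"
        using b no symA fP rQ f unfolding biclique_def by (auto simp: card_insert_if)
      moreover have "f \<notin> Q" using rQ f by auto
      ultimately show False using max[of P "insert f Q"] fP by simp
    qed
    then obtain a3 where a3: "a3 \<in> P" "(f, a3) \<notin> A" by blast
    have "a3 \<noteq> a1" "a3 \<noteq> a2" using a3 ends f symA by auto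
    moreover have "\<not> card Q \<le> Suc 0" using b unfolding biclique_def by auto
    then obtain b1 b2 where "b1 \<in> Q" "b2 \<in> Q" "b1 \<noteq> b2" using fP(2) by (auto simp: card_le_Suc0_iff_eq)
    moreover from this have "(f, b1) \<notin> A" "(f, b2) \<notin> A" using hdQ f by auto
    ultimately show ?thesis using a3 f by auto
  next
    case False
    have st: "set (tl r) \<subset> F" "set (butlast r) \<subset> F"
    proof -
      have "hd r \<in> F" "hd r \<notin> set (tl r)" "set (tl r) \<subseteq> F" using r r0 by (cases r; auto)+
      then show "set (tl r) \<subset> F" by blast
      have "last r \<in> F" using r(1) r0 by auto
      moreover have "distinct (butlast r @ [last r])" using r(2) r0 by simp
      moreover have "set (butlast r) \<subseteq> F" using r(1) by (meson in_set_butlastD subset_iff)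
      ultimately show "set (butlast r) \<subset> F" by auto
    qed
    have bl: "butlast r \<noteq> []" using False by (cases r) auto
    have c1: "connected_on (set (tl r))"
      using ends(3) False r0 edges_Cons2[OF False, of "hd r"] by (intro connected_on_path_set) auto
    have c2: "connected_on (set (butlast r))"
      using ends(3) bl r0 edges_snoc[OF bl, of "last r"] by (intro connected_on_path_set) auto
    have m1: "last r \<in> set (tl r)" using False by (metis last_in_set last_tl)
    have m2: "hd r \<in> set (butlast r)" using bl r0 by (cases r) (auto split: if_splits)
    have rt: "f = hd r \<or> f \<in> set (tl r)" if "f \<in> set r" for f using that by (cases r) auto
    \<comment> \<open>A further attachment \<open>a3\<close> is paired with \<open>a1\<close> if the
      first vertex of \<open>r\<close> sees it, and otherwise with \<open>a2\<close>; in both cases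
      a proper part of \<open>r\<close> is already two-sided.\<close>
    have noP: "(f, a3) \<notin> A" if "a3 \<in> P" "a3 \<noteq> a1" "a3 \<noteq> a2" "f \<in> set r" for a3 f
    proof
      assume fa: "(f, a3) \<in> A"
      from rt[OF that(4)] show False
      proof
        assume "f = hd r"
        then have "two_sided P Q (set (butlast r))"
          using ts[OF c2 _ _ that(1) a(1) that(2) m2 _ m2 ends(1)] st symA fa by auto
        then show False using min[OF st(2)] by blast
      next
        assume "f \<in> set (tl r)"
        then have "two_sided P Q (set (tl r))"
          using ts[OF c1 _ _ that(1) a(2) that(3) _ _ m1 ends(2), of f] st symA fa by auto
        then show False using min[OF st(1)] by blast
      qed
    qed
    \<comment> \<open>The first vertex of \<open>r\<close> sees nothing of \<open>Q\<close>, so two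
      members of \<open>W\<close> would both attach to \<open>tl r\<close>. Hence at least two
      vertices of \<open>Q\<close> are left for \<open>b1\<close> and \<open>b2\<close>.\<close>
    define W where "W = {w \<in> Q. \<exists>f\<in>set r. (f, w) \<in> A}"
    have "u = w" if uwW: "u \<in> W" "w \<in> W" for u w
    proof (rule ccontr)
      assume "u \<noteq> w"
      obtain f g where fg: "f \<in> set r" "(f, u) \<in> A" "g \<in> set r" "(g, w) \<in> A" and uw: "u \<in> Q" "w \<in> Q"
        using uwW unfolding W_def by blast
      then have "f \<in> set (tl r)" "g \<in> set (tl r)" using rt hdQ by metis+
      then have "two_sided P Q (set (tl r))"
        using ts[OF c1 _ _ uw \<open>u \<noteq> w\<close>, of f g] st symA fg by auto
      then show False using min[OF st(1)] by blast
    qed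
    then have "card W \<le> 1" using fP by (auto simp: card_le_Suc0_iff_eq W_def)
    moreover have "W \<subseteq> Q" unfolding W_def by auto
    moreover have "3 \<le> card Q" using b unfolding biclique_def by auto
    ultimately have "\<not> card (Q - W) \<le> Suc 0" using fP(2) by (simp add: card_Diff_subset finite_subset)
    then obtain b1 b2 where "b1 \<in> Q - W" "b2 \<in> Q - W" "b1 \<noteq> b2" using fP(2) by (auto simp: card_le_Suc0_iff_eq)
    moreover have "\<not> P \<subseteq> {a1, a2}"
    proof
      assume "P \<subseteq> {a1, a2}"
      then have "card P \<le> card {a1, a2}" by (intro card_mono) auto
      then show False using b unfolding biclique_def by (auto simp: card_insert_if split: if_splits)
    qed
    then obtain a3 where "a3 \<in> P" "a3 \<noteq> a1" "a3 \<noteq> a2" by blast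
    ultimately show ?thesis using noP unfolding W_def by blast
  qed
  then show False using biclique_ISK4[OF b a(1-3) _ _ _ _ _ _ r0 rQ r(2,3) ind] by blast
qed

lemma not_two_sided:
  assumes b: "biclique P Q" and max: "\<And>P' Q'. biclique P' Q' \<Longrightarrow> card P' + card Q' \<le> card P + card Q"
    and "finite F"
  shows "\<not> two_sided P Q F"
  using assms(3)
proof (induction F rule: finite_psubset_induct)
  case (psubset F)
  show ?case
  proof
    assume ts: "two_sided P Q F"
    have "\<exists>S\<in>{P, Q}. \<exists>a1\<in>S. \<exists>a2\<in>S. a1 \<noteq> a2 \<and> (\<exists>f\<in>F. (a1, f) \<in> A) \<and> (\<exists>f\<in>F. (a2, f) \<in> A)"
      using ts unfolding two_sided_def by (elim conjE)
    then obtain S a1 a2 f1 f2 where "S \<in> {P, Q}" and a: "a1 \<in> S" "a2 \<in> S" "a1 \<noteq> a2"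
      "(a1, f1) \<in> A" "f1 \<in> F" "(a2, f2) \<in> A" "f2 \<in> F" by (elim bexE conjE) (rule that)
    then have S: "S = P \<or> S = Q" by simp
    have F: "connected_on F" "F \<inter> (P \<union> Q) = {}" "F \<inter> (Q \<union> P) = {}" using ts unfolding two_sided_def by auto
    from S show False
    proof
      assume "S = P"
      from two_sided_minimal[OF b max F(1,2) psubset.IH a[unfolded this]] show False .
    next
      assume "S = Q"
      have 1: "\<not> two_sided Q P F'" if "F' \<subset> F" for F'
        using psubset.IH[OF that] two_sided_sym[of P Q F'] by simp
      have 2: "card P' + card Q' \<le> card Q + card P" if "biclique P' Q'" for P' Q'
        using max[OF that] by (simp add: add.commute)
      from two_sided_minimal[OF biclique_sym[OF b] 2 F(1,3) 1 a[unfolded \<open>S = Q\<close>]] show False .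
    qed
  qed
qed

text \<open>A maximal connected \<open>F\<close> outside the biclique is a component there. Its
  attachment set \<open>C\<close> leaves a vertex of \<open>P\<close> on the other side, since
  \<open>P\<close> has at least three vertices and at most one of them lies in
  \<open>C\<close>.\<close>

lemma K33_decomposition:
  assumes V: "finite V" "A \<subseteq> V \<times> V" and k33: "K33_in UNIV"
  shows "(\<exists>P Q. V = P \<union> Q \<and> P \<inter> Q = {} \<and> P \<noteq> {} \<and> Q \<noteq> {} \<and> A = P \<times> Q \<union> Q \<times> P)
    \<or> (\<exists>C\<subseteq>V. card C \<le> 2 \<and> (\<forall>u\<in>C. \<forall>w\<in>C. u \<noteq> w \<longrightarrow> (u, w) \<in> A) \<and> V - C \<noteq> {} \<and> \<not> connected_on (V - C))"
proof -
  have sub: "P \<subseteq> V \<and> Q \<subseteq> V" if "biclique P Q" for P Q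
  proof -
    have "P \<noteq> {}" "Q \<noteq> {}" "P \<times> Q \<subseteq> V \<times> V" using that V(2) unfolding biclique_def by auto
    then show ?thesis by blast
  qed
  obtain a b c d e f where K: "distinct [a, b, c, d, e, f]" "{a, b, c} \<times> {d, e, f} \<subseteq> A"
    using k33 unfolding K33_in_def by (elim exE conjE) (rule that)
  have "biclique {a, b, c} {d, e, f}" using K unfolding biclique_def by auto
  moreover have bound: "card P + card Q \<le> 2 * card V" if "biclique P Q" for P Q
    using sub[OF that] card_mono[OF V(1), of P] card_mono[OF V(1), of Q] by linarith
  ultimately obtain n where "\<exists>P Q. biclique P Q \<and> card P + card Q = n"
    and n: "\<And>k. n < k \<Longrightarrow> k \<le> 2 * card V \<Longrightarrow> \<not> (\<exists>P Q. biclique P Q \<and> card P + card Q = k)"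
    using greatest_nat[of "\<lambda>k. \<exists>P Q. biclique P Q \<and> card P + card Q = k" "card {a, b, c} + card {d, e, f}" "2 * card V"]
    by blast
  then obtain P Q where b: "biclique P Q" and cn: "card P + card Q = n" by blast
  have max: "card P' + card Q' \<le> card P + card Q" if "biclique P' Q'" for P' Q'
  proof (rule ccontr)
    assume "\<not> ?thesis"
    then have "n < card P' + card Q'" using cn by simp
    from n[OF this bound[OF that]] that show False by blast
  qed
  have bi: "P \<inter> Q = {}" "3 \<le> card P" "3 \<le> card Q" "P \<times> Q \<subseteq> A" using b unfolding biclique_def by auto
  show ?thesis
  proof (cases "V = P \<union> Q")
    case True
    have "A = P \<times> Q \<union> Q \<times> P"
    proof
      show "P \<times> Q \<union> Q \<times> P \<subseteq> A" using bi(4) symA by blast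
      show "A \<subseteq> P \<times> Q \<union> Q \<times> P"
      proof (rule subrelI)
        fix u w assume uw: "(u, w) \<in> A"
        then have "u \<in> P \<union> Q" "w \<in> P \<union> Q" using V(2) True by auto
        then show "(u, w) \<in> P \<times> Q \<union> Q \<times> P"
          using biclique_indep[OF b] biclique_indep[OF biclique_sym[OF b]] uw by blast
      qed
    qed
    moreover have "P \<noteq> {}" "Q \<noteq> {}" using bi by auto
    ultimately show ?thesis using True bi(1) by blast
  next
    case False
    then obtain z where z: "z \<in> V - (P \<union> Q)" using sub[OF b] by blast
    let ?FF = "{F. F \<subseteq> V - (P \<union> Q) \<and> connected_on F \<and> z \<in> F}"
    have "finite ?FF" using V(1) by simp
    moreover have "?FF \<noteq> {}" using z connected_on_singleton by auto
    ultimately have "\<exists>F\<in>?FF. \<forall>F'\<in>?FF. F \<subseteq> F' \<longrightarrow> F = F'" by (rule finite_has_maximal)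
    then obtain F where FF: "F \<in> ?FF" and Fmax0: "\<forall>F'\<in>?FF. F \<subseteq> F' \<longrightarrow> F = F'" by (rule bexE)
    have Fmax: "F = F'" if "F' \<in> ?FF" "F \<subseteq> F'" for F'
      using bspec[OF Fmax0 that(1)] that(2) by (rule mp)
    have F: "F \<subseteq> V - (P \<union> Q)" "connected_on F" "z \<in> F" using FF by auto
    have "finite F" using F(1) V(1) finite_subset by blast
    then have nts: "\<not> two_sided P Q F" using not_two_sided[OF b max] by blast
    define C where "C = {u \<in> P \<union> Q. \<exists>f\<in>F. (u, f) \<in> A}"
    have FP: "F \<inter> (P \<union> Q) = {}" using F(1) by auto
    have one: "u = w" if "u \<in> C \<inter> S" "w \<in> C \<inter> S" "S \<in> {P, Q}" for u w S
    proof (rule ccontr)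
      assume "u \<noteq> w"
      then show False using nts that F(2) FP unfolding two_sided_def C_def by blast
    qed
    have fC: "finite P" "finite Q" using biclique_finite[OF b] by auto
    have cP: "card (C \<inter> P) \<le> 1" "card (C \<inter> Q) \<le> 1"
      using one[where S = P] one[where S = Q] fC by (auto simp: card_le_Suc0_iff_eq)
    have "C = (C \<inter> P) \<union> (C \<inter> Q)" unfolding C_def by auto
    then have c2: "card C \<le> 2" using cP card_Un_le[of "C \<inter> P" "C \<inter> Q"] by simp
    have CV: "C \<subseteq> V" using sub[OF b] unfolding C_def by blast
    have clique: "(u, w) \<in> A" if "u \<in> C" "w \<in> C" "u \<noteq> w" for u w
    proof -
      have "u \<in> P \<and> w \<in> Q \<or> u \<in> Q \<and> w \<in> P" using that one[where S = P] one[where S = Q] unfolding C_def by blast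
      then show ?thesis using bi(4) symA by blast
    qed
    have "\<not> P \<subseteq> C"
    proof
      assume "P \<subseteq> C"
      then have "C \<inter> P = P" by auto
      then show False using cP(1) bi(2) by simp
    qed
    then obtain p where p: "p \<in> P" "p \<notin> C" by blast
    then have pV: "p \<in> V - C" "p \<notin> F" using sub[OF b] FP by auto
    have "F \<subseteq> V - C" using F(1) unfolding C_def by auto
    moreover have "F \<noteq> {}" "F \<noteq> V - C" using F(3) pV by auto
    moreover have "(f, w) \<notin> A" if "f \<in> F" "w \<in> (V - C) - F" for f w
    proof
      assume fw: "(f, w) \<in> A"
      show False
      proof (cases "w \<in> P \<union> Q")
        case True
        then have "w \<in> C" using that(1) symA[OF fw] unfolding C_def by blast
        then show False using that by blast
      next
        case False
        then have "insert w F \<in> ?FF" using that F connected_on_insert[OF F(2) that(1) fw] by auto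
        then have "F = insert w F" by (rule Fmax) blast
        then show False using that(2) by blast
      qed
    qed
    ultimately have "\<not> connected_on (V - C)" unfolding connected_on_def by meson
    moreover have "V - C \<noteq> {}" using pV(1) by blast
    ultimately show ?thesis using CV c2 clique by (intro disjI2 exI[of _ C] conjI ballI impI)
  qed
qed

end

section \<open>Subdivisions in the sense of the graph library\<close>

lemma edges_subset_path: "edges (a # p @ [b]) \<subseteq> ({a, b} \<union> set p) \<times> ({a, b} \<union> set p)"
  using edges_subset[of "a # p @ [b]"] by auto

text \<open>A step replaces \<open>ab\<close> by \<open>aw\<close> and \<open>wb\<close>; then
  \<open>aw\<close> is final and joins \<open>E\<close>, while \<open>wb\<close> is subdivided next.
  The edge \<open>ab\<close> must not occur in \<open>E\<close>, since the step removes it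
  altogether.\<close>

lemma subdivision_of_path:
  assumes "pair_graph \<lparr>pverts = W, parcs = E \<union> {(a, b), (b, a)}\<rparr>"
    and "distinct p" "set p \<inter> W = {}" "(a, b) \<notin> E" "(b, a) \<notin> E"
  shows "subdivision_pair \<lparr>pverts = W, parcs = E \<union> {(a, b), (b, a)}\<rparr>
      \<lparr>pverts = W \<union> set p, parcs = E \<union> edges (a # p @ [b])\<rparr>"
  using assms
proof (induction p arbitrary: a W E)
  case Nil
  interpret G: pair_graph "\<lparr>pverts = W, parcs = E \<union> {(a, b), (b, a)}\<rparr>" by fact
  have "insert (a, b) (insert (b, a) E) = E \<union> {(a, b), (b, a)}" by auto
  then show ?case using subdivision_pair_base[OF G.pair_bidirected_digraph_axioms] by simp
next
  case (Cons w p)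
  let ?G = "\<lparr>pverts = W, parcs = E \<union> {(a, b), (b, a)}\<rparr>"
  let ?E = "E \<union> {(a, w), (w, a)}"
  let ?H = "\<lparr>pverts = insert w W, parcs = ?E \<union> {(w, b), (b, w)}\<rparr>"
  interpret G: pair_graph ?G by fact
  have w: "w \<notin> W" using Cons.prems by auto
  then have wE: "(w, u) \<notin> E" "(u, w) \<notin> E" for u using G.in_arcsD1 G.in_arcsD2 by fastforce+
  have ab: "a \<in> W" "b \<in> W" using G.in_arcsD1[of a b] G.in_arcsD2[of a b] by auto
  have neq: "a \<noteq> b" using G.no_loops'[of a b] by auto
  have sub: "subdivide ?G (a, b) w = ?H"
    using Cons.prems(4,5) by (auto simp: subdivide.simps)
  have pg: "pair_graph ?H" using G.pair_graph_subdivide[of "(a, b)" w] w sub by simp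
  have "subdivision_pair ?G (subdivide ?G (a, b) w)"
    by (rule subdivision_pair_divide[OF _ _ subdivision_pair_base[OF G.pair_bidirected_digraph_axioms]]) (use w in simp_all)
  then have "subdivision_pair ?G ?H" by (simp only: sub)
  moreover have "subdivision_pair ?H \<lparr>pverts = insert w W \<union> set p, parcs = ?E \<union> edges (w # p @ [b])\<rparr>"
    by (rule Cons.IH[OF pg]) (use Cons.prems w wE ab neq in auto)
  ultimately have "subdivision_pair ?G \<lparr>pverts = insert w W \<union> set p, parcs = ?E \<union> edges (w # p @ [b])\<rparr>"
    by (rule subdivision_trans)
  moreover have "insert w W \<union> set p = W \<union> set (w # p)" "?E \<union> edges (w # p @ [b]) = E \<union> edges (a # (w # p) @ [b])" by auto
  ultimately show ?case by simp
qed

lemma subdivision_of_path_step: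
  assumes S: "subdivision_pair B \<lparr>pverts = W, parcs = E'\<rparr>" and B: "pair_graph B" and E: "E' = E \<union> {(a, b), (b, a)}"
    and "distinct p" "set p \<inter> W = {}" "(a, b) \<notin> E" "(b, a) \<notin> E"
  shows "subdivision_pair B \<lparr>pverts = W \<union> set p, parcs = E \<union> edges (a # p @ [b])\<rparr>"
proof -
  have "pair_graph \<lparr>pverts = W, parcs = E'\<rparr>" using pair_graph.pair_graph_subdivision[OF B S] .
  from subdivision_of_path[OF this[unfolded E] assms(4-7)] S show ?thesis unfolding E by (metis subdivision_trans)
qed

lemma K4_model_is_subdivision:
  assumes M: "K4_model A X B D a b c d p q r s t z"
  shows "is_subdivision_of_K4 \<lparr>pverts = X, parcs = D\<rparr>"
proof -
  have dist: "distinct (a # b # c # d # p @ q @ r @ s @ t @ z)" using K4_modelD(7)[OF M] .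
  have neq: "distinct [a, b, c, d]" using dist by auto
  let ?e = "\<lambda>x y. {(x, y), (y, x)}"
  let ?W = "{a, b, c, d}"
  let ?P = "edges (a # p @ [b])" let ?Q = "edges (a # q @ [c])" let ?R = "edges (a # r @ [d])"
  let ?S = "edges (b # s @ [c])" let ?T = "edges (b # t @ [d])" let ?Z = "edges (c # z @ [d])"
  define K where "K = \<lparr>pverts = ?W, parcs = ?e a b \<union> ?e a c \<union> ?e a d \<union> ?e b c \<union> ?e b d \<union> ?e c d\<rparr>"
  have K4: "K\<^bsub>4\<^esub> (with_proj K)"
    unfolding complete_digraph_pair_def K_def using neq by auto
  have pgK: "pair_graph K" using pair_graphI_complete[OF K4] .
  \<comment> \<open>A branch edge still to be treated is not among the edges of a path already
    inserted, as that path contains only its own two branch vertices.\<close>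
  have esub: "(x, y) \<notin> edges (u # l @ [v])" if "{x, y} \<noteq> {u, v}" "x \<in> ?W" "y \<in> ?W" "set l \<inter> ?W = {}" "x \<noteq> y" for x y u v l
    using edges_subset_path[of u l v] that by auto
  have ints: "set p \<inter> ?W = {}" "set q \<inter> ?W = {}" "set r \<inter> ?W = {}" "set s \<inter> ?W = {}" "set t \<inter> ?W = {}" "set z \<inter> ?W = {}"
    using dist by auto
  have 0: "subdivision_pair K \<lparr>pverts = ?W, parcs = ?e a b \<union> ?e a c \<union> ?e a d \<union> ?e b c \<union> ?e b d \<union> ?e c d\<rparr>"
    using subdivision_pair_base[of K] pgK unfolding K_def by (simp add: pair_graph_def pair_bidirected_digraph_def pair_digraph_def pair_pseudo_graph_def)
  note step = subdivision_of_path_step[OF _ pgK]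
  have 1: "subdivision_pair K \<lparr>pverts = ?W \<union> set p, parcs = (?e a c \<union> ?e a d \<union> ?e b c \<union> ?e b d \<union> ?e c d) \<union> ?P\<rparr>"
    by (rule step[OF 0]) (use dist neq ints in auto)
  have 2: "subdivision_pair K \<lparr>pverts = ?W \<union> set p \<union> set q, parcs = (?e a d \<union> ?e b c \<union> ?e b d \<union> ?e c d \<union> ?P) \<union> ?Q\<rparr>"
    by (rule step[OF 1]) (use dist neq ints esub in \<open>auto simp: doubleton_eq_iff\<close>)
  have 3: "subdivision_pair K \<lparr>pverts = ?W \<union> set p \<union> set q \<union> set r, parcs = (?e b c \<union> ?e b d \<union> ?e c d \<union> ?P \<union> ?Q) \<union> ?R\<rparr>"
    by (rule step[OF 2]) (use dist neq ints esub in \<open>auto simp: doubleton_eq_iff\<close>)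
  have 4: "subdivision_pair K \<lparr>pverts = ?W \<union> set p \<union> set q \<union> set r \<union> set s, parcs = (?e b d \<union> ?e c d \<union> ?P \<union> ?Q \<union> ?R) \<union> ?S\<rparr>"
    by (rule step[OF 3]) (use dist neq ints esub in \<open>auto simp: doubleton_eq_iff\<close>)
  have 5: "subdivision_pair K \<lparr>pverts = ?W \<union> set p \<union> set q \<union> set r \<union> set s \<union> set t, parcs = (?e c d \<union> ?P \<union> ?Q \<union> ?R \<union> ?S) \<union> ?T\<rparr>"
    by (rule step[OF 4]) (use dist neq ints esub in \<open>auto simp: doubleton_eq_iff\<close>)
  have 6: "subdivision_pair K \<lparr>pverts = ?W \<union> set p \<union> set q \<union> set r \<union> set s \<union> set t \<union> set z,
      parcs = (?P \<union> ?Q \<union> ?R \<union> ?S \<union> ?T) \<union> ?Z\<rparr>"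
    by (rule step[OF 5]) (use dist neq ints esub in \<open>auto simp: doubleton_eq_iff\<close>)
  have "X = ?W \<union> set p \<union> set q \<union> set r \<union> set s \<union> set t \<union> set z" "D = (?P \<union> ?Q \<union> ?R \<union> ?S \<union> ?T) \<union> ?Z"
    using M unfolding K4_model_def by auto
  then show ?thesis unfolding is_subdivision_of_K4_def using K4 6 by auto
qed

lemma edges_insert:
  assumes "(u, v) \<in> edges (a # p @ [b])" "distinct (a # p @ [b])"
  shows "\<exists>p'. mset p' = add_mset w (mset p) \<and>
    edges (a # p' @ [b]) \<subseteq> (edges (a # p @ [b]) - {(u, v), (v, u)}) \<union> {(u, w), (w, u), (v, w), (w, v)}"
  using assms
proof (induction p arbitrary: a)
  case Nil
  then show ?case by (intro exI[of _ "[w]"]) auto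
next
  case (Cons y p)
  show ?case
  proof (cases "{u, v} = {a, y}")
    case True
    have "a \<notin> set (y # p @ [b])" using Cons.prems(2) by auto
    then have "(u, v) \<notin> edges (y # p @ [b])" "(v, u) \<notin> edges (y # p @ [b])"
      using True edges_subset[of "y # p @ [b]"] by (auto simp: doubleton_eq_iff)
    then show ?thesis using True by (intro exI[of _ "w # y # p"]) (auto simp: doubleton_eq_iff)
  next
    case False
    then have "(u, v) \<in> edges (y # p @ [b])" using Cons.prems(1) by (auto simp: doubleton_eq_iff)
    then obtain p' where p': "mset p' = add_mset w (mset p)"
      "edges (y # p' @ [b]) \<subseteq> (edges (y # p @ [b]) - {(u, v), (v, u)}) \<union> {(u, w), (w, u), (v, w), (w, v)}"
      using Cons.IH Cons.prems(2) by auto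
    then show ?thesis using False by (intro exI[of _ "y # p'"]) (auto simp: doubleton_eq_iff)
  qed
qed

text \<open>Only the path through the subdivided edge changes. Any other path shares at most one
  vertex with it and so cannot contain the edge.\<close>

lemma K4_on_subdivide_first:
  assumes M: "K4_model A X B D a b c d p q r s t z" and irr: "\<And>x. (x, x) \<notin> A"
    and uv: "(u, v) \<in> edges (a # p @ [b])" and w: "w \<notin> X"
  shows "K4_on ((A - {(u, v), (v, u)}) \<union> {(u, w), (w, u), (w, v), (v, w)}) (insert w X)"
proof -
  let ?A = "(A - {(u, v), (v, u)}) \<union> {(u, w), (w, u), (w, v), (v, w)}"
  note m = K4_modelD[OF M]
  have "distinct (a # p @ [b])" using m(7) by auto
  from edges_insert[OF uv this, of w] obtain p' where p': "mset p' = add_mset w (mset p)"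
    "edges (a # p' @ [b]) \<subseteq> (edges (a # p @ [b]) - {(u, v), (v, u)}) \<union> {(u, w), (w, u), (v, w), (w, v)}" by blast
  have neq: "u \<noteq> v" using uv m(1) irr by auto
  have uvs: "u \<in> {a, b} \<union> set p" "v \<in> {a, b} \<union> set p" using uv edges_subset_path[of a p b] by auto
  have other: "edges (x # l @ [y]) \<subseteq> ?A"
    if "edges (x # l @ [y]) \<subseteq> A" "\<not> (u \<in> {x, y} \<union> set l \<and> v \<in> {x, y} \<union> set l)" for x y l
    using that edges_subset_path[of x l y] by auto
  have dd: "u = v" if "u \<in> S" "v \<in> S" "S \<inter> ({a, b} \<union> set p) \<subseteq> {e}" for S e using that uvs by auto
  have other': "edges (x # l @ [y]) \<subseteq> ?A"
    if "edges (x # l @ [y]) \<subseteq> A" "({x, y} \<union> set l) \<inter> ({a, b} \<union> set p) \<subseteq> {e}" for x y l e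
  proof (rule other[OF that(1)], rule notI, elim conjE)
    assume "u \<in> {x, y} \<union> set l" "v \<in> {x, y} \<union> set l"
    from dd[OF this that(2)] neq show False by contradiction
  qed
  have ms: "mset (a # b # c # d # p' @ q @ r @ s @ t @ z) = mset (w # a # b # c # d # p @ q @ r @ s @ t @ z)"
    using p'(1) by simp
  have "distinct (w # a # b # c # d # p @ q @ r @ s @ t @ z)" using m(7,8) w by simp
  then have dist: "distinct (a # b # c # d # p' @ q @ r @ s @ t @ z)" using mset_eq_imp_distinct_iff[OF ms] by blast
  have X: "insert w X = set (a # b # c # d # p' @ q @ r @ s @ t @ z)" using mset_eq_setD[OF ms] m(8) by simp
  show ?thesis
  proof (rule K4_onI[OF dist X])
    show "edges (a # p' @ [b]) \<subseteq> ?A" using p'(2) m(1) by auto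
    show "edges (a # q @ [c]) \<subseteq> ?A"
      by (rule other'[OF m(2), where e = a]) (use m(7) in \<open>simp, blast\<close>)
    show "edges (a # r @ [d]) \<subseteq> ?A"
      by (rule other'[OF m(3), where e = a]) (use m(7) in \<open>simp, blast\<close>)
    show "edges (b # s @ [c]) \<subseteq> ?A"
      by (rule other'[OF m(4), where e = b]) (use m(7) in \<open>simp, blast\<close>)
    show "edges (b # t @ [d]) \<subseteq> ?A"
      by (rule other'[OF m(5), where e = b]) (use m(7) in \<open>simp, blast\<close>)
    \<comment> \<open>This path is disjoint from the changed one, so \<open>e = a\<close> is an
      arbitrary choice.\<close>
    show "edges (c # z @ [d]) \<subseteq> ?A"
      by (rule other'[OF m(6), where e = a]) (use m(7) in \<open>simp, blast\<close>)
  qed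
qed

text \<open>If the model avoids the edge, it survives unchanged on \<open>X\<close>, without
  \<open>w\<close>; hence an inclusion for \<open>Y\<close>.\<close>

lemma K4_on_subdivide:
  assumes M: "K4_model A X B D a b c d p q r s t z" and irr: "\<And>x. (x, x) \<notin> A" and w: "w \<notin> X"
  shows "\<exists>Y\<subseteq>insert w X. K4_on ((A - {(u, v), (v, u)}) \<union> {(u, w), (w, u), (w, v), (v, w)}) Y"
proof (cases "(u, v) \<in> D")
  case False
  then have "(v, u) \<notin> D" using K4_model_sym[OF M] by blast
  moreover have "D \<subseteq> A" using M unfolding K4_model_def by (elim conjE)
  ultimately have "D \<subseteq> (A - {(u, v), (v, u)}) \<union> {(u, w), (w, u), (w, v), (v, w)}" using False by auto
  then have "K4_model ((A - {(u, v), (v, u)}) \<union> {(u, w), (w, u), (w, v), (v, w)}) X B D a b c d p q r s t z"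
    using M unfolding K4_model_def by (elim conjE) (intro conjI)
  then have "K4_on ((A - {(u, v), (v, u)}) \<union> {(u, w), (w, u), (w, v), (v, w)}) X"
    unfolding K4_on_def by (intro exI)
  then show ?thesis by (intro exI[of _ X] conjI subset_insertI)
next
  case True
  have D: "D = edges (a # p @ [b]) \<union> edges (a # q @ [c]) \<union> edges (a # r @ [d])
      \<union> edges (b # s @ [c]) \<union> edges (b # t @ [d]) \<union> edges (c # z @ [d])" using M unfolding K4_model_def by (elim conjE)
  from True[unfolded D] have "K4_on ((A - {(u, v), (v, u)}) \<union> {(u, w), (w, u), (w, v), (v, w)}) (insert w X)"
  proof (elim UnE)
    assume "(u, v) \<in> edges (a # p @ [b])"
    from K4_on_subdivide_first[OF M irr this w] show ?thesis .
  next
    assume "(u, v) \<in> edges (a # q @ [c])"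
    from K4_on_subdivide_first[OF K4_model_swap23[OF M] irr this w] show ?thesis .
  next
    assume "(u, v) \<in> edges (a # r @ [d])"
    from K4_on_subdivide_first[OF K4_model_swap23[OF K4_model_swap34[OF M]] irr this w] show ?thesis .
  next
    assume "(u, v) \<in> edges (b # s @ [c])"
    from K4_on_subdivide_first[OF K4_model_swap23[OF K4_model_swap12[OF M]] irr this w] show ?thesis .
  next
    assume "(u, v) \<in> edges (b # t @ [d])"
    from K4_on_subdivide_first[OF K4_model_swap23[OF K4_model_swap34[OF K4_model_swap12[OF M]]] irr this w] show ?thesis .
  next
    assume "(u, v) \<in> edges (c # z @ [d])"
    from K4_on_subdivide_first[OF K4_model_swap_pairs[OF M] irr this w] show ?thesis .
  qed
  then show ?thesis by (intro exI[of _ "insert w X"] conjI order_refl)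
qed

lemma subdivision_of_K4_has_model:
  assumes "subdivision_pair B H" "K\<^bsub>4\<^esub> (with_proj B)"
  shows "\<exists>X\<subseteq>pverts H. K4_on (parcs H) X"
  using assms(1)
proof (induction rule: subdivision_pair_induct)
  case base
  have B: "card (pverts B) = 4" "parcs B = {(u, v). (u, v) \<in> (pverts B \<times> pverts B) \<and> u \<noteq> v}"
    using assms(2) unfolding complete_digraph_pair_def by auto
  then obtain l where l: "set l = pverts B" "distinct l" "length l = 4"
    by (metis card.infinite distinct_card finite_distinct_list zero_neq_numeral)
  then obtain a b c d where "l = [a, b, c, d]" by (auto simp: numeral_eq_Suc length_Suc_conv)
  then have "K4_on (parcs B) (set l)"
    using l B(2) by (intro K4_onI[of a b c d "[]" "[]" "[]" "[]" "[]" "[]"]) auto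
  then show ?case using l by blast
next
  case (divide e w H)
  obtain u v where e: "e = (u, v)" by (cases e)
  interpret H: pair_bidirected_digraph H by (rule bidirected_digraphI_subdivision) fact
  obtain X where X: "X \<subseteq> pverts H" "K4_on (parcs H) X" using divide.IH by blast
  have irr: "(x, x) \<notin> parcs H" for x using H.no_loops' by blast
  have w: "w \<notin> X" using X(1) divide.hyps by auto
  obtain B' D a b c d p q r s t z where M: "K4_model (parcs H) X B' D a b c d p q r s t z"
    using X(2) unfolding K4_on_def by (elim exE) (rule that)
  from K4_on_subdivide[OF M irr w, of u v] obtain Y where
    "Y \<subseteq> insert w X" "K4_on ((parcs H - {(u, v), (v, u)}) \<union> {(u, w), (w, u), (w, v), (v, w)}) Y" by blast
  then show ?case using X(1) unfolding e arcs_subdivide verts_subdivide by (intro exI[of _ Y]) auto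
qed

lemma K4_on_mono: "K4_on A X \<Longrightarrow> A \<subseteq> A' \<Longrightarrow> K4_on A' X"
proof -
  assume K: "K4_on A X" and sub: "A \<subseteq> A'"
  obtain B D a b c d p q r s t z where "K4_model A X B D a b c d p q r s t z"
    using K unfolding K4_on_def by (elim exE) (rule that)
  from K4_modelD[OF this] show ?thesis using sub by (intro K4_onI) auto
qed

lemma fst_ed: "fst ` edges (a # p @ [b]) = {a, b} \<union> set p"
proof (induction p arbitrary: a)
  case (Cons y p)
  have "edges (a # (y # p) @ [b]) = insert (a, y) (insert (y, a) (edges (y # p @ [b])))" by simp
  then show ?case using Cons.IH[of y] by auto
qed auto

lemma K4_model_field:
  assumes M: "K4_model A X B D a b c d p q r s t z"
  shows "fst ` D = X" "D \<subseteq> X \<times> X"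
proof -
  have D: "D = edges (a # p @ [b]) \<union> edges (a # q @ [c]) \<union> edges (a # r @ [d])
      \<union> edges (b # s @ [c]) \<union> edges (b # t @ [d]) \<union> edges (c # z @ [d])" using M unfolding K4_model_def by (elim conjE)
  show 1: "fst ` D = X" unfolding D K4_modelD(8)[OF M] image_Un fst_ed by auto
  show "D \<subseteq> X \<times> X"
  proof (rule subrelI)
    fix x y assume "(x, y) \<in> D"
    moreover from this have "(y, x) \<in> D" using K4_model_sym[OF M] by blast
    ultimately show "(x, y) \<in> X \<times> X" using 1 by force
  qed
qed

text \<open>Its contrapositive yields cutsets. The library defines connectivity by reachability in
  the symmetric closure, and a set without outgoing edges is closed under reachability.\<close>

lemma (in triangle_free_relation) connected_imp_conn:
  assumes "connected (with_proj G \<restriction> S)" "parcs G = A"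
  shows "connected_on S"
  unfolding connected_on_def
proof (intro allI impI)
  fix L assume L: "L \<subseteq> S" "L \<noteq> {}" "L \<noteq> S"
  let ?H = "mk_symmetric (with_proj G \<restriction> S)"
  show "\<exists>u\<in>L. \<exists>v\<in>S - L. (u, v) \<in> A"
  proof (rule ccontr)
    assume no: "\<not> ?thesis"
    obtain u v where uv: "u \<in> L" "v \<in> S - L" using L by blast
    have "u \<rightarrow>\<^sup>*\<^bsub>with_proj ?H\<^esub> v"
      using assms(1) uv L(1) unfolding connected_def strongly_connected_def by (auto simp: mk_symmetric_def)
    then have "(u, v) \<in> rtrancl_on (verts (with_proj ?H)) (arcs_ends (with_proj ?H))" unfolding reachable_def .
    then have "v \<in> L"
    proof (induction rule: rtrancl_on_induct)
      case (step w w')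
      then have "(w, w') \<in> A \<and> w' \<in> S"
        using symA assms(2) by (auto simp: mk_symmetric_def induce_subgraph_def arcs_ends_def arc_to_ends_def)
      then show ?case using no step by blast
    qed (use uv in simp)
    then show False using uv by blast
  qed
qed

theorem theorem2p2:
  fixes G :: "'a pair_pre_digraph"
  assumes "pair_graph G"
    and "triangle_free G"
    and "ISK4_free G"
  shows "series_parallel G
    \<or> complete_bipartite G
    \<or> (\<exists>C. clique_cutset G C \<and> card C \<le> 2)
    \<or> (\<exists>C. star_cutset G C)"
proof -
  interpret G: pair_graph G by fact
  let ?A = "parcs G"
  let ?V = "pverts G"
  have V: "finite ?V" "?A \<subseteq> ?V \<times> ?V" using G.in_arcsD1 G.in_arcsD2 G.pair_finite_verts by auto
  interpret triangle_free_relation ?A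
  proof unfold_locales
    show "(y, x) \<in> ?A" if "(x, y) \<in> ?A" for x y using that G.arcs_symmetric by blast
    show irr: "(x, x) \<notin> ?A" for x using G.no_loops' by blast
    show "(x, z) \<notin> ?A" if xy: "(x, y) \<in> ?A" "(y, z) \<in> ?A" for x y z
    proof
      assume xz: "(x, z) \<in> ?A"
      let ?H = "\<lparr>pverts = {x, y, z}, parcs = {(x, y), (y, x), (y, z), (z, y), (x, z), (z, x)}\<rparr>"
      have neq: "x \<noteq> y" "y \<noteq> z" "x \<noteq> z" using xy xz irr by auto
      have sub: "(y, x) \<in> ?A" "(z, y) \<in> ?A" "(z, x) \<in> ?A" using xy xz G.arcs_symmetric by blast+
      have K3: "K\<^bsub>3\<^esub> (with_proj ?H)" unfolding complete_digraph_pair_def using neq by auto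
      then interpret H: pair_graph ?H by (rule pair_graphI_complete)
      have arcs: "parcs ?H = {e \<in> ?A. fst e \<in> {x, y, z} \<and> snd e \<in> {x, y, z}}"
      proof
        show "parcs ?H \<subseteq> {e \<in> ?A. fst e \<in> {x, y, z} \<and> snd e \<in> {x, y, z}}" using xy xz sub by simp
        show "{e \<in> ?A. fst e \<in> {x, y, z} \<and> snd e \<in> {x, y, z}} \<subseteq> parcs ?H"
        proof (rule subrelI)
          fix s t assume st: "(s, t) \<in> {e \<in> ?A. fst e \<in> {x, y, z} \<and> snd e \<in> {x, y, z}}"
          then have "s \<noteq> t" using irr[of s] by auto
          then show "(s, t) \<in> parcs ?H" using st by auto
        qed
      qed
      have "{x, y, z} \<subseteq> ?V" using xy xz V(2) by blast
      moreover have "parcs ?H \<subseteq> ?A" unfolding arcs by blast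
      ultimately have "induced_subgraph (with_proj ?H) (with_proj G)"
        unfolding induced_subgraph_def subgraph_def
        using arcs H.wf_digraph_axioms G.wf_digraph_axioms compatibleI_with_proj by simp
      then show False using K3 assms(2) unfolding triangle_free_def by blast
    qed
  qed
  interpret ISK4_free_relation ?A
  proof unfold_locales
    fix X B D a b c d p q r s t z
    assume M: "K4_model ?A X B D a b c d p q r s t z"
    show "\<not> ?A \<inter> X \<times> X \<subseteq> D"
    proof
      assume ind: "?A \<inter> X \<times> X \<subseteq> D"
      let ?H = "\<lparr>pverts = X, parcs = D\<rparr>"
      have DA: "D \<subseteq> ?A" using M unfolding K4_model_def by (elim conjE)
      note f = K4_model_field[OF M]
      have D: "D = {e \<in> ?A. fst e \<in> X \<and> snd e \<in> X}" using ind DA f(2) by auto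
      have "X \<subseteq> ?V" using f(1) DA V(2) by auto
      moreover have "pair_wf_digraph ?H" using f(2) by unfold_locales auto
      then have "wf_digraph (with_proj ?H)" unfolding wf_digraph_wp_iff .
      ultimately have "induced_subgraph (with_proj ?H) (with_proj G)"
        unfolding induced_subgraph_def subgraph_def
        using DA D G.wf_digraph_axioms compatibleI_with_proj by auto
      then show False using K4_model_is_subdivision[OF M] assms(3) unfolding ISK4_free_def ISK4_of_def by blast
    qed
  qed
  have cut: "cutset G C" if "C \<subseteq> ?V" "?V - C \<noteq> {}" "\<not> connected_on (?V - C)" for C
    using that connected_imp_conn[of G "?V - C"] unfolding cutset_def disconnected_def by auto
  show ?thesis
  proof (cases "K33_in UNIV")
    case True
    from K33_decomposition[OF V True] show ?thesis
    proof
      assume "\<exists>P Q. ?V = P \<union> Q \<and> P \<inter> Q = {} \<and> P \<noteq> {} \<and> Q \<noteq> {} \<and> ?A = P \<times> Q \<union> Q \<times> P"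
      then obtain P Q where PQ: "?V = P \<union> Q" "P \<inter> Q = {}" "P \<noteq> {}" "Q \<noteq> {}" "?A = P \<times> Q \<union> Q \<times> P" by blast
      then have "finite P" "finite Q" using V(1) by auto
      then have "1 \<le> card P" "1 \<le> card Q" using PQ(3,4) by (simp_all add: Suc_le_eq card_gt_0_iff)
      moreover have "K\<^bsub>card P,card Q\<^esub> (with_proj G)"
        unfolding complete_bipartite_digraph_pair_def using V(1) PQ by blast
      ultimately show ?thesis unfolding complete_bipartite_def by blast
    next
      assume "\<exists>C\<subseteq>?V. card C \<le> 2 \<and> (\<forall>u\<in>C. \<forall>w\<in>C. u \<noteq> w \<longrightarrow> (u, w) \<in> ?A) \<and> ?V - C \<noteq> {} \<and> \<not> connected_on (?V - C)"
      then obtain C where C: "C \<subseteq> ?V" "card C \<le> 2" "\<forall>u\<in>C. \<forall>w\<in>C. u \<noteq> w \<longrightarrow> (u, w) \<in> ?A" "?V - C \<noteq> {}" "\<not> connected_on (?V - C)"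
        by blast
      then have "clique_cutset G C" using cut unfolding clique_cutset_def clique_def by blast
      then show ?thesis using C(2) by blast
    qed
  next
    case False
    show ?thesis
    proof (cases "\<forall>x\<in>?V. connected_on {u \<in> ?V. u \<noteq> x \<and> (x, u) \<notin> ?A}")
      case True
      have noK4: "\<not> K4_on ?A X" for X using no_K4_model[OF V False] True by blast
      have "series_parallel G"
        unfolding series_parallel_def
      proof
        assume "\<exists>H :: 'a pair_pre_digraph. subgraph (with_proj H) (with_proj G) \<and> is_subdivision_of_K4 H"
        then obtain H B :: "'a pair_pre_digraph" where H: "subgraph (with_proj H) (with_proj G)"
          "K\<^bsub>4\<^esub> (with_proj B)" "subdivision_pair B H" unfolding is_subdivision_of_K4_def by blast
        from subdivision_of_K4_has_model[OF H(3,2)] obtain X where "K4_on (parcs H) X" by blast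
        moreover have "parcs H \<subseteq> ?A" using H(1) unfolding subgraph_def by simp
        ultimately show False using K4_on_mono noK4 by blast
      qed
      then show ?thesis by blast
    next
      case no: False
      then obtain x where x: "x \<in> ?V" "\<not> connected_on {u \<in> ?V. u \<noteq> x \<and> (x, u) \<notin> ?A}" by blast
      define C where "C = {u \<in> ?V. u = x \<or> (x, u) \<in> ?A}"
      have VC: "?V - C = {u \<in> ?V. u \<noteq> x \<and> (x, u) \<notin> ?A}" unfolding C_def by auto
      \<comment> \<open>The complement of \<open>C\<close> is not connected and therefore nonempty,
        as \<open>disconnected\<close> demands.\<close>
      have "connected_on {}" unfolding connected_on_def by blast
      then have "?V - C \<noteq> {}" using x(2) unfolding VC by force
      then have "cutset G C" by (intro cut) (use x(2) VC C_def in auto)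
      moreover have "x \<in> C" "\<forall>v\<in>C. v \<noteq> x \<longrightarrow> (x, v) \<in> ?A" using x(1) unfolding C_def by auto
      ultimately have "star_cutset G C" unfolding star_cutset_def by blast
      then show ?thesis by blast
    qed
  qed
qed

end
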